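(* Let $\mathbb{Z}[\mathrm{i}]\subset\mathbb{C}\cong\mathbb{R}^2$ be the square lattice (Gaussian integers, with the standard Euclidean inner product). For $n\ge1$ let $a_\square(n)$ be the number of well-rounded sublattices of $\mathbb{Z}[\mathrm{i}]$ of index $n$, and let $\Phi_{\square,\mathsf{wr}}(s)=\sum_{n\ge1}a_\square(n)n^{-s}$. Put $\Phi_\square(s)=\zeta(s)L(s,\chi_{-4})$, $\Phi^{\mathsf{pr}}_\square(s)=\zeta(s)L(s,\chi_{-4})/\zeta(2s)$, $$\Phi_{\mathsf{wr},\mathrm{even}}(s)=\frac{2}{2^s}\sum_{p\in\mathbb{N}}\ \sum_{q\in\mathbb{N},\ p<q<\sqrt3\,p}\frac{1}{p^sq^s}\,\Phi^{\mathsf{pr}}_\square(s),$$ $$\Phi_{\mathsf{wr},\mathrm{odd}}(s)=\frac{2}{1+2^{-s}}\,\Phi^{\mathsf{pr}}_\square(s)\sum_{k\in\mathbb{N}}\ \sum_{\ell\in\mathbb{N},\ k<\ell<\sqrt3 k+\frac{\sqrt3-1}{2}}\frac{1}{(2k+1)^s(2\ell+1)^s}.$$ Then $\Phi_{\square,\mathsf{wr}}(s)=\Phi_\square(s)+\Phi_{\mathsf{wr},\mathrm{even}}(s)+\Phi_{\mathsf{wr},\mathrm{odd}}(s)$. The function $\Phi_{\square,\mathsf{wr}}$ is meromorphic in the half plane $\{\mathrm{Re}(s)>\tfrac12\}$, with a pole of order $2$ at $s=1$ and no other pole in $\{\mathrm{Re}(s)\ge1\}$. For real $s>1$, $$D_\square(s)-\Phi_\square(s)<\Phi_{\square,\mathsf{wr}}(s)<D_\square(s)+\Phi_\square(s),$$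 where $$D_\square(s)=\frac{2+2^s}{1+2^s}\cdot\frac{1-\sqrt3^{\,1-s}}{s-1}\cdot\frac{L(s,\chi_{-4})}{\zeta(2s)}\,\zeta(s)\,\zeta(2s-1).$$ Consequently $A_\square(x)=\sum_{n\le x}a_\square(n)$ satisfies $A_\square(x)=\frac{\log 3}{2\pi}\,x\log x+o(x\log x)$ as $x\to\infty$.
   Context: A lattice in $\mathbb{R}^2$ is well-rounded if its non-zero vectors of minimal length span $\mathbb{R}^2$; a sublattice means a subgroup of finite index. $\mathbb{N}=\{1,2,3,\dots\}$. $\zeta$ is the Riemann zeta function, and $L(s,\chi_{-4})=\sum_{n\ge1}\chi_{-4}(n)n^{-s}$ where $\chi_{-4}(n)=0$ for $n$ even, $1$ for $n\equiv1\pmod 4$, $-1$ for $n\equiv3\pmod4$. *)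

theory Defs
  imports
    "HOL-Algebra.Coset"
    "HOL-Complex_Analysis.Complex_Analysis"
    "HOL-Library.Landau_Symbols"
begin

definition minimal_vectors :: "'a::real_normed_vector set \<Rightarrow> 'a set" where
  "minimal_vectors L = {v \<in> L. v \<noteq> 0 \<and> (\<forall>w\<in>L. w \<noteq> 0 \<longrightarrow> norm v \<le> norm w)}"

definition well_rounded :: "'a::real_normed_vector set \<Rightarrow> bool" where
  "well_rounded L \<longleftrightarrow> span (minimal_vectors L) = UNIV"

definition square_lattice :: "complex monoid" where
  "square_lattice = \<lparr>carrier = {z. Re z \<in> \<int> \<and> Im z \<in> \<int>}, monoid.mult = (+), one = 0\<rparr>"

definition sublattice :: "complex set \<Rightarrow> bool" where
  "sublattice L \<longleftrightarrow> subgroup L square_lattice \<and> finite (rcosets\<^bsub>square_lattice\<^esub> L)"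

definition a_square :: "nat \<Rightarrow> nat" where
  "a_square n =
     card {L. sublattice L \<and> well_rounded L \<and> card (rcosets\<^bsub>square_lattice\<^esub> L) = n}"

text \<open>
  The series below are polymorphic so that they can be used with complex as well as with
  real argument. A Dirichlet series starts at index 1, hence the shift, and its terms are
  summed in their natural order.
\<close>

definition dirichlet_series :: "(nat \<Rightarrow> 'a) \<Rightarrow> 'a \<Rightarrow> 'a::{ln, real_normed_field}" where
  "dirichlet_series a s = (\<Sum>n. a (Suc n) * of_nat (Suc n) powr (- s))"

definition chi4 :: "nat \<Rightarrow> 'a::ring_1" where
  "chi4 n = (if even n then 0 else if n mod 4 = 1 then 1 else - 1)"

text \<open>The series defines the Riemann zeta function only for real part of \<open>s\<close> greater than 1.\<close>

definition zeta :: "'a \<Rightarrow> 'a::{ln, real_normed_field}" where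
  "zeta s = dirichlet_series (\<lambda>_. 1) s"

definition L_chi4 :: "'a \<Rightarrow> 'a::{ln, real_normed_field}" where
  "L_chi4 s = dirichlet_series chi4 s"

definition Phi_square_wr :: "'a \<Rightarrow> 'a::{ln, real_normed_field}" where
  "Phi_square_wr s = dirichlet_series (\<lambda>n. of_nat (a_square n)) s"

definition Phi_square :: "'a \<Rightarrow> 'a::{ln, real_normed_field}" where
  "Phi_square s = zeta s * L_chi4 s"

definition Phi_square_pr :: "complex \<Rightarrow> complex" where
  "Phi_square_pr s = zeta s * L_chi4 s / zeta (2 * s)"

definition Phi_wr_even :: "complex \<Rightarrow> complex" where
  "Phi_wr_even s = 2 / 2 powr s *
     (\<Sum>\<^sub>\<infinity>p\<in>{1..}. \<Sum>q\<in>{q::nat. p < q \<and> real q < sqrt 3 * real p}.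
        1 / (of_nat p powr s * of_nat q powr s)) * Phi_square_pr s"

definition Phi_wr_odd :: "complex \<Rightarrow> complex" where
  "Phi_wr_odd s = 2 / (1 + 2 powr (- s)) * Phi_square_pr s *
     (\<Sum>\<^sub>\<infinity>k\<in>{1..}. \<Sum>l\<in>{l::nat. k < l \<and> real l < sqrt 3 * real k + (sqrt 3 - 1) / 2}.
        1 / (of_nat (2 * k + 1) powr s * of_nat (2 * l + 1) powr s))"

definition D_square :: "real \<Rightarrow> real" where
  "D_square s = (2 + 2 powr s) / (1 + 2 powr s) * ((1 - sqrt 3 powr (1 - s)) / (s - 1)) *
     (L_chi4 s / zeta (2 * s)) * zeta s * zeta (2 * s - 1)"

definition A_square :: "real \<Rightarrow> nat" where
  "A_square x = (\<Sum>n | 1 \<le> n \<and> real n \<le> x. a_square n)"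

end

theory Submission
  imports
    Defs
    "HOL-Computational_Algebra.Squarefree"
    "HOL-Number_Theory.Number_Theory"
    "HOL-Real_Asymp.Real_Asymp"
begin

text \<open>
  A well-rounded sublattice of index \<open>n\<close> has exactly four positively oriented bases \<open>v, w\<close> of minimal
  vectors. The diagonals of the rhombus spanned
    by \<open>v\<close> and \<open>w\<close> are orthogonal, so \<open>v + w = a z\<close> and
  \<open>w - v = b i z\<close> with \<open>a, b\<close> positive integers, \<open>z\<close> a primitive Gaussian integer and \<open>2 n = a b |z|\<^sup>2\<close>;
  minimality of \<open>v\<close> and \<open>w\<close> means that \<open>a\<close> and \<open>b\<close> differ
    by a factor less than \<open>sqrt 3\<close>. The case
  \<open>a = b\<close> gives the square sublattices, counted
    by Jacobi's two-square theorem, and the cases \<open>a, b\<close>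
  even and \<open>a, b\<close> odd give the other two Dirichlet series.

  For fixed \<open>p\<close> the inner sum over \<open>p < q < sqrt 3 p\<close> is a Riemann sum. Its difference from the integral of
  \<open>t powr - s\<close> is of order \<open>p powr - Re s\<close>, which after summation over \<open>p\<close> is holomorphic for
  \<open>Re s > 1/2\<close>, while the integral contributes \<open>zeta (2 s - 1)\<close> and hence the second pole at 1. For real
  \<open>s\<close> the lower and upper Riemann sums give the two bounds. The asymptotic formula is obtained without a
  Tauberian theorem: primitive Gaussian integers have a density (from the Leibniz series and Moebius
  inversion), and summing it against \<open>1 / (p q)\<close> over the admissible pairs produces \<open>x log x\<close>.
\<close>

section \<open>Sums of two squares\<close>

text \<open>Strictness in the bound by \<open>sqrt 3\<close> loses nothing: equality would be a
  hexagonal sublattice, which the irrationality of sqrt 3 excludes. A quarter turn of the basis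
  exchanges acute and obtuse angles, so \<open>4 * a_square n\<close> is the number of orthogonal
  bases plus twice the number of obtuse ones, and only \<open>a < b\<close> has to be counted. For
  \<open>a = 2 p\<close>, \<open>b = 2 q\<close> the equation \<open>2 n = a b |z|^2\<close> reads
  \<open>n = 2 p q |z|^2\<close>; for odd \<open>a\<close>, \<open>b\<close> one has
  \<open>z = (1 + i) y\<close> and \<open>n = a b |y|^2\<close> with \<open>y\<close> primitive of
  odd norm. Hence the factors 2^(-s) and 1/(1 + 2^(-s)). The half plane Re s > 1/2 is where three
  things hold at once: 2 s lies in Re > 1, where zeta has no zero; 2 s - 1 lies in Re > 0, where (s
  - 1) zeta(s) is continued by elementary means; and the error series converges. In the asymptotics
  the primitive and the odd primitive elements have densities 6/pi and 4/pi, and the harmonic sums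
  over the pairs are (log 3 / 4) log x and (log 3 / 16) log x. With the shift x/2 of the even case,
  1/2 (1/2 * 6/pi * log 3 / 4 + 4/pi * log 3 / 16) = log 3 / (2 pi).\<close>

definition gnorm :: "int \<times> int \<Rightarrow> nat" where
  "gnorm z = nat ((fst z)\<^sup>2 + (snd z)\<^sup>2)"

text \<open>Gaussian multiplication in integer coordinates; staying in \<open>int\<close> keeps
  divisibility and parity at hand, and \<open>emb\<close> passes to the complex plane later.\<close>

definition gmul :: "int \<times> int \<Rightarrow> int \<times> int \<Rightarrow> int \<times> int" where
  "gmul u z = (fst u * fst z - snd u * snd z, fst u * snd z + snd u * fst z)"

definition repr2 :: "nat \<Rightarrow> nat" where
  "repr2 n = card {z. gnorm z = n}"

definition chi_sum :: "nat \<Rightarrow> int" where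
  "chi_sum n = (\<Sum>d | d dvd n. chi4 d)"

lemma int_gnorm: "int (gnorm z) = (fst z)\<^sup>2 + (snd z)\<^sup>2"
  by (simp add: gnorm_def)

lemma gnorm_eq_iff: "gnorm z = n \<longleftrightarrow> (fst z)\<^sup>2 + (snd z)\<^sup>2 = int n"
  by (metis int_gnorm of_nat_eq_iff)

lemma gnorm_gmul: "gnorm (gmul u z) = gnorm u * gnorm z"
proof -
  have "int (gnorm (gmul u z)) = int (gnorm u * gnorm z)"
    by (simp add: int_gnorm gmul_def power2_eq_square algebra_simps)
  then show ?thesis by (simp only: of_nat_eq_iff)
qed

lemma gnorm_eq_0_iff: "gnorm z = 0 \<longleftrightarrow> z = (0, 0)"
  by (cases z) (simp add: gnorm_eq_iff sum_power2_eq_zero_iff)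

lemma finite_gnorm_le: "finite {z. gnorm z \<le> n}"
proof -
  have le: "\<bar>x\<bar> \<le> int n" if "x\<^sup>2 + y\<^sup>2 \<le> int n" for x y :: int
  proof -
    have "\<bar>x\<bar> \<le> x\<^sup>2"
    proof (cases "x = 0")
      case False
      then have "\<bar>x\<bar> * 1 \<le> \<bar>x\<bar> * \<bar>x\<bar>"
        by (intro mult_left_mono) auto
      then show ?thesis by (simp add: power2_eq_square)
    qed simp
    moreover have "y\<^sup>2 \<ge> 0" by simp
    ultimately show ?thesis using that by linarith
  qed
  have "{z. gnorm z \<le> n} \<subseteq> {- int n..int n} \<times> {- int n..int n}"
  proof
    fix z assume "z \<in> {z. gnorm z \<le> n}"
    then have *: "(fst z)\<^sup>2 + (snd z)\<^sup>2 \<le> int n" by (simp flip: int_gnorm)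
    show "z \<in> {- int n..int n} \<times> {- int n..int n}"
      using le[OF *] le[of "snd z" "fst z"] * by (cases z) (auto simp: add.commute)
  qed
  then show ?thesis by (rule finite_subset) auto
qed

lemma finite_gnorm_eq: "finite {z. gnorm z = n}"
  by (rule finite_subset[OF _ finite_gnorm_le[of n]]) auto

text \<open>The multiplicative norm rules out zero divisors.\<close>

lemma inj_gmul:
  assumes "u \<noteq> (0, 0)"
  shows "inj (gmul u)"
proof (rule injI)
  fix z w assume eq: "gmul u z = gmul u w"
  have "gmul u (fst z - fst w, snd z - snd w) = (0, 0)"
    using eq by (simp add: gmul_def algebra_simps)
  then have "gnorm u * gnorm (fst z - fst w, snd z - snd w) = 0"
    by (simp flip: gnorm_gmul add: gnorm_eq_0_iff)
  then show "z = w"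
    using assms by (auto simp: gnorm_eq_0_iff prod_eq_iff)
qed

lemma card_image_gmul:
  assumes "u \<noteq> (0, 0)"
  shows "card (gmul u ` {z. gnorm z = n}) = repr2 n"
  using card_image[OF inj_on_subset[OF inj_gmul[OF assms]]] by (simp add: repr2_def)

lemma prime_mod4_cases:
  fixes p :: nat
  assumes "prime p"
  shows "p = 2 \<or> p mod 4 = 1 \<or> p mod 4 = 3"
proof -
  have "p = 2 \<or> odd p" using prime_odd_nat[OF assms] prime_ge_2_nat[OF assms]
    by (cases "p = 2") simp_all
  moreover have "p mod 4 = 1 \<or> p mod 4 = 3" if "odd p" using that by presburger
  ultimately show ?thesis by blast
qed

text \<open>Euler's criterion at -1: the Legendre symbol is given by the parity of (p - 1)/2, and p
  > 2 keeps 1 and -1 apart.\<close>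

lemma QuadRes_minus_one:
  assumes "prime p" "2 < p"
  shows "QuadRes (int p) (- 1) \<longleftrightarrow> p mod 4 = 1"
proof -
  have odd: "p mod 4 = 1 \<or> p mod 4 = 3"
    using prime_mod4_cases[OF assms(1)] assms(2) by auto
  have ndvd: "\<not> [- 1 = 0] (mod int p)"
    using assms by (simp add: cong_0_iff)
  have "[Legendre (- 1) (int p) = (- 1) ^ ((p - 1) div 2)] (mod int p)"
    using euler_criterion[of p "- 1"] assms by simp
  moreover have "[(1::int) = - 1] (mod int p) \<longleftrightarrow> False"
    using assms by (auto simp: cong_iff_dvd_diff zdvd_not_zless)
  moreover have "[- 1 = (1::int)] (mod int p) \<longleftrightarrow> False"
    using calculation(2) cong_sym by blast
  moreover have "even ((p - 1) div 2) \<longleftrightarrow> p mod 4 = 1"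
    using odd by presburger
  ultimately show ?thesis
    using ndvd by (cases "even ((p - 1) div 2)") (auto simp: Legendre_def split: if_splits)
qed

text \<open>Thue's pigeonhole argument.\<close>

lemma prime_two_squares:
  assumes "prime p" "p mod 4 = 1"
  obtains a b :: int where "a\<^sup>2 + b\<^sup>2 = int p"
proof -
  have p2: "2 < p" using assms prime_ge_2_nat[of p] by (cases "p = 2") auto
  then obtain t where t: "[t\<^sup>2 = - 1] (mod int p)"
    using QuadRes_minus_one[OF assms(1)] assms(2) by (auto simp: QuadRes_def)
  define k where "k = floor_sqrt p"
  have kp: "k\<^sup>2 \<le> p" "p < (Suc k)\<^sup>2"
    by (auto simp: k_def floor_sqrt_power2_le Suc_floor_sqrt_power2_gt)
  \<comment> \<open>A prime is not a square; this makes x^2 + y^2 < 2 p strict below, so that the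
    multiple of p can only be p itself.\<close>
  have "k\<^sup>2 \<noteq> p"
    using assms(1) by (auto simp: prime_power_iff)
  then have kp': "k\<^sup>2 < p" using kp by simp
  define S where "S = {0..int k} \<times> {0..int k}"
  define f where "f = (\<lambda>z. (fst z - t * snd z) mod int p)"
  have "card (f ` S) \<le> card {0..<int p}"
    using p2 by (intro card_mono) (auto simp: f_def)
  also have "\<dots> < card S"
    using kp by (simp add: S_def card_cartesian_product power2_eq_square nat_add_distrib)
  finally have "\<not> inj_on f S" using pigeonhole by blast
  then obtain z w where zw: "z \<in> S" "w \<in> S" "f z = f w" "z \<noteq> w"
    by (auto simp: inj_on_def)
  define x y where "x = fst z - fst w" and "y = snd z - snd w"
  have "int p dvd x - t * y"
    using zw(3) by (simp add: f_def x_def y_def mod_eq_dvd_iff algebra_simps)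
  \<comment> \<open>The left part expands to x^2 + y^2, the terms with t cancelling.\<close>
  then have "int p dvd (x - t * y) * (x + t * y) + y\<^sup>2 * (t\<^sup>2 - (- 1))"
    using t by (intro dvd_add dvd_mult2 dvd_mult) (auto simp: cong_iff_dvd_diff)
  then have "int p dvd x\<^sup>2 + y\<^sup>2" by (simp add: algebra_simps power2_eq_square)
  then obtain m where m: "x\<^sup>2 + y\<^sup>2 = int p * m" by (auto simp: dvd_def)
  have pos: "0 < x\<^sup>2 + y\<^sup>2"
    using zw(4) by (simp add: sum_power2_gt_zero_iff x_def y_def prod_eq_iff)
  have ab: "\<bar>x\<bar> \<le> int k" "\<bar>y\<bar> \<le> int k" using zw
    by (auto simp: S_def x_def y_def)
  have "x\<^sup>2 \<le> (int k)\<^sup>2" "y\<^sup>2 \<le> (int k)\<^sup>2"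
    using power_mono[OF ab(1), of 2] power_mono[OF ab(2), of 2] by simp_all
  then have "x\<^sup>2 + y\<^sup>2 < 2 * int p" using kp' by (simp flip: of_nat_power)
  then have pm: "int p * m < int p * 2" "int p * 0 < int p * m" using m pos p2 by simp_all
  have "m < 2" by (rule mult_left_less_imp_less[OF pm(1)]) simp
  moreover have "0 < m" by (rule mult_left_less_imp_less[OF pm(2)]) simp
  ultimately have "m = 1" by simp
  then show ?thesis using m that by simp
qed

lemma chi4_eq: "chi4 n = (if n mod 4 = 1 then 1 else if n mod 4 = 3 then - 1 else 0 :: 'a :: ring_1)"
proof -
  have "even n \<longleftrightarrow> n mod 4 \<noteq> 1 \<and> n mod 4 \<noteq> 3" by presburger
  then show ?thesis unfolding chi4_def by auto
qed

lemma chi4_mult: "chi4 (m * n) = (chi4 m * chi4 n :: int)"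
proof -
  have *: "(m * n) mod 4 = (i * j) mod 4" if "m mod 4 = i" "n mod 4 = j" for i j
    using that by (metis mod_mult_eq)
  have "m mod 4 = 0 \<or> m mod 4 = 1 \<or> m mod 4 = 2 \<or> m mod 4 = 3"
    "n mod 4 = 0 \<or> n mod 4 = 1 \<or> n mod 4 = 2 \<or> n mod 4 = 3" by presburger+
  then show ?thesis unfolding chi4_eq by (elim disjE) (simp_all add: *)
qed

text \<open>The divisors of p n are those of n together with p times those of n; the overlap
  consists of the p e with e dividing n / p.\<close>

lemma chi_sum_Hecke:
  assumes "prime p" "0 < n"
  shows "chi_sum (p * n) = (1 + chi4 p) * chi_sum n
           - chi4 p * (if p dvd n then chi_sum (n div p) else 0)"
proof -
  have p0: "p > 0" using assms(1) prime_gt_0_nat by blast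
  have fin: "finite {d. d dvd n}" using assms by simp
  have un: "{d. d dvd p * n} = {d. d dvd n} \<union> (*) p ` {d. d dvd n}"
  proof (intro subset_antisym subsetI)
    fix d assume "d \<in> {d. d dvd p * n}"
    then have d: "d dvd p * n" by simp
    show "d \<in> {d. d dvd n} \<union> (*) p ` {d. d dvd n}"
    proof (cases "p dvd d")
      case True
      then obtain e where "d = p * e" by (auto simp: dvd_def)
      then show ?thesis using d p0 by auto
    next
      case False
      then have "coprime d p" using assms(1) by (metis prime_imp_coprime coprime_commute)
      then show ?thesis using d coprime_dvd_mult_right_iff by blast
    qed
  qed auto
  have int: "{d. d dvd n} \<inter> (*) p ` {d. d dvd n}
      = (if p dvd n then (*) p ` {d. d dvd n div p} else {})"
    using p0 by (auto simp: dvd_div_iff_mult mult.commute elim: dvd_mult_right dvd_mult_left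
        dest: dvd_mult_right dvd_mult_left)
  have img: "(\<Sum>d\<in>(*) p ` A. chi4 d) = chi4 p * (\<Sum>d\<in>A. chi4 d :: int)" for A
    using p0 by (subst sum.reindex) (auto simp: inj_on_def chi4_mult sum_distrib_left)
  have "chi_sum (p * n) = chi_sum n + chi4 p * chi_sum n
      - (\<Sum>d\<in>{d. d dvd n} \<inter> (*) p ` {d. d dvd n}. chi4 d)"
    unfolding chi_sum_def un using fin by (subst sum_Un) (auto simp: img)
  then show ?thesis unfolding int
    by (cases "p dvd n") (simp_all only: img chi_sum_def if_True if_False sum.empty,
        simp_all add: algebra_simps)
qed

text \<open>An element of even norm is divisible by 1 + i, which has norm 2.\<close>

lemma repr2_double: "repr2 (2 * n) = repr2 n"
proof -
  have "{z. gnorm z = 2 * n} = gmul (1, 1) ` {z. gnorm z = n}"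
  proof (intro subset_antisym subsetI)
    fix z assume "z \<in> {z. gnorm z = 2 * n}"
    then have *: "(fst z)\<^sup>2 + (snd z)\<^sup>2 = 2 * int n" by (simp add: gnorm_eq_iff)
    then have "even ((fst z)\<^sup>2 + (snd z)\<^sup>2)" by simp
    then have ev: "even (fst z + snd z)" by simp
    define w where "w = ((fst z + snd z) div 2, (snd z - fst z) div 2)"
    have w: "2 * fst w = fst z + snd z" "2 * snd w = snd z - fst z"
      using ev by (auto simp: w_def)
    have z: "z = gmul (1, 1) w"
      using w by (auto simp: gmul_def prod_eq_iff)
    then have "2 * gnorm w = 2 * n"
      using * gnorm_gmul[of "(1,1)" w] by (simp add: gnorm_eq_iff) (simp add: gnorm_def)
    then show "z \<in> gmul (1, 1) ` {z. gnorm z = n}" using z by auto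
  qed (auto simp: gnorm_gmul, simp add: gnorm_def)
  then show ?thesis using card_image_gmul[of "(1,1)" n] by (simp add: repr2_def)
qed

text \<open>Dividing by p lowers the norm by p^2. \<open>P\<close> is a parameter because the lemma
  serves twice: with \<open>True\<close> for inert primes, and with membership in both prime ideals
  above p for split primes.\<close>

lemma mult_p_repr:
  assumes "p > 0" "\<And>z. gnorm z = m \<Longrightarrow> P z \<longleftrightarrow> int p dvd fst z \<and> int p dvd snd z"
  shows "card {z. gnorm z = m \<and> P z} = (if p\<^sup>2 dvd m then repr2 (m div p\<^sup>2) else 0)"
proof -
  have gp: "gnorm (gmul (int p, 0) z) = p\<^sup>2 * gnorm z" for z
    by (simp add: gnorm_gmul) (simp add: gnorm_def flip: of_nat_power)
  have "{z. gnorm z = m \<and> P z} = gmul (int p, 0) ` {z. p\<^sup>2 * gnorm z = m}"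
  proof (intro subset_antisym subsetI)
    fix z assume "z \<in> {z. gnorm z = m \<and> P z}"
    then have z: "gnorm z = m" "int p dvd fst z" "int p dvd snd z" using assms(2)[of z] by auto
    then obtain x y where "fst z = int p * x" "snd z = int p * y" by (auto simp: dvd_def)
    then have zz: "z = gmul (int p, 0) (x, y)" by (simp add: gmul_def prod_eq_iff)
    then show "z \<in> gmul (int p, 0) ` {z. p\<^sup>2 * gnorm z = m}"
      using z(1) gp by auto
  next
    fix z assume "z \<in> gmul (int p, 0) ` {z. p\<^sup>2 * gnorm z = m}"
    then obtain w where w: "z = gmul (int p, 0) w" "p\<^sup>2 * gnorm w = m" by auto
    then have "gnorm z = m" using gp by simp
    then show "z \<in> {z. gnorm z = m \<and> P z}" using assms(2)[of z] w by (auto simp: gmul_def)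
  qed
  moreover have "{z. p\<^sup>2 * gnorm z = m} = (if p\<^sup>2 dvd m then {z. gnorm z = m div p\<^sup>2} else {})"
    using assms(1) by auto
  ultimately show ?thesis
    using card_image_gmul[of "(int p, 0)"] assms(1) by (auto simp: repr2_def)
qed

text \<open>Inert primes: if p divided x^2 + y^2 but not x, then y/x would be a square root of -1
  modulo p.\<close>

lemma repr2_prime_3_mod_4:
  assumes "prime p" "p mod 4 = 3"
  shows "repr2 (p * n) = (if p dvd n then repr2 (n div p) else 0)"
proof -
  have p2: "2 < p" using assms prime_ge_2_nat[of p] by (cases "p = 2") auto
  have pp: "prime (int p)" using assms by simp
  have *: "int p dvd x" if "int p dvd x\<^sup>2 + y\<^sup>2" for x y :: int
  proof (rule ccontr)
    assume nd: "\<not> int p dvd x"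
    then have "coprime x (int p)" using pp by (metis prime_imp_coprime coprime_commute)
    then obtain u where u: "[x * u = 1] (mod int p)"
      using cong_solve_coprime_int by blast
    have "[(x\<^sup>2 + y\<^sup>2) * u\<^sup>2 = 0] (mod int p)" using that
      by (simp add: cong_0_iff)
    moreover have "[(x * u)\<^sup>2 = 1\<^sup>2] (mod int p)" using u cong_pow by blast
    ultimately have "[(x\<^sup>2 + y\<^sup>2) * u\<^sup>2 - (x * u)\<^sup>2 = 0 - 1\<^sup>2] (mod int p)"
      by (rule cong_diff)
    then have "[(y * u)\<^sup>2 = - 1] (mod int p)" by (simp add: algebra_simps power_mult_distrib)
    then have "QuadRes (int p) (- 1)" by (auto simp: QuadRes_def)
    then show False using QuadRes_minus_one[OF assms(1) p2] assms(2) by simp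
  qed
  have "int p dvd fst z \<and> int p dvd snd z" if "gnorm z = p * n" for z
    using that *[of "fst z" "snd z"] *[of "snd z" "fst z"] by (simp add: gnorm_eq_iff add.commute)
  then have "card {z. gnorm z = p * n \<and> True}
      = (if p\<^sup>2 dvd p * n then repr2 (p * n div p\<^sup>2) else 0)"
    using p2 by (intro mult_p_repr) auto
  then show ?thesis using p2 by (simp add: repr2_def power2_eq_square)
qed

text \<open>Split primes: p = (a + b i)(a - b i), and an element whose norm is divisible by p is a
  multiple of one of the two factors. Inclusion-exclusion applies, the common multiples being the
  multiples of p.\<close>

lemma repr2_prime_1_mod_4:
  assumes "prime p" "p mod 4 = 1"
  shows "int (repr2 (p * n)) = 2 * int (repr2 n) - (if p dvd n then int (repr2 (n div p)) else 0)"
proof -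
  have p2: "2 < p" using assms prime_ge_2_nat[of p] by (cases "p = 2") auto
  have pp: "prime (int p)" using assms by simp
  obtain a b where ab: "a\<^sup>2 + b\<^sup>2 = int p" using prime_two_squares[OF assms] .
  \<comment> \<open>The condition on the right says that p divides the real part of z times the
    conjugate of c + d i. The squares of real and imaginary part add up to a multiple of p, so the
    imaginary part is divisible as well and z can be divided by c + d i.\<close>
  have mem: "z \<in> gmul (c, d) ` {z. gnorm z = n} \<longleftrightarrow> int p dvd c * fst z + d * snd z"
    if cd: "c\<^sup>2 + d\<^sup>2 = int p" and z: "gnorm z = p * n" for c d z
  proof
    assume "z \<in> gmul (c, d) ` {z. gnorm z = n}"
    then obtain w where w: "z = gmul (c, d) w" by auto
    have "c * fst z + d * snd z = (c\<^sup>2 + d\<^sup>2) * fst w"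
      unfolding w by (simp add: gmul_def algebra_simps power2_eq_square)
    then show "int p dvd c * fst z + d * snd z" using cd by simp
  next
    assume dv: "int p dvd c * fst z + d * snd z"
    have "(c * snd z - d * fst z)\<^sup>2
        = (c\<^sup>2 + d\<^sup>2) * ((fst z)\<^sup>2 + (snd z)\<^sup>2) - (c * fst z + d * snd z)\<^sup>2"
      by (simp add: algebra_simps power2_eq_square)
    then have "int p dvd (c * snd z - d * fst z)\<^sup>2" using cd dv
      by (simp add: power2_eq_square)
    then have "int p dvd c * snd z - d * fst z" using pp prime_dvd_power by blast
    then obtain x y where xy: "c * fst z + d * snd z = int p * x" "c * snd z - d * fst z = int p * y"
      using dv by (auto simp: dvd_def)
    have "int p * fst z = c * (c * fst z + d * snd z) - d * (c * snd z - d * fst z)"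
      unfolding cd[symmetric] by (simp add: algebra_simps power2_eq_square)
    also have "\<dots> = int p * (c * x - d * y)" unfolding xy by (simp add: algebra_simps)
    finally have "int p * fst z = int p * (c * x - d * y)" .
    moreover have "int p * snd z = c * (c * snd z - d * fst z) + d * (c * fst z + d * snd z)"
      unfolding cd[symmetric] by (simp add: algebra_simps power2_eq_square)
    then have "int p * snd z = int p * (c * y + d * x)" unfolding xy by (simp add: algebra_simps)
    ultimately have zz: "z = gmul (c, d) (x, y)"
      using p2 by (simp add: gmul_def prod_eq_iff)
    have "gnorm (c, d) = p" using cd by (simp add: gnorm_eq_iff)
    then have "gnorm (x, y) = n" using z gnorm_gmul[of "(c,d)" "(x,y)"] p2 by (simp add: zz)
    then show "z \<in> gmul (c, d) ` {z. gnorm z = n}" using zz by auto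
  qed
  define A where "A = gmul (a, b) ` {z. gnorm z = n}"
  define B where "B = gmul (a, - b) ` {z. gnorm z = n}"
  have gab: "gnorm (a, b) = p" "gnorm (a, - b) = p" using ab by (auto simp: gnorm_eq_iff)
  have ab0: "(a, b) \<noteq> (0, 0)" "(a, - b) \<noteq> (0, 0)" using ab p2 by auto
  have nd: "\<not> int p dvd a" "\<not> int p dvd b"
  proof -
    have *: "\<not> int p dvd c" if "c\<^sup>2 + d\<^sup>2 = int p" for c d
    proof
      assume pc: "int p dvd c"
      then have "int p dvd c\<^sup>2" by (simp add: power2_eq_square)
      then have "int p dvd d\<^sup>2" using that
        by (metis dvd_add_times_triv_left_iff dvd_add_right_iff dvd_refl)
      then have "int p dvd d" using pp prime_dvd_power by blast
      with pc obtain x y where "c = int p * x" "d = int p * y" by (auto simp: dvd_def)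
      then have "int p * (int p * (x\<^sup>2 + y\<^sup>2)) = int p * 1"
        using that by (simp add: algebra_simps power2_eq_square)
      then have "int p * (x\<^sup>2 + y\<^sup>2) = 1" using p2 by simp
      then have "int p dvd 1" by (metis dvd_triv_left)
      then show False using p2 by simp
    qed
    show "\<not> int p dvd a" "\<not> int p dvd b" using *[of a b] *[of b a] ab
      by (auto simp: add.commute)
  qed
  have un: "{z. gnorm z = p * n} = A \<union> B"
  proof (intro subset_antisym subsetI)
    fix z assume "z \<in> {z. gnorm z = p * n}"
    then have z: "gnorm z = p * n" by simp
    \<comment> \<open>The product of the two test values vanishes modulo p, so the prime p divides
      one of them.\<close>
    have "(a * fst z + b * snd z) * (a * fst z + (- b) * snd z)
        = a\<^sup>2 * ((fst z)\<^sup>2 + (snd z)\<^sup>2) - (snd z)\<^sup>2 * (a\<^sup>2 + b\<^sup>2)"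
      by (simp add: algebra_simps power2_eq_square)
    then have "int p dvd (a * fst z + b * snd z) * (a * fst z + (- b) * snd z)"
      using z ab by (simp add: gnorm_eq_iff)
    then have "int p dvd a * fst z + b * snd z \<or> int p dvd a * fst z + (- b) * snd z"
      using pp prime_dvd_mult_iff by blast
    then show "z \<in> A \<union> B" using mem[of a b z] mem[of a "- b" z] z ab
      by (auto simp: A_def B_def)
  qed (auto simp: A_def B_def gnorm_gmul gab)
  have "A \<inter> B = {z. gnorm z = p * n \<and> z \<in> A \<inter> B}" using un by auto
  also have "card \<dots> = (if p\<^sup>2 dvd p * n then repr2 (p * n div p\<^sup>2) else 0)"
  proof (rule mult_p_repr)
    fix z assume z: "gnorm z = p * n"
    have "z \<in> A \<inter> B \<longleftrightarrow> int p dvd a * fst z + b * snd z \<and> int p dvd a * fst z + (- b) * snd z"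
      using mem[of a b z] mem[of a "- b" z] z ab by (auto simp: A_def B_def)
    also have "\<dots> \<longleftrightarrow> int p dvd fst z \<and> int p dvd snd z"
    proof
      assume *: "int p dvd a * fst z + b * snd z \<and> int p dvd a * fst z + (- b) * snd z"
      have np2: "\<not> int p dvd 2" using p2 by (simp add: zdvd_not_zless)
      have "int p dvd 2 * (a * fst z)" "int p dvd 2 * (b * snd z)"
        using dvd_add[OF conjunct1[OF *] conjunct2[OF *]] dvd_diff[OF conjunct1[OF *] conjunct2[OF *]]
        by (simp_all add: algebra_simps)
      then show "int p dvd fst z \<and> int p dvd snd z"
        using nd np2 pp by (simp add: prime_dvd_mult_iff)
    qed auto
    finally show "z \<in> A \<inter> B \<longleftrightarrow> int p dvd fst z \<and> int p dvd snd z" .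
  qed (use p2 in simp)
  finally have cAB: "card (A \<inter> B) = (if p dvd n then repr2 (n div p) else 0)"
    using p2 by (simp add: power2_eq_square)
  have fin: "finite A" "finite B" by (auto simp: A_def B_def finite_gnorm_eq)
  have "card A + card B = card (A \<union> B) + card (A \<inter> B)" using card_Un_Int[OF fin] .
  moreover have "card A = repr2 n" "card B = repr2 n"
    using card_image_gmul ab0 by (auto simp: A_def B_def)
  ultimately show ?thesis using cAB un by (auto simp: repr2_def split: if_splits)
qed

text \<open>Both sides satisfy the same Hecke recursion \<open>f(pn) = (1 + \<chi>(p)) f(n) - \<chi>(p) f(n/p)\<close>.\<close>

theorem repr2_eq_chi_sum: "0 < n \<Longrightarrow> int (repr2 n) = 4 * chi_sum n"
proof (induction n rule: less_induct)
  case (less n)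
  show ?case
  proof (cases "n = 1")
    case True
    have "{z. gnorm z = 1} = {(1, 0), (- 1, 0), (0, 1), (0, - 1)}"
    proof (intro subset_antisym subsetI)
      fix z assume "z \<in> {z. gnorm z = 1}"
      then have *: "(fst z)\<^sup>2 + (snd z)\<^sup>2 = 1" by (simp add: gnorm_eq_iff)
      moreover have "(fst z)\<^sup>2 \<ge> 0" "(snd z)\<^sup>2 \<ge> 0" by auto
      ultimately have "(fst z)\<^sup>2 \<le> 1" "(snd z)\<^sup>2 \<le> 1" by linarith+
      then have "\<bar>fst z\<bar> \<le> 1" "\<bar>snd z\<bar> \<le> 1"
        by (auto simp: abs_square_le_1)
      then have "fst z \<in> {-1, 0, 1}" "snd z \<in> {-1, 0, 1}" by auto
      then show "z \<in> {(1, 0), (- 1, 0), (0, 1), (0, - 1)}" using * by (cases z) auto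
    qed (auto simp: gnorm_def)
    then have "repr2 1 = 4" by (simp add: repr2_def)
    moreover have "chi_sum 1 = 1" by (simp add: chi_sum_def chi4_def)
    ultimately show ?thesis using True by simp
  next
    case False
    then obtain p where p: "prime p" "p dvd n" using prime_factor_nat by blast
    then obtain m where m: "n = p * m" by (auto simp: dvd_def)
    have m0: "0 < m" "m < n"
      using less.prems m prime_gt_1_nat[OF p(1)] by auto
    have IH1: "int (repr2 m) = 4 * chi_sum m" using less.IH m0 by blast
    have IH2: "int (repr2 (m div p)) = 4 * chi_sum (m div p)" if "p dvd m"
    proof (rule less.IH)
      show "m div p < n" using m0 div_le_dividend[of m p] by linarith
      show "0 < m div p" using that m0 by (metis dvd_div_eq_0_iff neq0_conv)
    qed
    note H = chi_sum_Hecke[OF p(1) m0(1)]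
    consider "p = 2" | "p mod 4 = 1" | "p mod 4 = 3" using prime_mod4_cases[OF p(1)] by blast
    then show ?thesis
    proof cases
      case 1
      then show ?thesis using H repr2_double[of m] IH1 m by (simp add: chi4_def)
    next
      case 2
      then have "chi4 p = (1 :: int)" by (auto simp: chi4_def) presburger
      then show ?thesis using H repr2_prime_1_mod_4[OF p(1) 2, of m] IH1 IH2 m by auto
    next
      case 3
      then have "chi4 p = (- 1 :: int)" by (auto simp: chi4_def) presburger
      then show ?thesis using H repr2_prime_3_mod_4[OF p(1) 3, of m] IH1 IH2 m by auto
    qed
  qed
qed

section \<open>Reduced bases of well-rounded lattices\<close>

definition dt :: "int \<times> int \<Rightarrow> int \<times> int \<Rightarrow> int" where
  "dt v w = fst v * snd w - snd v * fst w"

definition ip :: "int \<times> int \<Rightarrow> int \<times> int \<Rightarrow> int" where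
  "ip v w = fst v * fst w + snd v * snd w"

definition comb :: "int \<times> int \<Rightarrow> int \<times> int \<Rightarrow> int \<Rightarrow> int \<Rightarrow> int \<times> int" where
  "comb v w x y = (x * fst v + y * fst w, x * snd v + y * snd w)"

definition lat :: "int \<times> int \<Rightarrow> int \<times> int \<Rightarrow> (int \<times> int) set" where
  "lat v w = {comb v w x y | x y. True}"

definition emb :: "int \<times> int \<Rightarrow> complex" where
  "emb z = Complex (of_int (fst z)) (of_int (snd z))"

text \<open>The angle lies strictly between 60 and 120 degrees. The condition on \<open>dt\<close>
  fixes both the orientation and the index.\<close>

definition reduced_bases :: "nat \<Rightarrow> ((int \<times> int) \<times> (int \<times> int)) set" where
  "reduced_bases n = {(v, w). gnorm v = gnorm w \<and> dt v w = int n \<and> 2 * \<bar>ip v w\<bar> < int (gnorm v)}"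

abbreviation cosets :: "complex set \<Rightarrow> complex set set" where
  "cosets L \<equiv> rcosets\<^bsub>square_lattice\<^esub> L"

section \<open>The square lattice as a group, and its sublattices given by a basis\<close>

lemma emb_simps [simp]:
  "Re (emb z) = of_int (fst z)" "Im (emb z) = of_int (snd z)"
  "emb z = emb w \<longleftrightarrow> z = w" "emb z = 0 \<longleftrightarrow> z = 0"
  by (auto simp: emb_def complex_eq_iff prod_eq_iff)

lemma emb_arith: "emb (z + w) = emb z + emb w" "emb (z - w) = emb z - emb w" "emb (- z) = - emb z"
  by (auto simp: complex_eq_iff)

lemma norm_emb: "norm (emb z) = sqrt (real (gnorm z))"
proof -
  have "real (gnorm z) = real_of_int ((fst z)\<^sup>2 + (snd z)\<^sup>2)"
    by (simp only: int_gnorm[symmetric] of_int_of_nat_eq)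
  then show ?thesis by (simp add: cmod_def)
qed

lemma norm_emb_le_iff: "norm (emb z) \<le> norm (emb w) \<longleftrightarrow> gnorm z \<le> gnorm w"
  by (simp add: norm_emb)

lemma carrier_square_lattice: "carrier square_lattice = range emb"
proof (intro subset_antisym subsetI)
  fix z assume "z \<in> carrier square_lattice"
  then obtain x y where "Re z = of_int x" "Im z = of_int y"
    by (auto simp: square_lattice_def elim!: Ints_cases)
  then have "z = emb (x, y)" by (simp add: complex_eq_iff)
  then show "z \<in> range emb" by blast
qed (auto simp: square_lattice_def)

lemma square_lattice_simps [simp]:
  "x \<otimes>\<^bsub>square_lattice\<^esub> y = x + y" "\<one>\<^bsub>square_lattice\<^esub> = 0"
  by (simp_all add: square_lattice_def)

lemma group_square_lattice: "group square_lattice"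
proof (rule groupI)
  fix x assume "x \<in> carrier square_lattice"
  then show "\<exists>y\<in>carrier square_lattice. y \<otimes>\<^bsub>square_lattice\<^esub> x = \<one>\<^bsub>square_lattice\<^esub>"
    by (intro bexI[of _ "- x"]) (auto simp: square_lattice_def)
qed (auto simp: square_lattice_def)

lemma inv_square_lattice:
  assumes "x \<in> carrier square_lattice"
  shows "inv\<^bsub>square_lattice\<^esub> x = - x"
  by (rule group.inv_equality[OF group_square_lattice]) (use assms in \<open>auto simp: square_lattice_def\<close>)

lemma comb_in_lat [simp]: "comb v w x y \<in> lat v w"
  by (auto simp: lat_def)

lemma basis_in_lat [simp]: "v \<in> lat v w" "w \<in> lat v w"
  using comb_in_lat[of v w 1 0] comb_in_lat[of v w 0 1] by (simp_all add: comb_def)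

lemma zero_in_lat: "0 \<in> lat v w"
  using comb_in_lat[of v w 0 0] by (simp add: comb_def zero_prod_def)

lemma lat_add: "a \<in> lat v w \<Longrightarrow> b \<in> lat v w \<Longrightarrow> a + b \<in> lat v w"
proof (unfold lat_def, clarify)
  fix x y x' y'
  show "\<exists>xa ya. comb v w x y + comb v w x' y' = comb v w xa ya \<and> True"
    by (intro exI[of _ "x + x'"] exI[of _ "y + y'"]) (simp add: comb_def algebra_simps)
qed

lemma lat_uminus: "a \<in> lat v w \<Longrightarrow> - a \<in> lat v w"
proof (unfold lat_def, clarify)
  fix x y
  show "\<exists>xa ya. - comb v w x y = comb v w xa ya \<and> True"
    by (intro exI[of _ "- x"] exI[of _ "- y"]) (simp add: comb_def)
qed

lemma lat_subset:
  assumes "v' \<in> lat v w" "w' \<in> lat v w"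
  shows "lat v' w' \<subseteq> lat v w"
proof
  fix z assume "z \<in> lat v' w'"
  then obtain x y where z: "z = comb v' w' x y" by (auto simp: lat_def)
  obtain p q r s where "v' = comb v w p q" "w' = comb v w r s"
    using assms by (auto simp: lat_def)
  then have "z = comb v w (x * p + y * r) (x * q + y * s)"
    by (simp add: z comb_def algebra_simps)
  then show "z \<in> lat v w" by simp
qed

lemma lat_eqI:
  "v' \<in> lat v w \<Longrightarrow> w' \<in> lat v w \<Longrightarrow> v \<in> lat v' w' \<Longrightarrow> w \<in> lat v' w' \<Longrightarrow> lat v' w' = lat v w"
  by (intro subset_antisym lat_subset)

text \<open>The orientation-preserving change of basis whose iterates produce the four bases of one
  lattice.\<close>

lemma lat_rotate: "lat w (- v) = lat v w"
  by (rule lat_eqI) (auto intro: lat_uminus lat_uminus[of "- v", simplified])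

lemma subgroup_emb_lat: "subgroup (emb ` lat v w) square_lattice"
proof (rule group.subgroupI[OF group_square_lattice])
  fix a assume "a \<in> emb ` lat v w"
  then obtain z where z: "a = emb z" "z \<in> lat v w" by blast
  then have "inv\<^bsub>square_lattice\<^esub> a = emb (- z)"
    by (simp add: inv_square_lattice carrier_square_lattice emb_arith)
  then show "inv\<^bsub>square_lattice\<^esub> a \<in> emb ` lat v w"
    using lat_uminus[OF z(2)] by (metis imageI)
next
  fix a b assume "a \<in> emb ` lat v w" "b \<in> emb ` lat v w"
  then obtain y z where "a = emb y" "y \<in> lat v w" "b = emb z" "z \<in> lat v w" by blast
  then show "a \<otimes>\<^bsub>square_lattice\<^esub> b \<in> emb ` lat v w"
    using lat_add[of y v w z] by (simp flip: emb_arith)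
qed (use zero_in_lat[of v w] in \<open>auto simp: carrier_square_lattice\<close>)

section \<open>The index of a sublattice is its determinant\<close>

lemma lat_hermite:
  assumes "dt v w \<noteq> 0"
  shows "\<exists>a c d. 0 < a \<and> 0 < d \<and> lat v w = lat (a, 0) (c, d) \<and> a * d = \<bar>dt v w\<bar>"
  using assms
proof (induction "nat \<bar>snd v\<bar>" arbitrary: v w rule: less_induct)
  case less
  show ?case
  proof (cases "snd v = 0")
    case True
    define a where "a = fst v"
    have v: "v = (a, 0)" by (simp add: a_def True prod_eq_iff)
    have ne: "a \<noteq> 0" "snd w \<noteq> 0" using less.prems by (auto simp: v dt_def)
    have *: "lat v w = lat (\<bar>a\<bar>, 0) (sgn (snd w) * fst w, \<bar>snd w\<bar>)"
    proof (rule sym, rule lat_eqI)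
      have "(\<bar>a\<bar>, 0) = comb v w (sgn a) 0" by (simp add: comb_def v abs_sgn mult.commute)
      then show "(\<bar>a\<bar>, 0) \<in> lat v w" by (metis comb_in_lat)
      have "(sgn (snd w) * fst w, \<bar>snd w\<bar>) = comb v w 0 (sgn (snd w))"
        by (simp add: comb_def abs_sgn mult.commute)
      then show "(sgn (snd w) * fst w, \<bar>snd w\<bar>) \<in> lat v w" by (metis comb_in_lat)
      have "v = comb (\<bar>a\<bar>, 0) (sgn (snd w) * fst w, \<bar>snd w\<bar>) (sgn a) 0"
        by (simp add: comb_def v sgn_mult_abs)
      then show "v \<in> lat (\<bar>a\<bar>, 0) (sgn (snd w) * fst w, \<bar>snd w\<bar>)"
        by (metis comb_in_lat)
      have "w = comb (\<bar>a\<bar>, 0) (sgn (snd w) * fst w, \<bar>snd w\<bar>) 0 (sgn (snd w))"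
        using ne by (simp add: comb_def sgn_mult_abs prod_eq_iff sgn_if)
      then show "w \<in> lat (\<bar>a\<bar>, 0) (sgn (snd w) * fst w, \<bar>snd w\<bar>)"
        by (metis comb_in_lat)
    qed
    show ?thesis
      by (rule exI[of _ "\<bar>a\<bar>"], rule exI[of _ "sgn (snd w) * fst w"], rule exI[of _ "\<bar>snd w\<bar>"])
        (use ne * in \<open>simp add: v dt_def abs_mult\<close>)
  next
    case False
    \<comment> \<open>One step of Euclid's algorithm on the second coordinates. The pair is also
      swapped, which flips the sign of \<open>dt\<close>; hence the absolute value in the
      statement.\<close>
    define q where "q = snd w div snd v"
    define u where "u = comb v w (- q) 1"
    have "snd u = snd w mod snd v"
      by (simp add: u_def comb_def q_def minus_mult_div_eq_mod algebra_simps)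
    then have "\<bar>snd u\<bar> < \<bar>snd v\<bar>" using False abs_mod_less by simp
    then have lt: "nat \<bar>snd u\<bar> < nat \<bar>snd v\<bar>" by simp
    have du: "dt u v = - dt v w" by (simp add: u_def comb_def dt_def algebra_simps)
    have "w = comb u v 1 q" by (simp add: u_def comb_def prod_eq_iff)
    then have "w \<in> lat u v" by (metis comb_in_lat)
    then have "lat u v = lat v w" by (intro lat_eqI) (auto simp: u_def)
    then show ?thesis using less.hyps[OF lt, of v] du less.prems by simp
  qed
qed

lemma r_coset_emb_eq_iff:
  "(emb ` lat v w) #>\<^bsub>square_lattice\<^esub> emb z = (emb ` lat v w) #>\<^bsub>square_lattice\<^esub> emb z'
     \<longleftrightarrow> z - z' \<in> lat v w" (is "?A = ?B \<longleftrightarrow> _")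
proof
  assume eq: "?A = ?B"
  have "emb z \<in> ?A" unfolding r_coset_def using zero_in_lat[of v w]
    by (auto intro!: bexI[of _ 0] simp: complex_eq_iff)
  then obtain h where "h \<in> lat v w" "emb z = emb h + emb z'"
    unfolding eq unfolding r_coset_def square_lattice_simps by blast
  then have "z - z' = h" by (simp flip: emb_arith)
  then show "z - z' \<in> lat v w" using \<open>h \<in> lat v w\<close> by simp
next
  have sub: "(emb ` lat v w) #>\<^bsub>square_lattice\<^esub> emb z \<subseteq> (emb ` lat v w) #>\<^bsub>square_lattice\<^esub> emb z'"
    if "z - z' \<in> lat v w" for z z'
  proof
    fix x assume "x \<in> (emb ` lat v w) #>\<^bsub>square_lattice\<^esub> emb z"
    then obtain h where h: "h \<in> lat v w" "x = emb h + emb z" by (auto simp: r_coset_def)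
    then have "x = emb (h + (z - z')) + emb z'" by (simp flip: emb_arith)
    then show "x \<in> (emb ` lat v w) #>\<^bsub>square_lattice\<^esub> emb z'"
      using lat_add[OF h(1) that] by (force simp: r_coset_def)
  qed
  assume "z - z' \<in> lat v w"
  then show "?A = ?B" using sub[of z z'] sub[of z' z] lat_uminus[of "z - z'"] by auto
qed

text \<open>In Hermite form every coset has exactly one representative in the box of size a times d:
  reduce the second coordinate by (c, d), then the first by (a, 0).\<close>

theorem index_lat:
  assumes "dt v w \<noteq> 0"
  shows "finite (cosets (emb ` lat v w))" "int (card (cosets (emb ` lat v w))) = \<bar>dt v w\<bar>"
proof -
  obtain a c d where H: "0 < a" "0 < d" "lat v w = lat (a, 0) (c, d)" "a * d = \<bar>dt v w\<bar>"
    using lat_hermite[OF assms] by blast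
  define f where "f = (\<lambda>z. (emb ` lat v w) #>\<^bsub>square_lattice\<^esub> emb z)"
  define S where "S = {0..<a} \<times> {0..<d}"
  have "inj_on f S"
  proof (rule inj_onI)
    fix z z' assume z: "z \<in> S" "z' \<in> S" "f z = f z'"
    then have "z - z' \<in> lat (a, 0) (c, d)" using r_coset_emb_eq_iff H(3) by (simp add: f_def)
    then obtain x y where xy: "fst z - fst z' = x * a + y * c" "snd z - snd z' = y * d"
      by (auto simp: lat_def comb_def prod_eq_iff)
    have "\<bar>y * d\<bar> < 1 * d" using z by (simp flip: xy) (auto simp: S_def)
    then have "y = 0" using H(2) by (simp add: abs_mult)
    moreover from this have "\<bar>x * a\<bar> < 1 * a" using z xy by (auto simp: S_def)
    then have "x = 0" using H(1) by (simp add: abs_mult)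
    ultimately show "z = z'" using xy by (simp add: prod_eq_iff)
  qed
  moreover have "f ` S = cosets (emb ` lat v w)"
  proof (intro subset_antisym subsetI)
    fix C assume "C \<in> cosets (emb ` lat v w)"
    then obtain z where C: "C = f z" by (auto simp: RCOSETS_def carrier_square_lattice f_def)
    define y where "y = snd z div d"
    define x where "x = (fst z - y * c) div a"
    define r where "r = ((fst z - y * c) mod a, snd z mod d)"
    have "z - r = comb (a, 0) (c, d) x y"
      by (simp add: r_def comb_def x_def y_def prod_eq_iff minus_mod_eq_div_mult)
         (simp add: algebra_simps minus_mod_eq_div_mult)
    then have "z - r \<in> lat v w" by (simp add: H(3))
    then have "C = f r" using r_coset_emb_eq_iff by (simp add: C f_def)
    then show "C \<in> f ` S" using H by (auto simp: r_def S_def)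
  qed (auto simp: RCOSETS_def carrier_square_lattice f_def)
  ultimately have "bij_betw f S (cosets (emb ` lat v w))" by (simp add: bij_betw_def)
  then have "card S = card (cosets (emb ` lat v w))" "finite (cosets (emb ` lat v w)) = finite S"
    by (auto simp: bij_betw_same_card bij_betw_finite)
  moreover have "int (card S) = a * d" using H by (simp add: S_def card_cartesian_product)
  ultimately show "finite (cosets (emb ` lat v w))" "int (card (cosets (emb ` lat v w))) = \<bar>dt v w\<bar>"
    using H by (auto simp: S_def)
qed

section \<open>Minimal vectors and reduced bases\<close>

lemma gnorm_comb:
  assumes "gnorm v = gnorm w"
  shows "int (gnorm (comb v w x y)) = int (gnorm v) * (x\<^sup>2 + y\<^sup>2) + 2 * (x * y) * ip v w"
proof -
  have "int (gnorm (comb v w x y))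
      = int (gnorm v) * x\<^sup>2 + int (gnorm w) * y\<^sup>2 + 2 * (x * y) * ip v w"
    unfolding int_gnorm comb_def ip_def by (simp add: algebra_simps power2_eq_square)
  then show ?thesis using assms by (simp add: algebra_simps)
qed

text \<open>Lagrange's identity.\<close>

lemma ip_dt: "(ip v w)\<^sup>2 + (dt v w)\<^sup>2 = int (gnorm v) * int (gnorm w)"
  unfolding int_gnorm ip_def dt_def by (simp add: algebra_simps power2_eq_square)

text \<open>If both coefficients are non-zero, x^2 + y^2 >= 2 |x y| outweighs the mixed term and the
  form exceeds N; otherwise the vector is a multiple of one basis vector.\<close>

lemma reduced_comb:
  assumes "gnorm v = gnorm w" "2 * \<bar>ip v w\<bar> < int (gnorm v)" "comb v w x y \<noteq> 0"
  shows "gnorm v \<le> gnorm (comb v w x y)"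
    and "gnorm (comb v w x y) = gnorm v \<Longrightarrow> comb v w x y \<in> {v, w, - v, - w}"
proof -
  define N where "N = int (gnorm v)"
  have N0: "N > 0" using assms(2) by (auto simp: N_def)
  note g = gnorm_comb[OF assms(1), of x y, folded N_def]
  have "N \<le> gnorm (comb v w x y) \<and>
    (gnorm (comb v w x y) = N \<longrightarrow> comb v w x y \<in> {v, w, - v, - w})"
  proof (cases "x * y = 0")
    case True
    define k where "k = x + y"
    have kk: "x\<^sup>2 + y\<^sup>2 = k\<^sup>2" using True by (auto simp: k_def)
    have "k \<noteq> 0" using assms(3) True by (auto simp: k_def comb_def zero_prod_def)
    then have "1 * 1 \<le> \<bar>k\<bar> * \<bar>k\<bar>" by (intro mult_mono) auto
    then have k1: "1 \<le> k\<^sup>2" by (simp add: power2_eq_square)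
    have "N * 1 \<le> N * k\<^sup>2" using k1 N0 by (intro mult_left_mono) auto
    moreover have "k = 1 \<or> k = - 1" if "N * k\<^sup>2 = N"
    proof -
      have "k\<^sup>2 = 1" using that N0 by simp
      then show ?thesis by (simp add: power2_eq_1_iff)
    qed
    ultimately show ?thesis using g True unfolding kk
      by (auto simp: k_def comb_def prod_eq_iff)
  next
    case False
    then have xy: "1 \<le> \<bar>x * y\<bar>" by linarith
    have "\<bar>2 * (x * y) * ip v w\<bar> = \<bar>x * y\<bar> * (2 * \<bar>ip v w\<bar>)"
      by (simp add: abs_mult)
    \<comment> \<open>Integrality turns the strict bound into N - 1; the surplus of |x y| makes the
      final inequality strict.\<close>
    also have "\<dots> \<le> \<bar>x * y\<bar> * (N - 1)" using assms(2)
      by (intro mult_left_mono) (auto simp: N_def)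
    finally have 1: "2 * (x * y) * ip v w \<ge> - (\<bar>x * y\<bar> * (N - 1))" by linarith
    have "0 \<le> (\<bar>x\<bar> - \<bar>y\<bar>)\<^sup>2" by simp
    then have "x\<^sup>2 + y\<^sup>2 - 2 * \<bar>x * y\<bar> \<ge> 0"
      by (simp add: power2_diff abs_mult)
    then have "N * (x\<^sup>2 + y\<^sup>2 - 2 * \<bar>x * y\<bar>) \<ge> 0" using N0 by simp
    moreover have "N * \<bar>x * y\<bar> \<ge> N * 1" using N0 xy by (intro mult_left_mono) auto
    ultimately have "int (gnorm (comb v w x y)) > N"
      using 1 xy unfolding g by (simp add: algebra_simps)
    then show ?thesis by simp
  qed
  then show "gnorm v \<le> gnorm (comb v w x y)"
    "gnorm (comb v w x y) = gnorm v \<Longrightarrow> comb v w x y \<in> {v, w, - v, - w}"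
    by (auto simp: N_def)
qed

lemma minimal_vectors_reduced:
  assumes "(v, w) \<in> reduced_bases n" "0 < n"
  shows "minimal_vectors (emb ` lat v w) = emb ` {v, w, - v, - w}"
proof -
  have *: "gnorm v = gnorm w" "2 * \<bar>ip v w\<bar> < int (gnorm v)" using assms
    by (auto simp: reduced_bases_def)
  have min: "gnorm v \<le> gnorm z" "gnorm z = gnorm v \<Longrightarrow> z \<in> {v, w, - v, - w}"
    if "z \<in> lat v w" "z \<noteq> 0" for z
    using that reduced_comb[OF *] by (auto simp: lat_def)
  have gm: "gnorm (- z) = gnorm z" for z by (simp add: gnorm_def)
  have ne: "v \<noteq> 0" "w \<noteq> 0" using assms by (auto simp: reduced_bases_def dt_def)
  have conv: "z \<in> lat v w" "z \<noteq> 0" "gnorm z = gnorm v"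
    if "z \<in> {v, w, - v, - w}" for z
    using that ne *(1) gm[of v] gm[of w] lat_uminus[of v v w] lat_uminus[of w v w] by auto
  have iff: "z \<in> lat v w \<and> z \<noteq> 0 \<and> (\<forall>u\<in>lat v w. u \<noteq> 0 \<longrightarrow> gnorm z \<le> gnorm u)
      \<longleftrightarrow> z \<in> {v, w, - v, - w}" (is "?P z \<longleftrightarrow> _") for z
  proof
    assume z: "?P z"
    then have "gnorm z \<le> gnorm v" using ne by (meson basis_in_lat(1))
    then have "gnorm z = gnorm v" using min(1)[of z] z by simp
    then show "z \<in> {v, w, - v, - w}" using min(2)[of z] z by blast
  next
    assume z: "z \<in> {v, w, - v, - w}"
    show "?P z" using conv[OF z] min(1) by metis
  qed
  have "minimal_vectors (emb ` lat v w) = emb ` {z. ?P z}"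
    unfolding minimal_vectors_def by (auto simp: norm_emb_le_iff)
  then show ?thesis unfolding iff by (simp only: Collect_mem_eq)
qed

text \<open>Lagrange's identity bounds the squared length N by the index: 3 N^2 <= 4 n^2, of which N
  <= 2 n is a crude form.\<close>

lemma finite_reduced_bases: "finite (reduced_bases n)"
proof -
  have "gnorm v \<le> 2 * n \<and> gnorm w \<le> 2 * n" if "(v, w) \<in> reduced_bases n" for v w
  proof -
    have *: "gnorm v = gnorm w" "2 * \<bar>ip v w\<bar> < int (gnorm v)" "dt v w = int n"
      using that by (auto simp: reduced_bases_def)
    have "(2 * \<bar>ip v w\<bar>)\<^sup>2 \<le> (int (gnorm v))\<^sup>2" using *(2)
      by (intro power_mono) auto
    then have "4 * (ip v w)\<^sup>2 \<le> (int (gnorm v))\<^sup>2" by (simp add: power_mult_distrib)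
    moreover have "(ip v w)\<^sup>2 + (int n)\<^sup>2 = (int (gnorm v))\<^sup>2"
      using ip_dt[of v w] * by (simp add: power2_eq_square)
    moreover have "(int (gnorm v))\<^sup>2 \<ge> 0" by simp
    ultimately have "(int (gnorm v))\<^sup>2 \<le> 4 * (int n)\<^sup>2" by linarith
    then have "(int (gnorm v))\<^sup>2 \<le> (2 * int n)\<^sup>2" by (simp add: power_mult_distrib)
    then have "int (gnorm v) \<le> 2 * int n" by (rule power2_le_imp_le) simp
    then show ?thesis using *(1) by simp
  qed
  then have "reduced_bases n \<subseteq> {v. gnorm v \<le> 2 * n} \<times> {v. gnorm v \<le> 2 * n}"
    by auto
  then show ?thesis by (rule finite_subset) (simp add: finite_gnorm_le)
qed

lemma emb_lat_reduced:
  assumes "(v, w) \<in> reduced_bases n" "0 < n"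
  shows "sublattice (emb ` lat v w)" "well_rounded (emb ` lat v w)" "card (cosets (emb ` lat v w)) = n"
proof -
  have d: "dt v w = int n" using assms by (auto simp: reduced_bases_def)
  then have d0: "dt v w \<noteq> 0" using assms by simp
  show "sublattice (emb ` lat v w)" "card (cosets (emb ` lat v w)) = n"
    using index_lat[OF d0] d subgroup_emb_lat by (auto simp: sublattice_def)
  have "z \<in> span {emb v, emb w}" for z
  proof -
    define D where "D = real_of_int (dt v w)"
    have D: "D = real_of_int (fst v) * real_of_int (snd w) - real_of_int (snd v) * real_of_int (fst w)"
      by (simp add: D_def dt_def)
    have D0: "D \<noteq> 0" using d0 by (simp add: D_def)
    \<comment> \<open>Cramer's rule for the coordinates of z in the basis.\<close>
    define \<alpha> where "\<alpha> = (Re z * real_of_int (snd w) - Im z * real_of_int (fst w)) / D"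
    define \<beta> where "\<beta> = (real_of_int (fst v) * Im z - real_of_int (snd v) * Re z) / D"
    have "D * Re z = D * Re (\<alpha> *\<^sub>R emb v + \<beta> *\<^sub>R emb w)" "D * Im z = D * Im (\<alpha> *\<^sub>R emb v + \<beta> *\<^sub>R emb w)"
      using D0 by (simp_all add: \<alpha>_def \<beta>_def distrib_left) (simp_all add: D algebra_simps)
    then have zeq: "z = \<alpha> *\<^sub>R emb v + \<beta> *\<^sub>R emb w"
      unfolding complex_eq_iff mult_left_cancel[OF D0] by blast
    have "\<alpha> *\<^sub>R emb v + \<beta> *\<^sub>R emb w \<in> span {emb v, emb w}"
      by (intro span_add span_scale span_base) auto
    then show ?thesis by (simp only: zeq[symmetric])
  qed
  moreover have "{emb v, emb w} \<subseteq> minimal_vectors (emb ` lat v w)"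
    using minimal_vectors_reduced[OF assms] by auto
  ultimately show "well_rounded (emb ` lat v w)"
    unfolding well_rounded_def using span_mono by blast
qed

text \<open>The multiplicity of the prime 3 would be odd on the left and even on the right.\<close>

lemma no_int_sqrt3:
  assumes "3 * a\<^sup>2 = (b :: int)\<^sup>2"
  shows "a = 0"
proof (rule ccontr)
  assume "a \<noteq> 0"
  then have "b \<noteq> 0" using assms by auto
  have "multiplicity 3 (3 * a\<^sup>2) = multiplicity 3 (b\<^sup>2)" using assms by simp
  then have "Suc (2 * multiplicity 3 a) = 2 * multiplicity 3 b"
    using \<open>a \<noteq> 0\<close> \<open>b \<noteq> 0\<close>
    by (simp add: prime_elem_multiplicity_mult_distrib prime_elem_multiplicity_power_distrib)
  then show False by presburger
qed

lemma nearest_multiple: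
  assumes "(D :: int) > 0"
  obtains x where "2 * \<bar>a - x * D\<bar> \<le> D"
proof -
  \<comment> \<open>This rounds a / D to a nearest integer.\<close>
  define x where "x = (2 * a + D) div (2 * D)"
  have "(2 * a + D) mod (2 * D) = 2 * a + D - x * (2 * D)"
    unfolding x_def by (simp add: minus_div_mult_eq_mod)
  moreover have "0 \<le> (2 * a + D) mod (2 * D)" "(2 * a + D) mod (2 * D) < 2 * D" using assms
    by auto
  ultimately have "2 * \<bar>a - x * D\<bar> \<le> D" by (auto simp: algebra_simps abs_if)
  then show ?thesis using that by blast
qed

text \<open>Two independent minimal vectors form a reduced basis: minimality of v compared with v +
  w and v - w bounds the inner product, and a lattice vector outside their span over the integers
  would leave a remainder shorter than the minimum.\<close>

lemma well_rounded_imp_reduced: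
  assumes "sublattice L" "well_rounded L" "card (cosets L) = n"
  shows "\<exists>v w. (v, w) \<in> reduced_bases n \<and> L = emb ` lat v w"
proof -
  define I where "I = {z. emb z \<in> L}"
  have sg: "subgroup L square_lattice" using assms(1) by (simp add: sublattice_def)
  have LI: "L = emb ` I"
    using subgroup.subset[OF sg] by (auto simp: I_def carrier_square_lattice)
  have add: "a + b \<in> I" if "a \<in> I" "b \<in> I" for a b
    using that subgroup.m_closed[OF sg, of "emb a" "emb b"] by (simp add: I_def emb_arith)
  have neg: "- a \<in> I" if "a \<in> I" for a
    using that subgroup.m_inv_closed[OF sg, of "emb a"]
    by (simp add: I_def emb_arith inv_square_lattice carrier_square_lattice)
  have zero: "0 \<in> I" using subgroup.one_closed[OF sg] by (simp add: I_def) (metis emb_simps(4))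
  have nmul: "(int k * fst a, int k * snd a) \<in> I" if "a \<in> I" for a k
  proof (induction k)
    case (Suc k)
    then show ?case using add[OF that Suc] by (cases a) (simp add: algebra_simps)
  qed (use zero in \<open>simp add: zero_prod_def\<close>)
  have zmul: "(k * fst a, k * snd a) \<in> I" if "a \<in> I" for a k
    using nmul[OF that, of "nat k"] neg[OF nmul[OF that, of "nat (- k)"]]
    by (cases "k \<ge> 0") (simp_all add: uminus_prod_def)
  have combI: "comb a b x y \<in> I" if "a \<in> I" "b \<in> I" for a b x y
    using add[OF zmul[OF that(1), of x] zmul[OF that(2), of y]] by (simp add: comb_def)
  define M where "M = {z \<in> I. z \<noteq> 0 \<and> (\<forall>u\<in>I. u \<noteq> 0 \<longrightarrow> gnorm z \<le> gnorm u)}"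
  have MM: "minimal_vectors L = emb ` M"
    by (auto simp: minimal_vectors_def M_def LI norm_emb_le_iff)
  have "\<exists>v\<in>M. \<exists>w\<in>M. dt v w \<noteq> 0"
  proof (rule ccontr)
    assume no: "\<not> (\<exists>v\<in>M. \<exists>w\<in>M. dt v w \<noteq> 0)"
    have sp: "span (emb ` M) = UNIV" using assms(2) MM by (simp add: well_rounded_def)
    have "M \<noteq> {}"
    proof
      assume "M = {}"
      then have "(1::complex) \<in> {0}" using sp by auto
      then show False by simp
    qed
    then obtain v where v: "v \<in> M" by blast
    \<comment> \<open>The real line through v. If all minimal vectors were on it, it would be the
      whole plane and contain its own normal.\<close>
    define V where "V = {z. real_of_int (fst v) * Im z - real_of_int (snd v) * Re z = 0}"
    have "subspace V" by (auto simp: subspace_def V_def algebra_simps)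
    moreover have "emb ` M \<subseteq> V"
    proof
      fix z assume "z \<in> emb ` M"
      then obtain w where w: "w \<in> M" "z = emb w" by auto
      then have "real_of_int (dt v w) = 0" using no v by simp
      then show "z \<in> V" by (simp add: V_def w dt_def)
    qed
    ultimately have "UNIV \<subseteq> V" using span_minimal sp by metis
    then have "Complex (- real_of_int (snd v)) (real_of_int (fst v)) \<in> V" by blast
    then have "real_of_int (fst v * fst v + snd v * snd v) = 0" by (simp add: V_def)
    then have "fst v * fst v + snd v * snd v = 0" by (simp only: of_int_eq_0_iff)
    then have "v = 0" by (simp add: prod_eq_iff)
    then show False using v by (simp add: M_def)
  qed
  then obtain v0 w0 where vw0: "v0 \<in> M" "w0 \<in> M" "dt v0 w0 \<noteq> 0" by blast
  obtain v w where vw: "v \<in> M" "w \<in> M" "dt v w > 0"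
  proof (cases "dt v0 w0 > 0")
    case False
    then have "dt w0 v0 > 0" using vw0(3) by (simp add: dt_def algebra_simps)
    then show ?thesis using that vw0 by blast
  qed (use that vw0 in blast)
  have I: "v \<in> I" "w \<in> I" and eq: "gnorm v = gnorm w"
    using vw by (auto simp: M_def intro!: order.antisym)
  have min: "gnorm v \<le> gnorm z" if "z \<in> I" "z \<noteq> 0" for z using that vw(1)
    by (auto simp: M_def)
  define N where "N = int (gnorm v)"
  define D where "D = dt v w"
  have N0: "N > 0" using vw(1) gnorm_eq_0_iff[of v] by (auto simp: N_def M_def zero_prod_def)
  have le: "2 * \<bar>ip v w\<bar> \<le> N"
  proof -
    have nz: "comb v w 1 1 \<noteq> 0" "comb v w 1 (- 1) \<noteq> 0"
      using vw(3) by (auto simp: comb_def zero_prod_def dt_def add_eq_0_iff)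
    have "N \<le> int (gnorm (comb v w 1 1))" "N \<le> int (gnorm (comb v w 1 (- 1)))"
      using min[OF combI[OF I] nz(1)] min[OF combI[OF I] nz(2)] by (simp_all add: N_def)
    then show ?thesis
      unfolding gnorm_comb[OF eq] N_def[symmetric] by (auto simp: abs_if)
  qed
  \<comment> \<open>Equality means an angle of 60 or 120 degrees; with Lagrange's identity it would
    make sqrt 3 rational.\<close>
  have "2 * \<bar>ip v w\<bar> \<noteq> N"
  proof
    assume "2 * \<bar>ip v w\<bar> = N"
    then have "N\<^sup>2 = (2 * \<bar>ip v w\<bar>)\<^sup>2" by simp
    then have "N\<^sup>2 = 4 * (ip v w)\<^sup>2" by (simp add: power_mult_distrib)
    moreover have "(ip v w)\<^sup>2 + D\<^sup>2 = N\<^sup>2"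
      using ip_dt[of v w] eq by (simp add: N_def D_def power2_eq_square)
    ultimately have "3 * N\<^sup>2 = (2 * D)\<^sup>2" by (simp add: power_mult_distrib)
    then show False using no_int_sqrt3 N0 by blast
  qed
  then have lt: "2 * \<bar>ip v w\<bar> < N" using le by simp
  have "I \<subseteq> lat v w"
  proof
    fix z assume z: "z \<in> I"
    have D0: "D > 0" using vw by (simp add: D_def)
    obtain x where x: "2 * \<bar>dt z w - x * D\<bar> \<le> D" using nearest_multiple[OF D0] .
    obtain y where y: "2 * \<bar>dt v z - y * D\<bar> \<le> D" using nearest_multiple[OF D0] .
    \<comment> \<open>By Cramer's rule these are D times the coordinates of the remainder
      \<open>r\<close>, each at most D/2 in absolute value by rounding. They force |r|^2 <= 3/4 N,
      against the minimality of N unless r = 0.\<close>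
    define \<alpha> \<beta> where "\<alpha> = dt z w - x * D" and "\<beta> = dt v z - y * D"
    define r where "r = z - comb v w x y"
    have rI: "r \<in> I" using add[OF z neg[OF combI[OF I]]] by (simp add: r_def)
    have Dr: "(D * fst r, D * snd r) = comb v w \<alpha> \<beta>"
      by (simp add: r_def comb_def \<alpha>_def \<beta>_def D_def dt_def algebra_simps)
    have "int (gnorm (D * fst r, D * snd r)) = D\<^sup>2 * int (gnorm r)"
      unfolding int_gnorm by (simp add: power_mult_distrib algebra_simps)
    then have g: "D\<^sup>2 * int (gnorm r) = N * (\<alpha>\<^sup>2 + \<beta>\<^sup>2) + 2 * (\<alpha> * \<beta>) * ip v w"
      using gnorm_comb[OF eq, of \<alpha> \<beta>] by (simp add: Dr N_def)
    have "r = 0"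
    proof (rule ccontr)
      assume "r \<noteq> 0"
      then have "N \<le> int (gnorm r)" using min[OF rI] by (simp add: N_def)
      then have "D\<^sup>2 * N \<le> D\<^sup>2 * int (gnorm r)" by (intro mult_left_mono) auto
      also have "\<dots> \<le> N * (\<alpha>\<^sup>2 + \<beta>\<^sup>2) + \<bar>\<alpha> * \<beta>\<bar> * N"
      proof -
        have "2 * (\<alpha> * \<beta>) * ip v w \<le> \<bar>\<alpha> * \<beta>\<bar> * (2 * \<bar>ip v w\<bar>)"
          using abs_ge_self[of "2 * (\<alpha> * \<beta>) * ip v w"] by (simp add: abs_mult)
        also have "\<dots> \<le> \<bar>\<alpha> * \<beta>\<bar> * N" using lt
          by (intro mult_left_mono) auto
        finally show ?thesis unfolding g by simp
      qed
      finally have "N * (4 * D\<^sup>2) \<le> N * (4 * (\<alpha>\<^sup>2 + \<beta>\<^sup>2 + \<bar>\<alpha> * \<beta>\<bar>))"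
        by (simp add: algebra_simps)
      then have 1: "4 * D\<^sup>2 \<le> 4 * (\<alpha>\<^sup>2 + \<beta>\<^sup>2 + \<bar>\<alpha> * \<beta>\<bar>)"
        using N0 mult_le_cancel_left_pos by blast
      have "(2 * \<bar>\<alpha>\<bar>)\<^sup>2 \<le> D\<^sup>2" "(2 * \<bar>\<beta>\<bar>)\<^sup>2 \<le> D\<^sup>2"
        using power_mono[OF x, of 2] power_mono[OF y, of 2]
          by (simp_all add: \<alpha>_def \<beta>_def)
      moreover have "(2 * \<bar>\<alpha>\<bar>) * (2 * \<bar>\<beta>\<bar>) \<le> D * D"
        using x y D0 by (intro mult_mono) (auto simp: \<alpha>_def \<beta>_def)
      ultimately have "4 * (\<alpha>\<^sup>2 + \<beta>\<^sup>2 + \<bar>\<alpha> * \<beta>\<bar>) \<le> 3 * D\<^sup>2"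
        by (simp add: power_mult_distrib abs_mult power2_eq_square)
      moreover have "D\<^sup>2 > 0" using D0 by simp
      ultimately show False using 1 by linarith
    qed
    then have "z = comb v w x y" by (simp add: r_def)
    then show "z \<in> lat v w" by simp
  qed
  moreover have "lat v w \<subseteq> I" using combI[OF I] by (auto simp: lat_def)
  ultimately have L: "L = emb ` lat v w" using LI by auto
  have "int n = dt v w" using index_lat(2)[of v w] vw(3) assms(3) L by simp
  then have "(v, w) \<in> reduced_bases n" using eq lt by (auto simp: reduced_bases_def N_def)
  then show ?thesis using L by blast
qed

text \<open>A well-rounded sublattice has exactly four minimal vectors, hence four positively oriented
  bases of minimal vectors.\<close>

theorem card_reduced_bases:
  assumes "0 < n"
  shows "card (reduced_bases n) = 4 * a_square n"
proof -
  define f where "f = (\<lambda>(v, w). emb ` lat v w)"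
  have img: "f ` reduced_bases n = {L. sublattice L \<and> well_rounded L \<and> card (cosets L) = n}"
    using emb_lat_reduced[OF _ assms] well_rounded_imp_reduced by (fastforce simp: f_def)
  have fib: "card {b \<in> reduced_bases n. f b = f b0} = 4"
    if b0: "b0 \<in> reduced_bases n" for b0
  proof -
    obtain v w where vw: "b0 = (v, w)" by (cases b0)
    have d: "dt v w = int n" "gnorm v = gnorm w" "2 * \<bar>ip v w\<bar> < int (gnorm v)"
      using b0 by (auto simp: vw reduced_bases_def)
    have gm: "gnorm (- z) = gnorm z" for z by (simp add: gnorm_def)
    have dtm: "dt (- a) b = - dt a b" "dt a (- b) = - dt a b" "dt a a = 0" "dt w v = - int n"
      for a b using d(1) by (auto simp: dt_def algebra_simps)
    have ipm: "ip (- a) b = - ip a b" "ip a (- b) = - ip a b" "ip w v = ip v w"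
      for a b by (auto simp: ip_def algebra_simps)
    have "{b \<in> reduced_bases n. f b = f b0} = {(v, w), (w, - v), (- v, - w), (- w, v)}"
    proof (intro subset_antisym subsetI)
      fix b assume "b \<in> {b \<in> reduced_bases n. f b = f b0}"
      then obtain v' w' where b: "b = (v', w')" "(v', w') \<in> reduced_bases n"
        "emb ` lat v' w' = emb ` lat v w"
        by (cases b) (auto simp: f_def vw)
      \<comment> \<open>A lattice determines its minimal vectors, and among pairs of them only four
        have determinant n.\<close>
      have "emb ` {v', w', - v', - w'} = emb ` {v, w, - v, - w}"
        using minimal_vectors_reduced[OF b(2) assms] minimal_vectors_reduced[OF b0[unfolded vw] assms] b(3)
        by simp
      then have "{v', w', - v', - w'} = {v, w, - v, - w}"
        by (subst (asm) inj_image_eq_iff) (auto simp: inj_on_def)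
      then have "v' \<in> {v, w, - v, - w}" "w' \<in> {v, w, - v, - w}" by blast+
      moreover have "dt v' w' = int n" using b(2) by (simp add: reduced_bases_def)
      ultimately show "b \<in> {(v, w), (w, - v), (- v, - w), (- w, v)}"
        using assms d(1) by (auto simp: b(1) dtm)
    next
      fix b assume "b \<in> {(v, w), (w, - v), (- v, - w), (- w, v)}"
      moreover have "lat w (- v) = lat v w" "lat (- v) (- w) = lat v w" "lat (- w) v = lat v w"
        using lat_rotate[of w v] lat_rotate[of "- v" w] lat_rotate[of "- w" "- v"]
        by simp_all
      ultimately show "b \<in> {b \<in> reduced_bases n. f b = f b0}"
        using d by (auto simp: reduced_bases_def f_def vw gm dtm ipm)
    qed
    moreover have "v \<noteq> w" "v \<noteq> - w" "v \<noteq> - v" "w \<noteq> - w"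
    proof -
      show "v \<noteq> w" "v \<noteq> - w" using d(1) assms by (auto simp: dt_def)
      show "v \<noteq> - v" "w \<noteq> - w" using d(1) assms by (auto simp: dt_def prod_eq_iff)
    qed
    ultimately show ?thesis by (auto simp: card_insert_if)
  qed
  have "card (reduced_bases n) = (\<Sum>L\<in>f ` reduced_bases n. card {b \<in> reduced_bases n. f b = L})"
    using sum.image_gen[OF finite_reduced_bases, of "\<lambda>_. 1::nat" n f] by simp
  also have "\<dots> = (\<Sum>L\<in>f ` reduced_bases n. 4)"
    by (intro sum.cong refl) (use fib in auto)
  finally show ?thesis by (simp add: img a_square_def)
qed

section \<open>Diagonals of reduced bases\<close>

definition prim :: "(int \<times> int) set" where
  "prim = {z. coprime (fst z) (snd z)}"

definition prim_odd :: "(int \<times> int) set" where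
  "prim_odd = {z \<in> prim. odd (gnorm z)}"

text \<open>For h = 1 the congruences are void, for h = 2 they say that p and q are odd;
  \<open>1 mod h\<close> rather than 1 covers both. The squared inequality is q < sqrt 3 p inside
  \<open>nat\<close>.\<close>

definition side_pairs :: "nat \<Rightarrow> (nat \<times> nat) set" where
  "side_pairs h = {(p, q). 0 < p \<and> p < q \<and> q\<^sup>2 < 3 * p\<^sup>2 \<and> p mod h = 1 mod h \<and> q mod h = 1 mod h}"

definition scale :: "nat \<times> (int \<times> int) \<Rightarrow> int \<times> int" where
  "scale x = (int (fst x) * fst (snd x), int (fst x) * snd (snd x))"

text \<open>An element ((a, b), z) describes a rhombus by its diagonals a z and b i z. The two
  parity conditions say that its sides (a z - b i z)/2 and (a z + b i z)/2 have integer
  coordinates.\<close>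

definition rectangles :: "nat \<Rightarrow> ((nat \<times> nat) \<times> (int \<times> int)) set" where
  "rectangles n = {x. snd x \<in> prim \<and> 0 < fst (fst x) \<and> fst (fst x) < snd (fst x)
     \<and> (snd (fst x))\<^sup>2 < 3 * (fst (fst x))\<^sup>2
     \<and> even (int (fst (fst x)) * fst (snd x) + int (snd (fst x)) * snd (snd x))
     \<and> even (int (fst (fst x)) * snd (snd x) + int (snd (fst x)) * fst (snd x))
     \<and> fst (fst x) * snd (fst x) * gnorm (snd x) = 2 * n}"

lemma gnorm_scale: "gnorm (scale x) = (fst x)\<^sup>2 * gnorm (snd x)"
proof -
  have "int (gnorm (scale x)) = int ((fst x)\<^sup>2 * gnorm (snd x))"
    by (simp add: int_gnorm scale_def power_mult_distrib algebra_simps)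
  then show ?thesis by (simp only: of_nat_eq_iff)
qed

lemma zero_notin_prim: "z \<in> prim \<Longrightarrow> z \<noteq> 0"
  by (auto simp: prim_def)

lemma gnorm_pos: "z \<noteq> 0 \<Longrightarrow> 0 < gnorm z"
  using gnorm_eq_0_iff[of z] by (simp add: zero_prod_def)

text \<open>The gcd of the coordinates recovers the scaling factor. As it enters the norm squared,
  this bijection is the origin of the denominator zeta(2 s).\<close>

lemma bij_betw_scale: "bij_betw scale ({1..} \<times> prim) (- {0})"
  unfolding bij_betw_def
proof
  have g: "gcd (fst (scale x)) (snd (scale x)) = int (fst x)" if "x \<in> {1..} \<times> prim" for x
    using that by (auto simp: scale_def prim_def gcd_mult_left)
  show "inj_on scale ({1..} \<times> prim)"
  proof (rule inj_onI)
    fix x y assume xy: "x \<in> {1..} \<times> prim" "y \<in> {1..} \<times> prim" "scale x = scale y"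
    then have "fst x = fst y" using g by (metis of_nat_eq_iff)
    moreover have "0 < fst x" using xy(1) by auto
    ultimately show "x = y" using xy(3) by (auto simp: scale_def prod_eq_iff)
  qed
  show "scale ` ({1..} \<times> prim) = - {0}"
  proof (intro subset_antisym subsetI)
    fix z assume "z \<in> scale ` ({1..} \<times> prim)"
    then obtain x where "x \<in> {1..} \<times> prim" "z = scale x" by blast
    then have "0 < gnorm z" using gnorm_pos zero_notin_prim by (auto simp: gnorm_scale)
    then show "z \<in> - {0}" by (auto simp: gnorm_def)
  next
    fix z :: "int \<times> int" assume "z \<in> - {0}"
    then have ne: "fst z \<noteq> 0 \<or> snd z \<noteq> 0" by (auto simp: prod_eq_iff)
    define d where "d = gcd (fst z) (snd z)"
    have d: "d > 0" using ne by (auto simp: d_def)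
    define y where "y = (fst z div d, snd z div d)"
    have "coprime (fst y) (snd y)" using ne div_gcd_coprime by (simp add: y_def d_def)
    moreover have "z = scale (nat d, y)" using d
      by (simp add: scale_def y_def prod_eq_iff) (simp add: d_def)
    ultimately show "z \<in> scale ` ({1..} \<times> prim)" using d
      by (intro image_eqI[of _ _ "(nat d, y)"]) (auto simp: prim_def)
  qed
qed

text \<open>A primitive element is not divisible by (1 + i)^2 = 2 i, so even norm means exactly one
  factor 1 + i.\<close>

lemma prim_even: "{z \<in> prim. even (gnorm z)} = gmul (1, 1) ` prim_odd"
proof (intro subset_antisym subsetI)
  have ev: "even (gnorm z) \<longleftrightarrow> even (fst z + snd z)" for z
  proof -
    have "even (gnorm z) \<longleftrightarrow> even (int (gnorm z))" by simp
    also have "\<dots> \<longleftrightarrow> even (fst z + snd z)" unfolding int_gnorm by simp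
    finally show ?thesis .
  qed
  fix z assume "z \<in> {z \<in> prim. even (gnorm z)}"
  then have z: "coprime (fst z) (snd z)" "even (fst z + snd z)" using ev by (auto simp: prim_def)
  then have odd: "odd (fst z)" "odd (snd z)" by auto
  define x y where "x = (fst z + snd z) div 2" and "y = (snd z - fst z) div 2"
  have xy: "2 * x = fst z + snd z" "2 * y = snd z - fst z" using odd by (auto simp: x_def y_def)
  then have z12: "fst z = x - y" "snd z = x + y" by auto
  have "coprime x y"
  proof (rule coprimeI)
    fix c assume "c dvd x" "c dvd y"
    then have "c dvd x - y" "c dvd x + y" by simp_all
    then show "is_unit c" using z(1) coprime_common_divisor unfolding z12 by blast
  qed
  moreover have "odd (x + y)" using odd z12 by simp
  ultimately have "(x, y) \<in> prim_odd" using ev by (simp add: prim_odd_def prim_def)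
  moreover have "z = gmul (1, 1) (x, y)" by (simp add: gmul_def z12 prod_eq_iff add.commute)
  ultimately show "z \<in> gmul (1, 1) ` prim_odd" by blast
next
  fix z assume "z \<in> gmul (1, 1) ` prim_odd"
  then obtain w where w: "w \<in> prim_odd" "z = gmul (1, 1) w" by blast
  have g: "gnorm z = 2 * gnorm w" using w gnorm_gmul[of "(1,1)" w] by (simp add: gnorm_def)
  have "even (int (gnorm w)) \<longleftrightarrow> even (fst w + snd w)" unfolding int_gnorm by simp
  then have o: "odd (fst w + snd w)" using w(1) by (simp add: prim_odd_def)
  have c: "coprime (fst w) (snd w)" using w(1) by (simp add: prim_odd_def prim_def)
  have "coprime (fst w - snd w) (fst w + snd w)"
  proof (rule coprimeI)
    fix c assume cd: "c dvd fst w - snd w" "c dvd fst w + snd w"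
    have "odd c" using cd(2) o dvd_trans by blast
    then have c2: "coprime c 2" by simp
    have "c dvd 2 * fst w" "c dvd 2 * snd w"
      using dvd_add[OF cd] dvd_diff[OF cd(2) cd(1)] by simp_all
    then have "c dvd fst w" "c dvd snd w" using c2 by (simp_all add: coprime_dvd_mult_right_iff)
    then show "is_unit c" using c coprime_common_divisor by blast
  qed
  then show "z \<in> {z \<in> prim. even (gnorm z)}"
    using g by (simp add: prim_def w(2) gmul_def add.commute)
qed

text \<open>Orthogonality and equal lengths force w = i v, so a basis is determined by v, of norm
  n.\<close>

lemma card_reduced_square:
  assumes "0 < n"
  shows "card {b \<in> reduced_bases n. ip (fst b) (snd b) = 0} = repr2 n"
proof -
  have "{b \<in> reduced_bases n. ip (fst b) (snd b) = 0} = (\<lambda>v. (v, gmul (0, 1) v)) ` {v. gnorm v = n}"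
  proof (intro subset_antisym subsetI)
    fix b assume "b \<in> {b \<in> reduced_bases n. ip (fst b) (snd b) = 0}"
    then obtain v w where b: "b = (v, w)" "gnorm v = gnorm w" "dt v w = int n" "ip v w = 0"
      by (cases b) (auto simp: reduced_bases_def)
    have "(int n)\<^sup>2 = (int (gnorm v))\<^sup>2" using ip_dt[of v w] b
      by (simp add: power2_eq_square)
    then have N: "gnorm v = n" by simp
    \<comment> \<open>The determinant is the inner product of i v and w; here it equals the common
      norm, so the distance of w and i v is 0.\<close>
    have "int (gnorm (w - gmul (0, 1) v)) = int (gnorm v) + int (gnorm w) - 2 * dt v w"
      unfolding int_gnorm dt_def gmul_def by (simp add: algebra_simps power2_eq_square)
    then have "gnorm (w - gmul (0, 1) v) = 0" using b N by simp
    then have "w = gmul (0, 1) v" using gnorm_pos[of "w - gmul (0, 1) v"] by fastforce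
    then show "b \<in> (\<lambda>v. (v, gmul (0, 1) v)) ` {v. gnorm v = n}" using b N by auto
  next
    fix b assume "b \<in> (\<lambda>v. (v, gmul (0, 1) v)) ` {v. gnorm v = n}"
    then obtain v where v: "gnorm v = n" "b = (v, gmul (0, 1) v)" by blast
    have "gnorm (gmul (0, 1) v) = n" using v gnorm_gmul[of "(0,1)" v] by (simp add: gnorm_def)
    moreover have "dt v (gmul (0, 1) v) = int (gnorm v)" "ip v (gmul (0, 1) v) = 0"
      unfolding int_gnorm by (simp_all add: dt_def ip_def gmul_def power2_eq_square)
    ultimately show "b \<in> {b \<in> reduced_bases n. ip (fst b) (snd b) = 0}"
      using v assms by (simp add: reduced_bases_def)
  qed
  then show ?thesis by (simp add: card_image inj_on_def repr2_def)
qed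

text \<open>The turn (v, w) to (w, -v) keeps the orientation and changes the sign of the inner
  product.\<close>

lemma card_reduced_symm:
  "card {b \<in> reduced_bases n. ip (fst b) (snd b) > 0} = card {b \<in> reduced_bases n. ip (fst b) (snd b) < 0}"
proof -
  have gm: "gnorm (- z) = gnorm z" for z by (simp add: gnorm_def)
  have m: "dt w (- v) = dt v w" "dt (- w) v = dt v w" "ip w (- v) = - ip v w" "ip (- w) v = - ip v w" for v w
    by (auto simp: dt_def ip_def algebra_simps)
  have mem: "(w, - v) \<in> reduced_bases n \<longleftrightarrow> (v, w) \<in> reduced_bases n" "ip w (- v) = - ip v w" for v w
    using gm[of v] m[of w v] by (auto simp: reduced_bases_def)
  have mem': "(- w, v) \<in> reduced_bases n \<longleftrightarrow> (v, w) \<in> reduced_bases n" "ip (- w) v = - ip v w" for v w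
    using gm[of w] m[of w v] by (auto simp: reduced_bases_def)
  have "bij_betw (\<lambda>(v, w). (w, - v)) {b \<in> reduced_bases n. ip (fst b) (snd b) > 0}
      {b \<in> reduced_bases n. ip (fst b) (snd b) < 0}"
  proof (rule bij_betw_byWitness[where f' = "\<lambda>(v, w). (- w, v)"])
  qed (use mem mem' in auto)
  then show ?thesis by (rule bij_betw_same_card)
qed

lemma card_reduced_split:
  assumes "0 < n"
  shows "card (reduced_bases n) = repr2 n + 2 * card {b \<in> reduced_bases n. ip (fst b) (snd b) < 0}"
proof -
  define A where "A = (\<lambda>P. {b \<in> reduced_bases n. P (ip (fst b) (snd b))})"
  have fin: "finite (A P)" for P using finite_reduced_bases by (simp add: A_def)
  have "reduced_bases n = (A (\<lambda>x. x = 0) \<union> A (\<lambda>x. x < 0)) \<union> A (\<lambda>x. x > 0)"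
    by (auto simp: A_def)
  also have "card \<dots> = card (A (\<lambda>x. x = 0) \<union> A (\<lambda>x. x < 0)) + card (A (\<lambda>x. x > 0))"
    by (intro card_Un_disjoint finite_UnI fin) (auto simp: A_def)
  also have "card (A (\<lambda>x. x = 0) \<union> A (\<lambda>x. x < 0)) = card (A (\<lambda>x. x = 0)) + card (A (\<lambda>x. x < 0))"
    by (intro card_Un_disjoint fin) (auto simp: A_def)
  finally show ?thesis
    using card_reduced_symm card_reduced_square[OF assms] by (simp add: A_def)
qed

text \<open>The diagonals of the rhombus spanned by a reduced basis \<open>v, w\<close> are \<open>v + w = a z\<close> and
  \<open>w - v = b i z\<close> with \<open>z\<close> primitive; \<open>a < b\<close> means that the angle between \<open>v\<close> and \<open>w\<close> is obtuse.\<close>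

lemma diagonals:
  fixes a b :: int and z :: "int \<times> int"
  assumes "2 * fst v = a * fst z + b * snd z" "2 * snd v = a * snd z - b * fst z"
    and "2 * fst w = a * fst z - b * snd z" "2 * snd w = a * snd z + b * fst z"
  shows "4 * int (gnorm v) = (a\<^sup>2 + b\<^sup>2) * int (gnorm z)" "gnorm w = gnorm v"
    "4 * ip v w = (a\<^sup>2 - b\<^sup>2) * int (gnorm z)" "2 * dt v w = a * b * int (gnorm z)"
proof -
  have "4 * int (gnorm v) = (2 * fst v)\<^sup>2 + (2 * snd v)\<^sup>2"
    "4 * int (gnorm w) = (2 * fst w)\<^sup>2 + (2 * snd w)\<^sup>2"
    "4 * ip v w = (2 * fst v) * (2 * fst w) + (2 * snd v) * (2 * snd w)"
    "4 * dt v w = (2 * fst v) * (2 * snd w) - (2 * snd v) * (2 * fst w)"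
    unfolding int_gnorm ip_def dt_def by (simp_all add: power_mult_distrib)
  then have "4 * int (gnorm v) = (a\<^sup>2 + b\<^sup>2) * int (gnorm z) \<and> 4 * int (gnorm w) = (a\<^sup>2 + b\<^sup>2) * int (gnorm z)
    \<and> 4 * ip v w = (a\<^sup>2 - b\<^sup>2) * int (gnorm z) \<and> 4 * dt v w = 2 * (a * b * int (gnorm z))"
    unfolding assms int_gnorm[of z] by (simp add: algebra_simps power2_eq_square)
  then show "4 * int (gnorm v) = (a\<^sup>2 + b\<^sup>2) * int (gnorm z)" "gnorm w = gnorm v"
    "4 * ip v w = (a\<^sup>2 - b\<^sup>2) * int (gnorm z)" "2 * dt v w = a * b * int (gnorm z)"
    by linarith+
qed

definition rhombus :: "(nat \<times> nat) \<times> (int \<times> int) \<Rightarrow> (int \<times> int) \<times> (int \<times> int)" where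
  "rhombus x = (let a = int (fst (fst x)); b = int (snd (fst x)); z = snd x in
     (((a * fst z + b * snd z) div 2, (a * snd z - b * fst z) div 2),
      ((a * fst z - b * snd z) div 2, (a * snd z + b * fst z) div 2)))"

lemma rhombus_sides:
  assumes "x \<in> rectangles n" and "x = ((a, b), z)" and "rhombus x = (v, w)"
  shows "2 * fst v = int a * fst z + int b * snd z" "2 * snd v = int a * snd z - int b * fst z"
    and "2 * fst w = int a * fst z - int b * snd z" "2 * snd w = int a * snd z + int b * fst z"
proof -
  have ev: "even (int a * fst z + int b * snd z)" "even (int a * snd z + int b * fst z)"
    using assms(1) by (auto simp: rectangles_def assms(2))
  then have "even (int a * fst z - int b * snd z)" "even (int a * snd z - int b * fst z)" by auto
  with ev show "2 * fst v = int a * fst z + int b * snd z" "2 * snd v = int a * snd z - int b * fst z"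
    "2 * fst w = int a * fst z - int b * snd z" "2 * snd w = int a * snd z + int b * fst z"
    using assms(3) unfolding rhombus_def assms(2) Let_def by auto
qed

lemma bij_betw_rhombus:
  assumes "0 < n"
  shows "bij_betw rhombus (rectangles n) {b \<in> reduced_bases n. ip (fst b) (snd b) < 0}"
  unfolding bij_betw_def
proof
  show "inj_on rhombus (rectangles n)"
  proof (rule inj_onI)
    fix x x' assume x: "x \<in> rectangles n" "x' \<in> rectangles n" "rhombus x = rhombus x'"
    obtain a b z where xa: "x = ((a, b), z)" by (metis prod.exhaust)
    obtain a' b' z' where xa': "x' = ((a', b'), z')" by (metis prod.exhaust)
    obtain v w where vw: "rhombus x = (v, w)" by (cases "rhombus x")
    note s = rhombus_sides[OF x(1) xa vw] rhombus_sides[OF x(2) xa' vw[unfolded x(3)]]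
    \<comment> \<open>Sums and differences of the sides give back a z and b i z; each splits
      uniquely into a factor and a primitive element, and i z is primitive along with z.\<close>
    have mem: "(a, z) \<in> {1..} \<times> prim" "(a', z') \<in> {1..} \<times> prim"
      "(b, (- snd z, fst z)) \<in> {1..} \<times> prim" "(b', (- snd z', fst z')) \<in> {1..} \<times> prim"
      using x(1,2) by (auto simp: xa xa' rectangles_def prim_def coprime_commute)
    note inj = bij_betw_imp_inj_on[OF bij_betw_scale, THEN inj_onD]
    have "scale (a, z) = scale (a', z')" using s by (simp add: scale_def)
    then have "(a, z) = (a', z')" by (rule inj[OF _ mem(1,2)])
    moreover have "scale (b, (- snd z, fst z)) = scale (b', (- snd z', fst z'))"
      using s by (simp add: scale_def)
    then have "(b, (- snd z, fst z)) = (b', (- snd z', fst z'))" by (rule inj[OF _ mem(3,4)])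
    ultimately show "x = x'" by (simp add: xa xa')
  qed
  show "rhombus ` rectangles n = {b \<in> reduced_bases n. ip (fst b) (snd b) < 0}"
  proof (intro subset_antisym subsetI)
    fix y assume "y \<in> rhombus ` rectangles n"
    then obtain x where x: "x \<in> rectangles n" "y = rhombus x" by blast
    obtain a b z where xa: "x = ((a, b), z)" by (metis prod.exhaust)
    obtain v w where vw: "rhombus x = (v, w)" by (cases "rhombus x")
    note d = diagonals[OF rhombus_sides[OF x(1) xa vw]]
    have r: "z \<in> prim" "0 < a" "a < b" "b\<^sup>2 < 3 * a\<^sup>2" "a * b * gnorm z = 2 * n"
      using x(1) by (auto simp: rectangles_def xa)
    have g: "int (gnorm z) > 0" using r(1) gnorm_pos zero_notin_prim by simp
    have ab: "(int a)\<^sup>2 < (int b)\<^sup>2" using r by (intro power_strict_mono) auto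
    have ba: "(int b)\<^sup>2 < 3 * (int a)\<^sup>2" using r(4) by (simp flip: of_nat_power)
    have "((int a)\<^sup>2 - (int b)\<^sup>2) * int (gnorm z) < 0" using ab g
      by (simp add: mult_neg_pos)
    then have ip: "ip v w < 0" using d(3) by linarith
    \<comment> \<open>Four times the reducedness condition in terms of the diagonals; it amounts to
      b^2 < 3 a^2.\<close>
    have "(2 * ((int b)\<^sup>2 - (int a)\<^sup>2)) * int (gnorm z) < ((int a)\<^sup>2 + (int b)\<^sup>2) * int (gnorm z)"
      using ba g by (intro mult_strict_right_mono) auto
    then have "2 * \<bar>ip v w\<bar> < int (gnorm v)" using d(1,3) ip by (simp add: algebra_simps)
    moreover have "2 * dt v w = 2 * int n" using d(4) r(5) by (simp flip: of_nat_mult)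
    ultimately show "y \<in> {b \<in> reduced_bases n. ip (fst b) (snd b) < 0}"
      using d(2) ip x(2) vw by (simp add: reduced_bases_def)
  next
    fix y assume "y \<in> {b \<in> reduced_bases n. ip (fst b) (snd b) < 0}"
    then obtain v w where y: "y = (v, w)" "gnorm v = gnorm w" "dt v w = int n"
      "2 * \<bar>ip v w\<bar> < int (gnorm v)" "ip v w < 0"
        by (cases y) (auto simp: reduced_bases_def)
    have "v + w \<noteq> 0"
    proof
      assume "v + w = 0"
      then have "w = - v" by (simp add: eq_neg_iff_add_eq_0 add.commute)
      then have "dt v w = 0" by (simp add: dt_def)
      then show False using y(3) assms by simp
    qed
    then obtain a z where az: "v + w = scale (a, z)" "a > 0" "z \<in> prim"
      using bij_betw_imp_surj_on[OF bij_betw_scale]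
      by (smt (verit, best) ComplI SigmaE atLeast_iff imageE less_eq_Suc_le One_nat_def singletonD)
    have z: "coprime (fst z) (snd z)" using az(3) by (simp add: prim_def)
    have s: "fst v + fst w = int a * fst z" "snd v + snd w = int a * snd z"
      using az(1) by (simp_all add: scale_def prod_eq_iff)
    define t where "t = w - v"
    \<comment> \<open>Equal side lengths make the diagonals orthogonal.\<close>
    have "(fst v + fst w) * fst t + (snd v + snd w) * snd t = int (gnorm w) - int (gnorm v)"
      unfolding int_gnorm t_def by (simp add: algebra_simps power2_eq_square)
    then have "int a * (fst z * fst t + snd z * snd t) = 0"
      using y(2) unfolding s by (simp add: algebra_simps)
    then have zt: "fst z * fst t + snd z * snd t = 0" using az(2) by simp
    \<comment> \<open>As z is primitive, Bezout's relation exhibits the orthogonal vector t as an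
      integer multiple b of i z.\<close>
    obtain k l where kl: "fst z * k + snd z * l = 1"
      using bezout_int[of "fst z" "snd z"] z by (auto simp: mult.commute coprime_iff_gcd_eq_1)
    define b where "b = k * snd t - l * fst t"
    have "b * fst z = (fst z * k + snd z * l) * snd t - l * (fst z * fst t + snd z * snd t)"
      by (simp add: b_def algebra_simps)
    then have t2: "snd t = b * fst z" by (simp add: kl zt)
    have "b * snd z = k * (fst z * fst t + snd z * snd t) - (fst z * k + snd z * l) * fst t"
      by (simp add: b_def algebra_simps)
    then have t1: "fst t = - b * snd z" by (simp add: kl zt)
    have sides: "2 * fst v = int a * fst z + b * snd z" "2 * snd v = int a * snd z - b * fst z"
      "2 * fst w = int a * fst z - b * snd z" "2 * snd w = int a * snd z + b * fst z"
      using s t1 t2 by (simp_all add: t_def)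
    note d = diagonals[OF sides]
    have g: "int (gnorm z) > 0" using az(3) gnorm_pos zero_notin_prim by simp
    have "int a * b * int (gnorm z) > 0" using d(4) y(3) assms by simp
    then have b0: "b > 0" using g az(2) by (simp add: zero_less_mult_iff)
    then obtain b' where b': "b = int b'" by (metis nonneg_int_cases less_imp_le)
    have "((int a)\<^sup>2 - b\<^sup>2) * int (gnorm z) < 0" using d(3) y(5) by linarith
    then have "(int a)\<^sup>2 < b\<^sup>2" using g by (simp add: mult_less_0_iff)
    then have lt: "a < b'" using power2_less_imp_less[of "int a" b] b0 by (simp add: b')
    have "(2 * (b\<^sup>2 - (int a)\<^sup>2)) * int (gnorm z) < ((int a)\<^sup>2 + b\<^sup>2) * int (gnorm z)"
      using d(1,3) y(4,5) by (simp add: algebra_simps)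
    then have "2 * (b\<^sup>2 - (int a)\<^sup>2) < (int a)\<^sup>2 + b\<^sup>2" using g
      by (simp add: mult_less_cancel_right)
    then have "int (b'\<^sup>2) < int (3 * a\<^sup>2)" by (simp add: b')
    then have ba: "b'\<^sup>2 < 3 * a\<^sup>2" by (simp only: of_nat_less_iff)
    have "int (a * b' * gnorm z) = int (2 * n)" using d(4) y(3) by (simp add: b')
    then have "a * b' * gnorm z = 2 * n" by (simp only: of_nat_eq_iff)
    moreover have "even (int a * fst z + b * snd z)" "even (int a * snd z + b * fst z)"
      unfolding sides[symmetric] by simp_all
    ultimately have "((a, b'), z) \<in> rectangles n"
      using az lt ba by (simp add: rectangles_def b')
    moreover have "rhombus ((a, b'), z) = y"
      unfolding rhombus_def Let_def fst_conv snd_conv b'[symmetric] sides[symmetric] y(1) by simp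
    ultimately show "y \<in> rhombus ` rectangles n" by blast
  qed
qed

text \<open>For a = 2 p and b = 2 q, division of \<open>a b |z|^2 = 2 n\<close> by 2 leaves a factor
  2 on the left.\<close>

definition rect_even :: "nat \<Rightarrow> ((nat \<times> nat) \<times> (int \<times> int)) set" where
  "rect_even n = {x \<in> side_pairs 1 \<times> prim. 2 * (fst (fst x) * snd (fst x) * gnorm (snd x)) = n}"

text \<open>Here the factor 2 on the right of \<open>a b |z|^2 = 2 n\<close> is cancelled by the
  norm of 1 + i.\<close>

definition rect_odd :: "nat \<Rightarrow> ((nat \<times> nat) \<times> (int \<times> int)) set" where
  "rect_odd n = {x \<in> side_pairs 2 \<times> prim_odd. fst (fst x) * snd (fst x) * gnorm (snd x) = n}"

text \<open>If \<open>a\<close> and \<open>b\<close> are odd, the parity condition forces \<open>1 + i\<close> to divide \<open>z\<close>.\<close>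

lemma rectangles_even_odd:
  "rectangles n = (\<lambda>((p, q), z). ((2 * p, 2 * q), z)) ` rect_even n
     \<union> (\<lambda>(ab, z). (ab, gmul (1, 1) z)) ` rect_odd n" (is "_ = ?E \<union> ?O")
proof (intro subset_antisym subsetI)
  fix x assume x: "x \<in> rectangles n"
  obtain a b z where xa: "x = ((a, b), z)" by (metis prod.exhaust)
  have r: "z \<in> prim" "0 < a" "a < b" "b\<^sup>2 < 3 * a\<^sup>2" "a * b * gnorm z = 2 * n"
    "even (int a * fst z + int b * snd z)" "even (int a * snd z + int b * fst z)"
    using x by (auto simp: rectangles_def xa)
  have nz: "odd (fst z) \<or> odd (snd z)"
    using r(1) coprime_common_divisor[of "fst z" "snd z" 2] by (auto simp: prim_def)
  show "x \<in> ?E \<union> ?O"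
  proof (cases "even a \<and> even b")
    case True
    then obtain p q where pq: "a = 2 * p" "b = 2 * q" by (auto elim!: evenE)
    then have "((p, q), z) \<in> rect_even n"
      using r by (auto simp: rect_even_def side_pairs_def power_mult_distrib)
    then show ?thesis by (force simp: xa pq)
  next
    case False
    \<comment> \<open>If exactly one of a and b were even, both coordinates of z would be even; if
      both are odd, the coordinates have equal parity and so are odd.\<close>
    then have o: "odd a" "odd b" "odd (fst z)" "odd (snd z)" using r(6,7) nz by auto
    have "even (int (gnorm z))" unfolding int_gnorm using o by simp
    then have "z \<in> gmul (1, 1) ` prim_odd" using r(1) prim_even by auto
    then obtain y where y: "y \<in> prim_odd" "z = gmul (1, 1) y" by blast
    have "gnorm z = 2 * gnorm y" using y gnorm_gmul[of "(1,1)" y] by (simp add: gnorm_def)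
    then have "((a, b), y) \<in> rect_odd n"
      using r y o by (auto simp: rect_odd_def side_pairs_def odd_iff_mod_2_eq_one)
    then show ?thesis by (force simp: xa y)
  qed
next
  fix x assume "x \<in> ?E \<union> ?O"
  then show "x \<in> rectangles n"
  proof
    assume "x \<in> ?E"
    then show ?thesis
      by (auto simp: rect_even_def rectangles_def side_pairs_def power_mult_distrib)
  next
    assume "x \<in> ?O"
    then obtain a b y where y: "x = ((a, b), gmul (1, 1) y)" "((a, b), y) \<in> rect_odd n" by auto
    then have r: "0 < a" "a < b" "b\<^sup>2 < 3 * a\<^sup>2" "odd a" "odd b" "y \<in> prim_odd" "a * b * gnorm y = n"
      by (auto simp: rect_odd_def side_pairs_def odd_iff_mod_2_eq_one)
    have "gmul (1, 1) y \<in> prim" using r prim_even by auto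
    moreover have "gnorm (gmul (1, 1) y) = 2 * gnorm y"
      using gnorm_gmul[of "(1,1)" y] by (simp add: gnorm_def)
    moreover have "even (int (gnorm (gmul (1, 1) y)))" using calculation by simp
    then have "even (fst (gmul (1, 1) y) + snd (gmul (1, 1) y))" unfolding int_gnorm by simp
    ultimately show ?thesis using r by (simp add: rectangles_def y)
  qed
qed

theorem a_square_eq:
  assumes "0 < n"
  shows "4 * a_square n = repr2 n + 2 * card (rect_even n) + 2 * card (rect_odd n)"
    and "finite (rect_even n)" "finite (rect_odd n)"
proof -
  let ?E = "(\<lambda>((p, q), z). ((2 * p, 2 * q), z)) :: (nat \<times> nat) \<times> (int \<times> int) \<Rightarrow> _"
  let ?O = "(\<lambda>(ab, z). (ab, gmul (1, 1) z)) :: (nat \<times> nat) \<times> (int \<times> int) \<Rightarrow> _"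
  have "finite (rectangles n)"
    using bij_betw_finite[OF bij_betw_rhombus[OF assms]] finite_reduced_bases[of n] by simp
  then have fin: "finite (?E ` rect_even n)" "finite (?O ` rect_odd n)"
    unfolding rectangles_even_odd by simp_all
  have inj: "inj_on ?E (rect_even n)" "inj_on ?O (rect_odd n)"
    using inj_gmul[of "(1, 1)"] by (auto simp: inj_on_def)
  show "finite (rect_even n)" "finite (rect_odd n)"
    using fin inj finite_image_iff by blast+
  have "?E ` rect_even n \<inter> ?O ` rect_odd n = {}"
    by (auto simp: rect_odd_def side_pairs_def)
  then have "card (rectangles n) = card (rect_even n) + card (rect_odd n)"
    using fin inj unfolding rectangles_even_odd by (simp add: card_Un_disjoint card_image)
  then show "4 * a_square n = repr2 n + 2 * card (rect_even n) + 2 * card (rect_odd n)"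
    using card_reduced_bases[OF assms] card_reduced_split[OF assms]
      bij_betw_same_card[OF bij_betw_rhombus[OF assms]] by simp
qed

section \<open>Dirichlet series\<close>

text \<open>The value at n = 0 is 0, so index 0 contributes nothing when sums over fibres run
  through all of \<open>nat\<close>.\<close>

definition np :: "nat \<Rightarrow> complex \<Rightarrow> complex" where
  "np n s = of_nat n powr - s"

lemma np_mult: "np (a * b) s = np a s * np b s"
  by (simp add: np_def powr_times_real)

lemma np_0 [simp]: "np 0 s = 0" and np_1 [simp]: "np (Suc 0) s = 1"
  by (simp_all add: np_def)

lemma np_power2: "np (n\<^sup>2) s = np n (2 * s)"
proof -
  have "- (2 * s) = - s + - s" by simp
  then show ?thesis by (simp only: power2_eq_square np_mult) (simp only: np_def powr_add)
qed

lemma norm_np: "norm (np n s) = real n powr - Re s"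
  by (simp add: np_def norm_powr_real_powr)

lemma has_sum_nat_atLeast_1_iff: "(f has_sum S) {1::nat..} \<longleftrightarrow> ((\<lambda>n. f (Suc n)) has_sum S) UNIV"
proof -
  have "bij_betw Suc UNIV {1..}"
    by (rule bij_betwI[of _ _ _ "\<lambda>n. n - 1"]) auto
  from has_sum_reindex_bij_betw[OF this, of f S] show ?thesis by simp
qed

lemma has_sum_imp_norm_summable_on:
  fixes f :: "'a \<Rightarrow> complex"
  shows "(f has_sum S) A \<Longrightarrow> (\<lambda>x. norm (f x)) summable_on A"
  by (metis has_sum_imp_summable summable_on_iff_abs_summable_on_complex)

text \<open>Sums are regrouped freely below, so the working notion is the unordered
  \<open>has_sum\<close>; this lemma returns to the ordered series of the definitions, with absolute
  convergence.\<close>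

lemma dirichlet_series_eqI:
  assumes "((\<lambda>n. a n * np n s) has_sum S) {1..}"
  shows "dirichlet_series a s = S"
    and "summable (\<lambda>n. norm (a (Suc n) * of_nat (Suc n) powr - s))"
proof -
  have *: "((\<lambda>n. a (Suc n) * np (Suc n) s) has_sum S) UNIV"
    using assms by (simp only: has_sum_nat_atLeast_1_iff)
  then show "dirichlet_series a s = S"
    unfolding dirichlet_series_def np_def by (metis has_sum_imp_sums sums_unique)
  have "(\<lambda>n. norm (a (Suc n) * np (Suc n) s)) summable_on UNIV"
    using * by (rule has_sum_imp_norm_summable_on)
  then show "summable (\<lambda>n. norm (a (Suc n) * of_nat (Suc n) powr - s))"
    unfolding np_def by (rule summable_on_imp_summable)
qed

lemma has_sum_dirichlet_series:
  assumes "Re s > 1" "\<And>n. norm (a n) \<le> 1"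
  shows "((\<lambda>n. a n * np n s) has_sum dirichlet_series a s) {1..}"
proof -
  have "summable (\<lambda>n. real n powr - Re s)" using assms(1)
    by (simp add: summable_real_powr_iff)
  then have "summable (\<lambda>n. real (Suc n) powr - Re s)" by (subst summable_Suc_iff)
  then have sn: "summable (\<lambda>n. norm (a (Suc n) * np (Suc n) s))"
  proof (rule summable_comparison_test'[where N = 0])
    fix n
    have "norm (a (Suc n)) * norm (np (Suc n) s) \<le> 1 * norm (np (Suc n) s)"
      using assms(2) by (intro mult_right_mono) auto
    then show "norm (norm (a (Suc n) * np (Suc n) s)) \<le> real (Suc n) powr - Re s"
      by (simp add: norm_mult norm_np)
  qed
  have "(\<lambda>n. a (Suc n) * np (Suc n) s) sums dirichlet_series a s"
    unfolding dirichlet_series_def np_def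
    using summable_norm_cancel[OF sn] by (simp add: np_def summable_sums)
  then show ?thesis
    unfolding has_sum_nat_atLeast_1_iff using norm_summable_imp_has_sum[OF sn] by blast
qed

lemma has_sum_zeta: "Re s > 1 \<Longrightarrow> ((\<lambda>n. np n s) has_sum zeta s) {1..}"
  using has_sum_dirichlet_series[of s "\<lambda>_. 1"] by (simp add: zeta_def)

lemma has_sum_L_chi4: "Re s > 1 \<Longrightarrow> ((\<lambda>n. chi4 n * np n s) has_sum L_chi4 s) {1..}"
  unfolding L_chi4_def by (rule has_sum_dirichlet_series) (auto simp: chi4_def)

lemma has_sum_Times_mult:
  fixes f :: "'a \<Rightarrow> complex" and g :: "'b \<Rightarrow> complex"
  assumes "(f has_sum a) A" "(g has_sum b) B"
  shows "((\<lambda>x. f (fst x) * g (snd x)) has_sum a * b) (A \<times> B)"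
proof -
  have f: "(\<lambda>x. norm (f x)) summable_on A" and g: "(\<lambda>x. norm (g x)) summable_on B"
    by (rule has_sum_imp_norm_summable_on, rule assms)+
  have "(\<lambda>x. norm (f (fst x) * g (snd x))) summable_on (A \<times> B)"
    unfolding Infinite_Sum.abs_summable_on_Sigma_iff
  proof (intro conjI ballI)
    show "(\<lambda>y. norm (f (fst (x, y)) * g (snd (x, y)))) summable_on B" for x
      using g by (simp add: norm_mult summable_on_cmult_right)
    show "(\<lambda>x. norm (\<Sum>\<^sub>\<infinity>y\<in>B. norm (f (fst (x, y)) * g (snd (x, y))))) summable_on A"
      using f by (simp add: norm_mult infsum_cmult_right' abs_mult infsum_nonneg summable_on_cmult_left)
  qed
  then have sm: "(\<lambda>x. f (fst x) * g (snd x)) summable_on (A \<times> B)"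
    by (simp add: summable_on_iff_abs_summable_on_complex)
  show ?thesis
  proof (rule has_sum_SigmaI[where g = "\<lambda>x. f x * b"])
    show "((\<lambda>y. f (fst (x, y)) * g (snd (x, y))) has_sum f x * b) B" for x
      using has_sum_cmult_right[OF assms(2)] by simp
    show "((\<lambda>x. f x * b) has_sum a * b) A" using has_sum_cmult_left[OF assms(1)] .
  qed (use sm in auto)
qed

lemma finite_fibers:
  assumes "\<And>n. 0 < n \<Longrightarrow> finite {x \<in> X. w x = n}" "\<And>x. x \<in> X \<Longrightarrow> 0 < (w x :: nat)"
  shows "finite {x \<in> X. w x = n}"
proof (cases "n = 0")
  case True
  then have "{x \<in> X. w x = n} = {}" using assms(2) by fastforce
  then show ?thesis by (simp only: finite.emptyI)
qed (use assms(1) in simp)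

lemma bij_betw_fibers: "bij_betw (\<lambda>x. (w x, x)) X (Sigma UNIV (\<lambda>n. {x \<in> X. w x = n}))"
  by (rule bij_betwI[of _ _ _ snd]) auto

lemma has_sum_fibers:
  fixes f :: "'a \<Rightarrow> complex"
  assumes "(f has_sum S) X" "\<And>n. finite {x \<in> X. w x = n}"
  shows "((\<lambda>n. \<Sum>x | x \<in> X \<and> w x = n. f x) has_sum S) UNIV"
proof -
  have "((\<lambda>p. f (snd p)) has_sum S) (Sigma UNIV (\<lambda>n. {x \<in> X. w x = n}))"
    using has_sum_reindex_bij_betw[OF bij_betw_fibers[where w = w and X = X], of "\<lambda>p. f (snd p)" S] assms(1)
    by simp
  then show ?thesis
    by (rule has_sum_SigmaD) (use assms(2) in \<open>auto intro!: has_sum_finiteI\<close>)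
qed

text \<open>Turns a sum over weighted objects into the Dirichlet series whose coefficients count the
  objects of weight n.\<close>

lemma has_sum_card_fibers:
  assumes "((\<lambda>x. np (w x) s) has_sum S) X" "\<And>n. 0 < n \<Longrightarrow> finite {x \<in> X. w x = n}"
    and "\<And>x. x \<in> X \<Longrightarrow> 0 < w x"
  shows "((\<lambda>n. of_nat (card {x \<in> X. w x = n}) * np n s) has_sum S) {1..}"
proof -
  have fin: "finite {x \<in> X. w x = n}" for n
    using finite_fibers[of X w] assms(2,3) by blast
  have "((\<lambda>n. of_nat (card {x \<in> X. w x = n}) * np n s) has_sum S) UNIV"
    using has_sum_fibers[OF assms(1) fin] by simp
  then show ?thesis by (rule has_sum_cong_neutral[THEN iffD1, rotated -1]) (auto simp: not_le)
qed

text \<open>The converse of regrouping: the terms are non-negative, so convergence of the grouped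
  series suffices.\<close>

lemma summable_on_fibers:
  assumes "(\<lambda>n. real (card {x \<in> X. w x = n}) * real n powr r) summable_on {1..}"
    and "\<And>n. 0 < n \<Longrightarrow> finite {x \<in> X. w x = n}" and "\<And>x. x \<in> X \<Longrightarrow> 0 < w x"
  shows "(\<lambda>x. real (w x) powr r) summable_on X"
proof -
  have fin: "finite {x \<in> X. w x = n}" for n
    using finite_fibers[of X w] assms(2,3) by blast
  have "(\<lambda>p. real (w (snd p)) powr r) summable_on (Sigma UNIV (\<lambda>n. {x \<in> X. w x = n}))"
  proof (rule summable_on_SigmaI)
    show "((\<lambda>y. real (w (snd (n, y))) powr r) has_sum
        real (card {x \<in> X. w x = n}) * real n powr r) {x \<in> X. w x = n}" for n
      using fin[of n] by (intro has_sum_finiteI) auto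
    show "(\<lambda>n. real (card {x \<in> X. w x = n}) * real n powr r) summable_on UNIV"
      using assms(1) by (rule summable_on_cong_neutral[THEN iffD1, rotated -1]) (auto simp: not_le)
  qed auto
  then show ?thesis
    using summable_on_reindex_bij_betw[OF bij_betw_fibers[where w = w and X = X],
        of "\<lambda>p. real (w (snd p)) powr r"] by simp
qed

lemma summable_on_np_iff: "(\<lambda>x. np (w x) s) summable_on X \<longleftrightarrow> (\<lambda>x. real (w x) powr - Re s) summable_on X"
  by (subst summable_on_iff_abs_summable_on_complex) (simp add: norm_np)

text \<open>Dirichlet convolution with the constant 1: group the pairs (d, e) by their
  product.\<close>

lemma has_sum_divisor_sum:
  assumes "((\<lambda>n. a n * np n s) has_sum A) {1..}" "Re s > 1"
  shows "((\<lambda>n. (\<Sum>d | d dvd n. a d) * np n s) has_sum A * zeta s) {1..}"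
proof -
  have "((\<lambda>x. a (fst x) * np (fst x) s * np (snd x) s) has_sum A * zeta s) ({1..} \<times> {1..})"
    by (rule has_sum_Times_mult[OF assms(1) has_sum_zeta[OF assms(2)]])
  then have hs: "((\<lambda>x. a (fst x) * np (fst x * snd x) s) has_sum A * zeta s) ({1..} \<times> {1..})"
    by (simp add: np_mult mult.assoc)
  have fib: "{x \<in> {1..} \<times> {1..}. fst x * snd x = n} = (if n = 0 then {} else (\<lambda>d. (d, n div d)) ` {d. d dvd n})"
    for n :: nat by (auto simp: image_iff)
  have "((\<lambda>n. \<Sum>x | x \<in> {1..} \<times> {1..} \<and> fst x * snd x = n. a (fst x) * np (fst x * snd x) s)
      has_sum A * zeta s) UNIV"
    using fib by (intro has_sum_fibers[OF hs]) auto
  moreover have "(\<Sum>x | x \<in> {1..} \<times> {1..} \<and> fst x * snd x = n. a (fst x) * np (fst x * snd x) s)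
      = (if n = 0 then 0 else (\<Sum>d | d dvd n. a d) * np n s)" for n
    unfolding fib by (auto simp: sum.reindex inj_on_def sum_distrib_right)
  ultimately have "((\<lambda>n. if n = 0 then 0 else (\<Sum>d | d dvd n. a d) * np n s) has_sum A * zeta s) UNIV"
    by simp
  then show ?thesis by (rule has_sum_cong_neutral[THEN iffD1, rotated -1]) (auto simp: not_le)
qed

section \<open>Moebius function and non-vanishing of zeta\<close>

definition moebius_mu :: "nat \<Rightarrow> int" where
  "moebius_mu n = (if squarefree n then (- 1) ^ card (prime_factors n) else 0)"

lemma abs_moebius_le_1: "\<bar>moebius_mu n\<bar> \<le> 1"
  by (simp add: moebius_mu_def)

text \<open>For a prime p dividing n, the squarefree divisors prime to p pair off with their
  multiples by p, and the signs cancel.\<close>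

lemma sum_moebius:
  assumes "0 < n"
  shows "(\<Sum>d | d dvd n. moebius_mu d) = (if n = 1 then 1 else 0)"
proof (cases "n = 1")
  case False
  then obtain p where p: "prime p" "p dvd n" using prime_factor_nat by blast
  have p0: "p > 0" using p(1) prime_gt_0_nat by blast
  define D where "D = {d. d dvd n \<and> squarefree d \<and> \<not> p dvd d}"
  have fin: "finite {d. d dvd n}" using assms by simp
  then have finD: "finite D" by (rule rev_finite_subset) (auto simp: D_def)
  have split: "{d. d dvd n \<and> squarefree d} = D \<union> (*) p ` D"
  proof (intro subset_antisym subsetI)
    fix d assume d: "d \<in> {d. d dvd n \<and> squarefree d}"
    show "d \<in> D \<union> (*) p ` D"
    proof (cases "p dvd d")
      case True
      then obtain e where e: "d = p * e" by (auto simp: dvd_def)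
      then have "\<not> p dvd e" using d p(1) squarefreeD[of d p] by (auto simp: power2_eq_square)
      moreover have "squarefree e" using d e squarefree_mono[of e d] by auto
      moreover have "e dvd n" using d e dvd_mult_right by blast
      ultimately have "e \<in> D" by (simp add: D_def)
      then show ?thesis using e by blast
    qed (use d in \<open>auto simp: D_def\<close>)
  next
    fix d assume "d \<in> D \<union> (*) p ` D"
    then show "d \<in> {d. d dvd n \<and> squarefree d}"
    proof
      assume "d \<in> (*) p ` D"
      then obtain e where e: "e \<in> D" "d = p * e" by blast
      then have c: "coprime p e" using p(1) by (auto simp: D_def intro: prime_imp_coprime)
      then have "p * e dvd n" using e p(2) by (auto simp: D_def intro: divides_mult)
      moreover have "squarefree (p * e)"
        using c e p(1) by (auto simp: D_def squarefree_mult_coprime squarefree_prime)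
      ultimately show ?thesis using e by simp
    qed (auto simp: D_def)
  qed
  have mu: "moebius_mu (p * d) = - moebius_mu d" if "d \<in> D" for d
  proof -
    have d: "d dvd n" "squarefree d" "\<not> p dvd d" "d > 0"
      using that assms by (auto simp: D_def intro!: Nat.gr0I)
    then have c: "coprime p d" using p(1) by (auto intro: prime_imp_coprime)
    have "prime_factors (p * d) = insert p (prime_factors d)"
      using p(1) d p0 by (simp add: prime_factors_product prime_prime_factors)
    moreover have "p \<notin> prime_factors d" using d by auto
    moreover have "squarefree (p * d)"
      using c d p(1) by (simp add: squarefree_mult_coprime squarefree_prime)
    ultimately show ?thesis using d by (simp add: moebius_mu_def)
  qed
  have "(\<Sum>d | d dvd n. moebius_mu d) = (\<Sum>d | d dvd n \<and> squarefree d. moebius_mu d)"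
    using fin by (intro sum.mono_neutral_right) (auto simp: moebius_mu_def)
  also have "\<dots> = (\<Sum>d\<in>D. moebius_mu d) + (\<Sum>d\<in>(*) p ` D. moebius_mu d)"
    unfolding split using finD by (intro sum.union_disjoint) (auto simp: D_def)
  also have "(\<Sum>d\<in>(*) p ` D. moebius_mu d) = (\<Sum>d\<in>D. - moebius_mu d)"
    using p0 mu by (subst sum.reindex) (auto simp: inj_on_def intro!: sum.cong)
  finally show ?thesis using False by (simp add: sum_negf)
qed (simp add: moebius_mu_def)

text \<open>Used twice: it shows that zeta has no zero for Re s > 1, and it evaluates the density of
  primitive elements.\<close>

lemma zeta_times_moebius:
  assumes "Re s > 1"
  shows "dirichlet_series (\<lambda>n. of_int (moebius_mu n)) s * zeta s = 1"
proof -
  have "norm (of_int (moebius_mu n) :: complex) \<le> 1" for n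
    using abs_moebius_le_1[of n] by (metis norm_of_int of_int_abs of_int_le_1_iff)
  then have "((\<lambda>n. of_int (moebius_mu n) * np n s) has_sum dirichlet_series (\<lambda>n. of_int (moebius_mu n)) s) {1..}"
    by (intro has_sum_dirichlet_series assms)
  note H = has_sum_divisor_sum[OF this assms]
  have "(\<Sum>d | d dvd n. of_int (moebius_mu d) :: complex) = (if n = 1 then 1 else 0)"
    if "n > 0" for n
    using arg_cong[OF sum_moebius[OF that], of of_int] by (simp split: if_splits)
  then have "((\<lambda>n. if n = 1 then 1 else 0) has_sum
      (dirichlet_series (\<lambda>n. of_int (moebius_mu n)) s * zeta s)) {1::nat..}"
    by (intro has_sum_cong[THEN iffD1, OF _ H]) auto
  moreover have "((\<lambda>n. if n = 1 then 1 else 0) has_sum (1::complex)) {1::nat..}"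
    by (rule has_sum_finite_neutralI[of "{1}"]) auto
  ultimately show ?thesis by (rule has_sum_unique)
qed

lemma zeta_nonzero: "Re s > 1 \<Longrightarrow> zeta (s :: complex) \<noteq> 0"
  using zeta_times_moebius by force

section \<open>Norm series of Gaussian integers and the decomposition of the generating
  function\<close>

lemma has_sum_gauss:
  assumes "Re s > 1"
  shows "((\<lambda>z. np (gnorm z) s) has_sum 4 * Phi_square s) (- {0})"
proof -
  define a where "a = (\<lambda>n. \<Sum>d | d dvd n. chi4 d :: complex)"
  have a: "of_nat (repr2 n) = 4 * a n" if "0 < n" for n
  proof -
    have "of_int (int (repr2 n)) = (of_int (4 * chi_sum n) :: complex)"
      using repr2_eq_chi_sum[OF that] by simp
    moreover have "of_int (chi_sum n) = a n"
      by (auto simp: a_def chi_sum_def chi4_def intro!: sum.cong)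
    ultimately show ?thesis by simp
  qed
  have fib: "{z \<in> - {0}. gnorm z = n} = {z. gnorm z = n}" if "n > 0" for n
    using that by (auto simp: gnorm_def)
  have fin: "finite {z \<in> - {0}. gnorm z = n}" for n
    by (rule finite_subset[OF _ finite_gnorm_eq[of n]]) auto
  have "((\<lambda>n. a n * np n s) has_sum L_chi4 s * zeta s) {1..}"
    unfolding a_def by (rule has_sum_divisor_sum[OF has_sum_L_chi4[OF assms] assms])
  then have "((\<lambda>n. 4 * (a n * np n s)) has_sum 4 * (L_chi4 s * zeta s)) {1..}"
    by (rule has_sum_cmult_right)
  also have "4 * (L_chi4 s * zeta s) = 4 * Phi_square s" by (simp add: Phi_square_def)
  finally have "((\<lambda>n. 4 * (a n * np n s)) has_sum 4 * Phi_square s) {1..}" .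
  \<comment> \<open>By the two-square theorem this is the grouped series; it yields summability over
    the lattice points and then fixes the value of the ungrouped sum.\<close>
  then have H: "((\<lambda>n. of_nat (card {z \<in> - {0}. gnorm z = n}) * np n s) has_sum 4 * Phi_square s) {1..}"
    by (rule has_sum_cong[THEN iffD1, rotated])
      (use a fib in \<open>auto simp: repr2_def\<close>)
  then have "(\<lambda>n. norm (of_nat (card {z \<in> - {0}. gnorm z = n}) * np n s)) summable_on {1..}"
    by (rule has_sum_imp_norm_summable_on)
  then have "(\<lambda>z. real (gnorm z) powr - Re s) summable_on (- {0})"
    by (intro summable_on_fibers fin gnorm_pos) (auto simp: norm_mult norm_np)
  then have "(\<lambda>z. np (gnorm z) s) summable_on (- {0})" by (simp add: summable_on_np_iff)
  then obtain S where S: "((\<lambda>z. np (gnorm z) s) has_sum S) (- {0})"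
    by (auto simp: summable_on_def)
  have "((\<lambda>n. of_nat (card {z \<in> - {0}. gnorm z = n}) * np n s) has_sum S) {1..}"
    by (rule has_sum_card_fibers[OF S]) (use fin gnorm_pos in auto)
  then have "S = 4 * Phi_square s" using H has_sum_unique by blast
  then show ?thesis using S by simp
qed

text \<open>Splitting off the gcd of the coordinates factors the sum over all non-zero elements as
  zeta(2 s) times this one.\<close>

lemma has_sum_prim:
  assumes "Re s > 1"
  shows "((\<lambda>z. np (gnorm z) s) has_sum 4 * Phi_square_pr s) prim"
proof -
  have "(\<lambda>z. np (gnorm z) s) summable_on prim"
    by (rule summable_on_subset[OF has_sum_imp_summable[OF has_sum_gauss[OF assms]]])
      (auto dest: zero_notin_prim)
  then obtain S where S: "((\<lambda>z. np (gnorm z) s) has_sum S) prim"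
    by (auto simp: summable_on_def)
  have z2: "Re (2 * s) > 1" using assms by simp
  have "((\<lambda>x. np (fst x) (2 * s) * np (gnorm (snd x)) s) has_sum zeta (2 * s) * S) ({1..} \<times> prim)"
    by (rule has_sum_Times_mult[OF has_sum_zeta[OF z2] S])
  then have "((\<lambda>x. np (gnorm (scale x)) s) has_sum zeta (2 * s) * S) ({1..} \<times> prim)"
    by (simp add: gnorm_scale np_mult np_power2)
  then have "((\<lambda>z. np (gnorm z) s) has_sum zeta (2 * s) * S) (- {0})"
    using has_sum_reindex_bij_betw[OF bij_betw_scale, of "\<lambda>z. np (gnorm z) s"] by blast
  then have "zeta (2 * s) * S = 4 * Phi_square s" using has_sum_gauss[OF assms] has_sum_unique
    by blast
  then have "S = 4 * Phi_square_pr s"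
    using zeta_nonzero[OF z2] by (simp add: Phi_square_pr_def Phi_square_def field_simps)
  then show ?thesis using S by simp
qed

lemma one_plus_two_powr_nonzero: "Re s > 0 \<Longrightarrow> 1 + 2 powr (- s) \<noteq> (0 :: complex)"
proof
  assume s: "Re s > 0" "1 + 2 powr (- s) = (0 :: complex)"
  then have "norm (2 powr (- s) :: complex) = norm (- 1 :: complex)"
    by (metis add_eq_0_iff2 add.commute)
  moreover have "norm (2 powr (- s) :: complex) = 2 powr (- Re s)"
    by (simp add: norm_powr_real_powr)
  moreover have "(2::real) powr (- Re s) < 2 powr 0" using s by (intro powr_less_mono) auto
  ultimately show False by simp
qed

text \<open>The primitive elements are those of odd norm and 1 + i times those, which contributes
  the factor 1 + 2^(-s).\<close>

lemma has_sum_prim_odd: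
  assumes "Re s > 1"
  shows "((\<lambda>z. np (gnorm z) s) has_sum 4 * Phi_square_pr s / (1 + 2 powr (- s))) prim_odd"
proof -
  have "(\<lambda>z. np (gnorm z) s) summable_on prim_odd"
    by (rule summable_on_subset[OF has_sum_imp_summable[OF has_sum_prim[OF assms]]])
      (auto simp: prim_odd_def)
  then obtain S where S: "((\<lambda>z. np (gnorm z) s) has_sum S) prim_odd"
    by (auto simp: summable_on_def)
  have "bij_betw (gmul (1, 1)) prim_odd {z \<in> prim. even (gnorm z)}"
    unfolding prim_even using inj_on_subset[OF inj_gmul[of "(1,1)"]] by (simp add: bij_betw_def)
  moreover have "gnorm (gmul (1, 1) z) = 2 * gnorm z" for z
    using gnorm_gmul[of "(1,1)" z] by (simp add: gnorm_def)
  then have "((\<lambda>z. np (gnorm (gmul (1, 1) z)) s) has_sum 2 powr (- s) * S) prim_odd"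
    using has_sum_cmult_right[OF S, of "2 powr (- s)"] by (simp add: np_mult) (simp add: np_def)
  ultimately have "((\<lambda>z. np (gnorm z) s) has_sum 2 powr (- s) * S) {z \<in> prim. even (gnorm z)}"
    using has_sum_reindex_bij_betw[of "gmul (1, 1)" prim_odd _ "\<lambda>z. np (gnorm z) s"]
      by blast
  from has_sum_Un_disjoint[OF S this]
  have "((\<lambda>z. np (gnorm z) s) has_sum S + 2 powr (- s) * S) (prim_odd \<union> {z \<in> prim. even (gnorm z)})"
    by (auto simp: prim_odd_def)
  also have "prim_odd \<union> {z \<in> prim. even (gnorm z)} = prim" by (auto simp: prim_odd_def)
  finally have "S + 2 powr (- s) * S = 4 * Phi_square_pr s"
    using has_sum_prim[OF assms] has_sum_unique by blast
  then have "S = 4 * Phi_square_pr s / (1 + 2 powr (- s))"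
    using one_plus_two_powr_nonzero[of s] assms by (simp add: field_simps)
  then show ?thesis using S by simp
qed

definition side_sum :: "nat \<Rightarrow> complex \<Rightarrow> complex" where
  "side_sum h s = (\<Sum>\<^sub>\<infinity>(p, q)\<in>side_pairs h. np p s * np q s)"

lemma has_sum_side:
  assumes "Re s > 1"
  shows "((\<lambda>x. np (fst x) s * np (snd x) s) has_sum side_sum h s) (side_pairs h)"
proof -
  have "(\<lambda>x. np (fst x) s * np (snd x) s) summable_on ({1..} \<times> {1..})"
    using has_sum_Times_mult[OF has_sum_zeta[OF assms] has_sum_zeta[OF assms]] has_sum_imp_summable
      by blast
  then have "(\<lambda>x. np (fst x) s * np (snd x) s) summable_on side_pairs h"
    by (rule summable_on_subset) (auto simp: side_pairs_def)
  then show ?thesis by (simp add: side_sum_def case_prod_unfold)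
qed

lemma less_sqrt3_iff: "real q < sqrt 3 * real p \<longleftrightarrow> q\<^sup>2 < 3 * p\<^sup>2"
proof -
  have "real q < sqrt 3 * real p \<longleftrightarrow> sqrt (real (q\<^sup>2)) < sqrt (real (3 * p\<^sup>2))"
    by (simp add: real_sqrt_mult)
  also have "\<dots> \<longleftrightarrow> q\<^sup>2 < 3 * p\<^sup>2"
    unfolding real_sqrt_less_iff of_nat_less_iff ..
  finally show ?thesis .
qed

lemma np_mult_eq: "np p s * np q s = 1 / (of_nat p powr s * of_nat q powr s)"
  by (simp add: np_def powr_minus field_simps)

text \<open>\<open>f\<close> is the change of variables between the iterated sums of the definitions
  and the unordered sum over pairs: the identity, or (k, l) to (2 k + 1, 2 l + 1).\<close>

lemma side_sum_eq_iterated: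
  assumes "Re s > 1" "bij_betw f (Sigma {1::nat..} B) (side_pairs h)" "\<And>k. k \<ge> 1 \<Longrightarrow> finite (B k)"
  shows "(\<Sum>\<^sub>\<infinity>k\<in>{1..}. \<Sum>l\<in>B k. 1 / (of_nat (fst (f (k, l))) powr s * of_nat (snd (f (k, l))) powr s))
    = side_sum h s"
proof -
  have "((\<lambda>x. np (fst (f x)) s * np (snd (f x)) s) has_sum side_sum h s) (Sigma {1::nat..} B)"
    using has_sum_side[OF assms(1)] has_sum_reindex_bij_betw[OF assms(2), of "\<lambda>x. np (fst x) s * np (snd x) s"]
    by blast
  then have "((\<lambda>k. \<Sum>l\<in>B k. np (fst (f (k, l))) s * np (snd (f (k, l))) s) has_sum side_sum h s) {1..}"
    by (rule has_sum_SigmaD) (use assms(3) in \<open>auto intro!: has_sum_finiteI\<close>)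
  then show ?thesis unfolding np_mult_eq by (rule infsumI)
qed

lemma finite_less_sqrt3: "finite {q. P q \<and> real q < x}"
  by (rule finite_subset[of _ "{..nat \<lceil>x\<rceil>}"]) (auto, linarith)

lemma Phi_wr_even_eq:
  assumes "Re s > 1"
  shows "Phi_wr_even s = 2 / 2 powr s * side_sum 1 s * Phi_square_pr s"
proof -
  have "bij_betw id (Sigma {1..} (\<lambda>p. {q. p < q \<and> real q < sqrt 3 * real p})) (side_pairs 1)"
    unfolding less_sqrt3_iff by (auto simp: bij_betw_def side_pairs_def)
  from side_sum_eq_iterated[OF assms this finite_less_sqrt3]
  show ?thesis by (simp add: Phi_wr_even_def)
qed

lemma Phi_wr_odd_eq:
  assumes "Re s > 1"
  shows "Phi_wr_odd s = 2 / (1 + 2 powr (- s)) * Phi_square_pr s * side_sum 2 s"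
proof -
  let ?B = "\<lambda>k. {l. k < l \<and> real l < sqrt 3 * real k + (sqrt 3 - 1) / 2}"
  have B: "real l < sqrt 3 * real k + (sqrt 3 - 1) / 2 \<longleftrightarrow> (2 * l + 1)\<^sup>2 < 3 * (2 * k + 1)\<^sup>2" for k l :: nat
    unfolding less_sqrt3_iff[symmetric] by (auto simp: field_simps)
  have "bij_betw (\<lambda>(k, l). (2 * k + 1, 2 * l + 1)) (Sigma {1..} ?B) (side_pairs 2)"
  proof (rule bij_betwI[of _ _ _ "\<lambda>(p, q). (p div 2, q div 2)"])
    show "(\<lambda>(p, q). (p div 2, q div 2)) \<in> side_pairs 2 \<rightarrow> Sigma {1..} ?B"
    proof
      fix x assume x: "x \<in> side_pairs 2"
      obtain p q where pq: "x = (p, q)" by (cases x)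
      have "odd p" "odd q" using x by (auto simp: pq side_pairs_def odd_iff_mod_2_eq_one)
      then obtain k l where kl: "p = 2 * k + 1" "q = 2 * l + 1" by (auto elim!: oddE)
      have lt: "k < l" "(2 * l + 1)\<^sup>2 < 3 * (2 * k + 1)\<^sup>2" using x
        by (auto simp: pq kl side_pairs_def)
      \<comment> \<open>For p = 1 no odd q > 1 satisfies q^2 < 3, so letting k start at 1 loses
        nothing.\<close>
      have "k \<noteq> 0"
      proof
        assume "k = 0"
        then have "(2 * l + 1)\<^sup>2 < 3" using lt by simp
        moreover have "3\<^sup>2 \<le> (2 * l + 1)\<^sup>2" using lt \<open>k = 0\<close>
          by (intro power_mono) auto
        ultimately show False by simp
      qed
      then show "(case x of (p, q) \<Rightarrow> (p div 2, q div 2)) \<in> Sigma {1..} ?B"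
        using lt by (simp add: pq kl B)
    qed
  qed (auto simp: B side_pairs_def odd_iff_mod_2_eq_one)
  from side_sum_eq_iterated[OF assms this finite_less_sqrt3]
  show ?thesis by (simp add: Phi_wr_odd_def)
qed

lemma mult_four_divide_halve: "a * (4 * b / c) / 2 = 2 / c * b * (a :: complex)"
  by (cases "c = 0") simp_all

theorem Phi_square_wr_decomposition:
  assumes "Re s > 1"
  shows "Phi_square_wr s = Phi_square s + Phi_wr_even s + Phi_wr_odd s"
    and "summable (\<lambda>n. norm (of_nat (a_square (Suc n)) * of_nat (Suc n) powr (- s)))"
proof -
  \<comment> \<open>\<open>E\<close> and \<open>U\<close> are the series of
    \<open>card (rect_even n)\<close> and \<open>card (rect_odd n)\<close>. Both contain the four
    units through 4 * \<open>Phi_square_pr\<close>, and each enters with weight 2/4, so the two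
    parts are E/2 and U/2.\<close>
  define E where "E = 2 powr (- s) * side_sum 1 s * (4 * Phi_square_pr s)"
  define U where "U = side_sum 2 s * (4 * Phi_square_pr s / (1 + 2 powr (- s)))"
  have sp: "0 < fst x * snd x" if "x \<in> side_pairs h" for x h
    using that by (auto simp: side_pairs_def)
  have pr: "0 < gnorm z" if "z \<in> prim \<or> z \<in> prim_odd" for z
    using that gnorm_pos[of z] zero_notin_prim[of z] by (auto simp: prim_odd_def)
  have "((\<lambda>n. of_nat (card {x \<in> side_pairs 1 \<times> prim. 2 * (fst (fst x) * snd (fst x) * gnorm (snd x)) = n}) * np n s)
      has_sum E) {1..}"
  proof (rule has_sum_card_fibers)
    show "((\<lambda>x. np (2 * (fst (fst x) * snd (fst x) * gnorm (snd x))) s) has_sum E) (side_pairs 1 \<times> prim)"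
      using has_sum_cmult_right[OF has_sum_Times_mult[OF has_sum_side[OF assms, of 1] has_sum_prim[OF assms]],
          of "2 powr (- s)"]
      unfolding E_def np_mult by (simp add: mult.assoc) (simp add: np_def)
  qed (use a_square_eq(2) sp pr in \<open>auto simp: rect_even_def\<close>)
  then have E: "((\<lambda>n. of_nat (card (rect_even n)) * np n s) has_sum E) {1..}"
    unfolding rect_even_def .
  have "((\<lambda>n. of_nat (card {x \<in> side_pairs 2 \<times> prim_odd. fst (fst x) * snd (fst x) * gnorm (snd x) = n}) * np n s)
      has_sum U) {1..}"
  proof (rule has_sum_card_fibers)
    show "((\<lambda>x. np (fst (fst x) * snd (fst x) * gnorm (snd x)) s) has_sum U) (side_pairs 2 \<times> prim_odd)"
      using has_sum_Times_mult[OF has_sum_side[OF assms, of 2] has_sum_prim_odd[OF assms]]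
      unfolding U_def np_mult by simp
  qed (use a_square_eq(3) sp pr in \<open>auto simp: rect_odd_def\<close>)
  then have U: "((\<lambda>n. of_nat (card (rect_odd n)) * np n s) has_sum U) {1..}"
    unfolding rect_odd_def .
  have G: "((\<lambda>n. of_nat (card {z \<in> - {0}. gnorm z = n}) * np n s) has_sum 4 * Phi_square s) {1..}"
    by (rule has_sum_card_fibers[OF has_sum_gauss[OF assms]])
      (auto intro: gnorm_pos finite_subset[OF _ finite_gnorm_eq])
  have "((\<lambda>n. (1 / 4) * (of_nat (card {z \<in> - {0}. gnorm z = n}) * np n s
        + 2 * (of_nat (card (rect_even n)) * np n s) + 2 * (of_nat (card (rect_odd n)) * np n s)))
      has_sum (1 / 4) * (4 * Phi_square s + 2 * E + 2 * U)) {1..}"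
    by (intro has_sum_cmult_right has_sum_add G E U)
  moreover have "(1 / 4) * (of_nat (card {z \<in> - {0}. gnorm z = n}) * np n s
        + 2 * (of_nat (card (rect_even n)) * np n s) + 2 * (of_nat (card (rect_odd n)) * np n s))
      = of_nat (a_square n) * np n s" if "n \<in> {1..}" for n
  proof -
    have n: "0 < n" using that by simp
    have "{z \<in> - {0}. gnorm z = n} = {z. gnorm z = n}" using n by (auto simp: gnorm_def)
    then have "card {z \<in> - {0}. gnorm z = n} = repr2 n" by (simp add: repr2_def)
    then have "4 * of_nat (a_square n) = (of_nat (card {z \<in> - {0}. gnorm z = n})
        + 2 * of_nat (card (rect_even n)) + 2 * of_nat (card (rect_odd n)) :: complex)"
      using arg_cong[OF a_square_eq(1)[OF n], of "of_nat :: nat \<Rightarrow> complex"] by simp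
    then have "of_nat (a_square n) = (1 / 4) * (of_nat (card {z \<in> - {0}. gnorm z = n})
        + 2 * of_nat (card (rect_even n)) + 2 * of_nat (card (rect_odd n)) :: complex)"
      by (metis mult.assoc mult.left_neutral nonzero_eq_divide_eq times_divide_eq_left zero_neq_numeral mult.commute)
    then show ?thesis by (simp only: distrib_right distrib_left mult.assoc)
  qed
  ultimately have "((\<lambda>n. of_nat (a_square n) * np n s) has_sum
      (1 / 4) * (4 * Phi_square s + 2 * E + 2 * U)) {1..}"
    by (subst (asm) has_sum_cong)
  note H = dirichlet_series_eqI[OF this]
  have "Phi_square_wr s = (1 / 4) * (4 * Phi_square s + 2 * E + 2 * U)"
    unfolding Phi_square_wr_def by (rule H(1))
  also have "\<dots> = Phi_square s + E / 2 + U / 2" by simp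
  also have "E / 2 = Phi_wr_even s"
    unfolding Phi_wr_even_eq[OF assms] E_def by (simp add: powr_minus field_simps)
  also have "U / 2 = Phi_wr_odd s"
    unfolding Phi_wr_odd_eq[OF assms] U_def by (rule mult_four_divide_halve)
  finally show "Phi_square_wr s = Phi_square s + Phi_wr_even s + Phi_wr_odd s" .
  show "summable (\<lambda>n. norm (of_nat (a_square (Suc n)) * of_nat (Suc n) powr (- s)))"
    by (rule H(2))
qed

section \<open>Comparison with integrals\<close>

text \<open>The value of \<open>\<integral>\<^sub>a\<^sup>b t powr - s dt\<close>.\<close>

definition powint :: "real \<Rightarrow> real \<Rightarrow> complex \<Rightarrow> complex" where
  "powint a b s = (if s = 1 then of_real (ln b - ln a)
     else (of_real b powr (1 - s) - of_real a powr (1 - s)) / (1 - s))"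

text \<open>The singularity at 1 is removable: away from 1 the function is the difference quotient
  at 1 of a^(1 - z) - b^(1 - z), and the value given at 1 is the derivative.\<close>

lemma holomorphic_powint:
  assumes "0 < a" "0 < b"
  shows "powint a b holomorphic_on A"
proof -
  define f where "f = (\<lambda>z. complex_of_real a powr (1 - z) - of_real b powr (1 - z))"
  have D: "((\<lambda>z. complex_of_real c powr (1 - z)) has_field_derivative - of_real (ln c)) (at 1)"
    if "c > 0" for c
  proof -
    have "((\<lambda>z. complex_of_real c powr z) has_field_derivative
        Ln (of_real c) * of_real c powr (1 - 1)) (at (1 - 1))"
      using that by (intro has_field_derivative_powr_right) auto
    moreover have "((\<lambda>z. 1 - z) has_field_derivative - 1) (at (1::complex))"
      by (auto intro!: derivative_eq_intros)
    ultimately show ?thesis using DERIV_chain2 that by (fastforce simp: Ln_of_real)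
  qed
  have "(f has_field_derivative (of_real (ln b - ln a))) (at 1)"
    unfolding f_def using DERIV_diff[OF D[OF assms(1)] D[OF assms(2)]] by simp
  then have d: "deriv f 1 = of_real (ln b - ln a)" by (rule DERIV_imp_deriv)
  have "f holomorphic_on UNIV" unfolding f_def by (intro holomorphic_intros) (use assms in auto)
  then have "(\<lambda>z. if z = 1 then deriv f 1 else (f z - f 1) / (z - 1)) holomorphic_on UNIV"
    by (rule pole_lemma_open) simp
  moreover have f1: "f 1 = 0" using assms by (simp add: f_def)
  have "(\<lambda>z. if z = 1 then deriv f 1 else (f z - f 1) / (z - 1)) = powint a b"
  proof
    fix z
    have "(f z - f 1) / (z - 1) = - f z / (1 - z)" unfolding f1 by (simp add: minus_divide_right)
    also have "\<dots> = (of_real b powr (1 - z) - of_real a powr (1 - z)) / (1 - z)"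
      by (simp only: f_def minus_diff_eq)
    finally show "(if z = 1 then deriv f 1 else (f z - f 1) / (z - 1)) = powint a b z"
      by (simp add: powint_def d)
  qed
  ultimately show ?thesis using holomorphic_on_subset by auto
qed

lemma powint_refl [simp]: "powint a a s = 0"
  by (simp add: powint_def)

lemma powint_add: "powint a b s + powint b c s = powint a c s"
  by (simp add: powint_def flip: add_divide_distrib)

lemma powint_scale:
  assumes "0 < p" "0 < b"
  shows "powint p (b * p) s = of_real p powr (1 - s) * powint 1 b s"
proof -
  have "complex_of_real (b * p) powr (1 - s) = of_real b powr (1 - s) * of_real p powr (1 - s)"
    using assms by (simp add: powr_times_real)
  then show ?thesis using assms by (simp add: powint_def ln_mult field_simps)
qed

lemma has_vector_derivative_powr:
  assumes "0 < t"
  shows "((\<lambda>t. complex_of_real t powr z) has_vector_derivative z * of_real t powr (z - 1)) (at t within A)"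
proof -
  have "((\<lambda>x. x powr z) has_field_derivative z * of_real t powr (z - 1)) (at (of_real t))"
    using assms by (intro has_field_derivative_powr) (auto simp: complex_nonpos_Reals_iff)
  from has_vector_derivative_real_field[OF this] show ?thesis
    by (rule has_vector_derivative_at_within)
qed

lemma has_vector_derivative_powint:
  assumes "0 < t"
  shows "((\<lambda>t. powint a t s) has_vector_derivative (of_real t powr (- s))) (at t within A)"
proof (cases "s = 1")
  case True
  have "((\<lambda>t. complex_of_real (ln t - ln a)) has_vector_derivative of_real (inverse t)) (at t within A)"
    using assms by (auto intro!: derivative_eq_intros
        simp: has_real_derivative_iff_has_vector_derivative[symmetric] divide_inverse)
  then show ?thesis using True assms by (simp add: powint_def powr_minus)
next
  case False
  have "((\<lambda>t. (complex_of_real t powr (1 - s) - of_real a powr (1 - s)) / (1 - s)) has_vector_derivative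
      ((1 - s) * of_real t powr ((1 - s) - 1) - 0) / (1 - s)) (at t within A)"
    by (intro derivative_intros has_vector_derivative_powr assms)
  then show ?thesis using False by (simp add: powint_def)
qed

lemma vector_differentiable_bound:
  fixes f :: "real \<Rightarrow> 'a :: real_normed_vector"
  assumes "convex S" "\<And>x. x \<in> S \<Longrightarrow> (f has_vector_derivative f' x) (at x within S)"
    and "\<And>x. x \<in> S \<Longrightarrow> norm (f' x) \<le> B" "x \<in> S" "y \<in> S"
  shows "norm (f x - f y) \<le> B * norm (x - y)"
proof (rule differentiable_bound[OF assms(1) _ _ assms(4,5)])
  have B: "0 \<le> B" using assms(3)[OF assms(4)] norm_ge_zero order_trans by blast
  fix x assume x: "x \<in> S"
  show "(f has_derivative (\<lambda>h. h *\<^sub>R f' x)) (at x within S)"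
    using assms(2)[OF x] by (simp add: has_vector_derivative_def)
  show "onorm (\<lambda>h. h *\<^sub>R f' x) \<le> B"
  proof (rule onorm_bound[OF B])
    fix h show "norm (h *\<^sub>R f' x) \<le> B * norm h"
      using mult_right_mono[OF assms(3)[OF x], of "norm h"] by (simp add: mult.commute)
  qed
qed

lemma norm_real_powr: "0 < t \<Longrightarrow> norm (complex_of_real t powr z) = t powr Re z"
  by (simp add: norm_powr_real_powr)

lemma norm_powr_diff_le:
  assumes "0 < a" "a \<le> t" "a \<le> c" "Re s \<ge> 0"
  shows "norm (complex_of_real t powr (- s) - of_real c powr (- s)) \<le> norm s * a powr (- Re s - 1) * \<bar>t - c\<bar>"
proof -
  have "norm (complex_of_real t powr (- s) - of_real c powr (- s)) \<le> (norm s * a powr (- Re s - 1)) * norm (t - c)"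
  proof (rule vector_differentiable_bound[of "{a..}"])
    fix x assume x: "x \<in> {a..}"
    then show "((\<lambda>t. complex_of_real t powr (- s)) has_vector_derivative (- s) * of_real x powr (- s - 1)) (at x within {a..})"
      using assms by (intro has_vector_derivative_powr) auto
    have "x powr (- Re s - 1) \<le> a powr (- Re s - 1)"
      using x assms by (intro powr_mono2') auto
    then show "norm ((- s) * complex_of_real x powr (- s - 1)) \<le> norm s * a powr (- Re s - 1)"
      using x assms by (simp add: norm_mult norm_real_powr mult_left_mono)
  qed (use assms in auto)
  then show ?thesis by simp
qed

text \<open>Error of the rectangle rule on one interval, with an arbitrary node c: the left endpoint
  serves for zeta, the right endpoint for the sums over q.\<close>

lemma norm_powint_diff_le:
  assumes "0 < a" "a \<le> b" "a \<le> c" "c \<le> b" "Re s \<ge> 0"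
  shows "norm (powint a b s - of_real (b - a) * of_real c powr (- s))
    \<le> norm s * a powr (- Re s - 1) * (b - a)\<^sup>2"
proof -
  define \<phi> where "\<phi> = (\<lambda>t. powint a t s - of_real (t - a) * of_real c powr (- s))"
  have "norm (\<phi> b - \<phi> a) \<le> (norm s * a powr (- Re s - 1) * (b - a)) * norm (b - a)"
  proof (rule vector_differentiable_bound[of "{a..b}"])
    fix x assume x: "x \<in> {a..b}"
    then have "(\<phi> has_vector_derivative of_real x powr (- s) - (of_real (x - a) * 0 + (1 - 0) * of_real c powr (- s)))
        (at x within {a..b})"
      unfolding \<phi>_def using assms
      by (intro has_vector_derivative_diff has_vector_derivative_powint)
         (auto intro!: derivative_eq_intros)
    then show "(\<phi> has_vector_derivative of_real x powr (- s) - of_real c powr (- s)) (at x within {a..b})"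
      by simp
    have "norm (complex_of_real x powr (- s) - of_real c powr (- s)) \<le> norm s * a powr (- Re s - 1) * \<bar>x - c\<bar>"
      using x assms by (intro norm_powr_diff_le) auto
    also have "\<dots> \<le> norm s * a powr (- Re s - 1) * (b - a)"
      using x assms by (intro mult_left_mono) auto
    finally show "norm (complex_of_real x powr (- s) - of_real c powr (- s)) \<le> norm s * a powr (- Re s - 1) * (b - a)" .
  qed (use assms in auto)
  then show ?thesis using assms by (simp add: \<phi>_def power2_eq_square mult.assoc)
qed

lemma norm_powint_le:
  assumes "0 < a" "a \<le> b" "Re s \<ge> 0"
  shows "norm (powint a b s) \<le> (b - a) * a powr (- Re s)"
proof -
  have "norm (powint a b s - powint a a s) \<le> a powr (- Re s) * norm (b - a)"
  proof (rule vector_differentiable_bound[of "{a..b}"])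
    fix x assume x: "x \<in> {a..b}"
    then show "((\<lambda>t. powint a t s) has_vector_derivative of_real x powr (- s)) (at x within {a..b})"
      using assms by (intro has_vector_derivative_powint) auto
    show "norm (complex_of_real x powr - s) \<le> a powr - Re s"
      using x assms by (simp add: norm_real_powr powr_mono2')
  qed (use assms in auto)
  then show ?thesis using assms by (simp add: mult.commute)
qed

section \<open>Continuation of zeta and L to Re s > 0\<close>

lemma holomorphic_dirichlet_type_series:
  fixes f :: "nat \<Rightarrow> complex \<Rightarrow> complex"
  assumes hol: "\<And>n. f n holomorphic_on {s. Re s > c}"
    and bound: "\<And>n s. Re s > c \<Longrightarrow> norm (f n s) \<le> K * (norm s + 1) * real (Suc n) powr - (k * Re s + m)"
    and km: "k > 0" "k * c + m = 1" "K \<ge> 0"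
  shows "(\<lambda>s. \<Sum>n. f n s) holomorphic_on {s. Re s > c}"
    and "Re s > c \<Longrightarrow> (\<lambda>n. f n s) sums (\<Sum>n. f n s)"
proof -
  have op: "open {s. Re s > c}" by (simp add: open_halfspace_Re_gt)
  obtain g where g: "\<forall>x\<in>{s. Re s > c}. ((\<lambda>n. f n x) sums g x) \<and> g field_differentiable (at x)"
  proof (rule series_differentiable_comparison_complex[OF op])
    show "f n field_differentiable (at x)" if "x \<in> {s. Re s > c}" for n x
      using hol op that holomorphic_on_imp_differentiable_at by blast
    fix x assume "x \<in> {s. Re s > c}"
    then have x: "Re x > c" by simp
    define d where "d = (Re x - c) / 2"
    \<comment> \<open>With half the distance to the boundary line as radius, Re y >= c + d on the
      ball; since k c + m = 1, the exponent k (c + d) + m then exceeds 1 and the Weierstrass test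
      applies.\<close>
    have d: "d > 0" "Re x - d = c + d" using x by (simp_all add: d_def field_simps)
    define h where "h = (\<lambda>n. complex_of_real (K * (norm x + d + 1) * real (Suc n) powr - (k * (c + d) + m)))"
    have "k * d > 0" using km d by simp
    then have ex: "k * (c + d) + m > 1" using km by (simp add: distrib_left)
    have "summable (\<lambda>n. real (Suc n) powr - (k * (c + d) + m))"
      using ex by (subst summable_Suc_iff) (simp add: summable_real_powr_iff)
    then have "summable h" unfolding h_def by (intro summable_of_real summable_mult)
    moreover have "range h \<subseteq> \<real>\<^sub>\<ge>\<^sub>0" using km d by (auto simp: h_def)
    moreover have "norm (f n y) \<le> norm (h n)"
      if y: "y \<in> ball x d \<inter> {s. Re s > c}" for n y
    proof -
      have dist: "norm (y - x) < d" using y by (simp add: dist_norm norm_minus_commute)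
      have ny: "norm y \<le> norm x + d" using norm_triangle_ineq2[of y x] dist by linarith
      have "\<bar>Re (y - x)\<bar> < d" using abs_Re_le_cmod[of "y - x"] dist by linarith
      then have ry: "Re y \<ge> c + d" using d by simp
      have "norm (f n y) \<le> K * (norm y + 1) * real (Suc n) powr - (k * Re y + m)"
        using y by (intro bound) auto
      also have "\<dots> \<le> K * (norm x + d + 1) * real (Suc n) powr - (k * (c + d) + m)"
        using ny ry km d by (intro mult_mono mult_left_mono powr_mono) auto
      also have "\<dots> = norm (h n)" using km d unfolding h_def norm_of_real by simp
      finally show ?thesis .
    qed
    ultimately show "\<exists>d h. 0 < d \<and> summable h \<and> range h \<subseteq> \<real>\<^sub>\<ge>\<^sub>0 \<and>
        (\<forall>\<^sub>F n in sequentially. \<forall>y\<in>ball x d \<inter> {s. Re s > c}. cmod (f n y) \<le> cmod (h n))"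
      using d by (intro exI[of _ d] exI[of _ h]) auto
  qed (use that in blast)
  have eq: "g s = (\<Sum>n. f n s)" if "Re s > c" for s using g that sums_unique by fastforce
  have "g holomorphic_on {s. Re s > c}"
    using g by (auto simp: holomorphic_on_def intro: field_differentiable_at_within)
  then show "(\<lambda>s. \<Sum>n. f n s) holomorphic_on {s. Re s > c}"
    by (rule holomorphic_transform) (use eq in auto)
  show "(\<lambda>n. f n s) sums (\<Sum>n. f n s)" if "Re s > c" using g that eq by force
qed

lemma holomorphic_np: "(\<lambda>s. np n s) holomorphic_on A"
  unfolding np_def by (cases "n = 0") (auto intro!: holomorphic_intros)

text \<open>The continuation of (s - 1) zeta(s). Subtracting from each term its integral removes the
  total 1/(s - 1) and leaves terms of order n^(-Re s - 1); the product with s - 1 makes the value at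
  1 equal to 1.\<close>

definition zeta_reg :: "complex \<Rightarrow> complex" where
  "zeta_reg s = 1 + (s - 1) * (\<Sum>n. np (Suc n) s - powint (real (Suc n)) (real (Suc n + 1)) s)"

text \<open>Pairing the terms 4 n + 1 and 4 n + 3 gives differences of order n^(-Re s - 1), hence
  absolute convergence for Re s > 0.\<close>

definition L_ext :: "complex \<Rightarrow> complex" where
  "L_ext s = (\<Sum>n. np (4 * n + 1) s - np (4 * n + 3) s)"

lemma zeta_terms:
  "norm (np (Suc n) s - powint (real (Suc n)) (real (Suc n + 1)) s) \<le> 1 * (norm s + 1) * real (Suc n) powr - (1 * Re s + 1)"
  if "Re s > 0"
proof -
  have expo: "- Re s - 1 = - (1 * Re s + 1)" by simp
  have "norm (powint (real (Suc n)) (real (Suc n + 1)) s - of_real (real (Suc n + 1) - real (Suc n)) * of_real (real (Suc n)) powr (- s))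
     \<le> norm s * real (Suc n) powr (- Re s - 1) * (real (Suc n + 1) - real (Suc n))\<^sup>2"
    using that by (intro norm_powint_diff_le) auto
  also have "\<dots> \<le> (norm s + 1) * real (Suc n) powr (- Re s - 1)"
    by (simp add: distrib_right)
  finally show ?thesis unfolding expo by (simp add: np_def norm_minus_commute algebra_simps)
qed

lemma holomorphic_zeta_reg: "zeta_reg holomorphic_on {s. Re s > 0}"
proof -
  have "(\<lambda>s. \<Sum>n. np (Suc n) s - powint (real (Suc n)) (real (Suc n + 1)) s) holomorphic_on {s. Re s > 0}"
  proof (rule holomorphic_dirichlet_type_series(1)[OF _ zeta_terms])
    show "(\<lambda>s. np (Suc n) s - powint (real (Suc n)) (real (Suc n + 1)) s) holomorphic_on {s. Re s > 0}" for n
      by (intro holomorphic_on_diff holomorphic_np holomorphic_powint) auto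
  qed auto
  then show ?thesis unfolding zeta_reg_def by (intro holomorphic_intros)
qed

lemma zeta_reg_eq:
  assumes "Re s > 1"
  shows "zeta_reg s = (s - 1) * zeta s"
proof -
  have s1: "s \<noteq> 1" using assms by auto
  have z: "(\<lambda>n. np (Suc n) s) sums zeta s"
    using has_sum_zeta[OF assms] unfolding has_sum_nat_atLeast_1_iff by (rule has_sum_imp_sums)
  have "(\<lambda>n. complex_of_real (real (Suc n)) powr (1 - s)) \<longlonglongrightarrow> 0"
  proof (rule tendsto_norm_zero_cancel)
    have "((\<lambda>x. x powr (1 - Re s)) \<longlongrightarrow> 0) at_top"
      using assms by (intro tendsto_neg_powr filterlim_ident) auto
    then have "(\<lambda>n. real (Suc n) powr (1 - Re s)) \<longlonglongrightarrow> 0"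
      by (rule filterlim_compose) (rule filterlim_compose[OF filterlim_real_sequentially filterlim_Suc])
    moreover have "norm (complex_of_real (real (Suc n)) powr (1 - s)) = real (Suc n) powr (1 - Re s)" for n
      by (subst norm_real_powr) simp_all
    ultimately show "(\<lambda>n. norm (complex_of_real (real (Suc n)) powr (1 - s))) \<longlonglongrightarrow> 0"
      by (simp only:)
  qed
  then have "(\<lambda>n. (complex_of_real (real (Suc n)) powr (1 - s) - 1) / (1 - s)) \<longlonglongrightarrow> (0 - 1) / (1 - s)"
    using s1 by (intro tendsto_intros) auto
  \<comment> \<open>The integrals telescope to the integral from 1 to n + 1, whose limit is 1/(s -
    1).\<close>
  moreover have "(\<Sum>k<n. powint (real (Suc k)) (real (Suc k + 1)) s) = (complex_of_real (real (Suc n)) powr (1 - s) - 1) / (1 - s)" for n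
  proof -
    have "(\<Sum>k<n. powint (real (Suc k)) (real (Suc k + 1)) s) = powint 1 (real (Suc n)) s"
      by (induction n) (use powint_add in \<open>auto simp: add_ac\<close>)
    then show ?thesis using s1 by (simp add: powint_def)
  qed
  ultimately have "(\<lambda>n. powint (real (Suc n)) (real (Suc n + 1)) s) sums (1 / (s - 1))"
    unfolding sums_def using s1 by (simp add: minus_divide_right)
  from sums_diff[OF z this] have "(\<Sum>n. np (Suc n) s - powint (real (Suc n)) (real (Suc n + 1)) s) = zeta s - 1 / (s - 1)"
    using sums_unique by metis
  then show ?thesis using s1 by (simp add: zeta_reg_def field_simps)
qed

lemma L_ext_holomorphic: "L_ext holomorphic_on {s. Re s > 0}"
  and L_ext_sums: "Re s > 0 \<Longrightarrow> (\<lambda>n. np (4 * n + 1) s - np (4 * n + 3) s) sums L_ext s"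
proof -
  have hol: "(\<lambda>s. np (4 * n + 1) s - np (4 * n + 3) s) holomorphic_on {s. Re s > 0}" for n
    by (intro holomorphic_on_diff holomorphic_np)
  have bd: "norm (np (4 * n + 1) s - np (4 * n + 3) s) \<le> 2 * (norm s + 1) * real (Suc n) powr - (1 * Re s + 1)"
    if "Re s > 0" for n s
  proof -
    have expo: "- Re s - 1 = - (1 * Re s + 1)" by simp
    have "norm (complex_of_real (real (4 * n + 1)) powr (- s) - of_real (real (4 * n + 3)) powr (- s))
        \<le> norm s * real (4 * n + 1) powr (- Re s - 1) * \<bar>real (4 * n + 1) - real (4 * n + 3)\<bar>"
      using that by (intro norm_powr_diff_le) auto
    also have "\<dots> = 2 * (norm s * real (4 * n + 1) powr (- Re s - 1))" by simp
    also have "\<dots> \<le> 2 * ((norm s + 1) * real (Suc n) powr (- Re s - 1))"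
      using that by (intro mult_left_mono mult_mono powr_mono2') auto
    finally show ?thesis unfolding expo by (simp add: np_def algebra_simps)
  qed
  note H = holomorphic_dirichlet_type_series[of "\<lambda>n s. np (4 * n + 1) s - np (4 * n + 3) s" 0 2 1 1, OF hol bd]
  show "L_ext holomorphic_on {s. Re s > 0}" unfolding L_ext_def by (rule H(1)) auto
  show "(\<lambda>n. np (4 * n + 1) s - np (4 * n + 3) s) sums L_ext s" if "Re s > 0"
    unfolding L_ext_def by (rule H(2)) (use that in auto)
qed

lemma L_ext_eq:
  assumes "Re s > 1"
  shows "L_ext s = L_chi4 s"
proof -
  have "(\<lambda>n. chi4 (Suc n) * np (Suc n) s) sums L_chi4 s"
    using has_sum_L_chi4[OF assms] unfolding has_sum_nat_atLeast_1_iff by (rule has_sum_imp_sums)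
  from sums_group[OF this, of 4]
  have "(\<lambda>n. \<Sum>k\<in>{n * 4..<n * 4 + 4}. chi4 (Suc k) * np (Suc k) s) sums L_chi4 s"
    by simp
  moreover have "(\<Sum>k\<in>{n * 4..<n * 4 + 4}. chi4 (Suc k) * np (Suc k) s) = np (4 * n + 1) s - np (4 * n + 3) s" for n
  proof -
    have "{n * 4..<n * 4 + 4} = {4 * n, 4 * n + 1, 4 * n + 2, 4 * n + 3}" by auto
    moreover have "chi4 (Suc (4 * n)) = (1::complex)" "chi4 (Suc (4 * n + 1)) = (0::complex)"
      "chi4 (Suc (4 * n + 2)) = (- 1::complex)" "chi4 (Suc (4 * n + 3)) = (0::complex)"
      unfolding chi4_eq by (auto simp: mod_Suc)
    ultimately show ?thesis by (simp add: eval_nat_numeral)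
  qed
  ultimately have "(\<lambda>n. np (4 * n + 1) s - np (4 * n + 3) s) sums L_chi4 s" by simp
  moreover have "(\<lambda>n. np (4 * n + 1) s - np (4 * n + 3) s) sums L_ext s"
    using assms by (intro L_ext_sums) auto
  ultimately show ?thesis using sums_unique2 by blast
qed


section \<open>The sum over q as a Riemann sum\<close>

lemma side_progression:
  assumes "0 < p" "p mod h = 1 mod h" "0 < h"
  obtains N where "{q. (p, q) \<in> side_pairs h} = (\<lambda>j. p + h * Suc j) ` {..<N}"
    and "real (p + h * N) < sqrt 3 * real p" "sqrt 3 * real p \<le> real (p + h * Suc N)"
proof -
  define N where "N = (LEAST N. sqrt 3 * real p \<le> real (p + h * Suc N))"
  \<comment> \<open>N = p is an index past the threshold because sqrt 3 < 2; this makes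
    \<open>LEAST\<close> meaningful.\<close>
  have "sqrt 3 * real p \<le> real (p + h * Suc p)"
  proof -
    have "sqrt 3 < 2" by (simp add: real_less_lsqrt)
    then have "sqrt 3 * real p \<le> 2 * real p" by (intro mult_right_mono) auto
    also have "2 * p \<le> p + h * Suc p" using assms(3) by (cases h) auto
    then have "2 * real p \<le> real (p + h * Suc p)"
      by (metis of_nat_le_iff of_nat_mult of_nat_numeral)
    finally show ?thesis .
  qed
  then have N: "sqrt 3 * real p \<le> real (p + h * Suc N)"
    unfolding N_def by (rule LeastI)
  have lt: "real (p + h * Suc j) < sqrt 3 * real p" if "j < N" for j
    using not_less_Least[OF that[unfolded N_def]] by (simp add: not_le)
  have "real p < sqrt 3 * real p" using assms(1) by (simp add: real_less_rsqrt)
  then have N': "real (p + h * N) < sqrt 3 * real p"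
    using lt[of "N - 1"] by (cases N) auto
  have "{q. (p, q) \<in> side_pairs h} = (\<lambda>j. p + h * Suc j) ` {..<N}"
  proof (intro subset_antisym subsetI)
    fix q assume "q \<in> {q. (p, q) \<in> side_pairs h}"
    then have q: "p < q" "real q < sqrt 3 * real p" "q mod h = p mod h"
      using assms by (auto simp: side_pairs_def less_sqrt3_iff)
    then have "h dvd q - p" by (simp flip: mod_eq_dvd_iff_nat)
    then obtain k where "q - p = h * k" by (auto simp: dvd_def)
    then have k: "q = p + h * k" using q(1) by simp
    then have "k \<noteq> 0" using q by auto
    then obtain j where j: "k = Suc j" using not0_implies_Suc by blast
    have "j < N"
    proof (rule ccontr)
      assume "\<not> j < N"
      then have "h * Suc N \<le> h * Suc j" by (intro mult_le_mono2) auto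
      then have "real (p + h * Suc N) \<le> real q" unfolding k j of_nat_le_iff by simp
      then show False using N q(2) by linarith
    qed
    then show "q \<in> (\<lambda>j. p + h * Suc j) ` {..<N}" using k j by auto
  next
    fix q assume "q \<in> (\<lambda>j. p + h * Suc j) ` {..<N}"
    then obtain j where j: "j < N" "q = p + h * Suc j" by auto
    have "q mod h = p mod h" unfolding j(2) by (rule mod_mult_self2)
    then show "q \<in> {q. (p, q) \<in> side_pairs h}"
      using assms lt[of j] j by (auto simp: side_pairs_def simp flip: less_sqrt3_iff)
  qed
  then show ?thesis using that N' N by blast
qed

text \<open>Riemann sum with step h minus integral, divided by h. The value 0 outside the residue
  class lets the series below run over all p.\<close>

definition side_error :: "nat \<Rightarrow> nat \<Rightarrow> complex \<Rightarrow> complex" where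
  "side_error h p s = (if p mod h = 1 mod h then
     (\<Sum>q | (p, q) \<in> side_pairs h. np q s) - powint (real p) (sqrt 3 * real p) s / of_nat h else 0)"

lemma norm_powint_progression:
  assumes "0 < p" "Re s \<ge> 0"
  shows "norm (of_nat h * (\<Sum>j<N. np (p + h * Suc j) s) - powint (real p) (real (p + h * N)) s)
    \<le> real N * (norm s * real p powr (- Re s - 1) * (real h)\<^sup>2)"
proof (induction N)
  case (Suc N)
  have "norm (powint (real (p + h * N)) (real (p + h * Suc N)) s
      - of_real (real (p + h * Suc N) - real (p + h * N)) * of_real (real (p + h * Suc N)) powr (- s))
      \<le> norm s * real (p + h * N) powr (- Re s - 1) * (real (p + h * Suc N) - real (p + h * N))\<^sup>2"
    using assms by (intro norm_powint_diff_le) (auto intro: add_pos_nonneg)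
  also have "real (p + h * Suc N) - real (p + h * N) = real h" by (simp add: algebra_simps)
  also have "norm s * real (p + h * N) powr (- Re s - 1) * (real h)\<^sup>2
      \<le> norm s * real p powr (- Re s - 1) * (real h)\<^sup>2"
    using assms by (intro mult_right_mono mult_left_mono powr_mono2') auto
  finally have step: "norm (of_nat h * np (p + h * Suc N) s - powint (real (p + h * N)) (real (p + h * Suc N)) s)
      \<le> norm s * real p powr (- Re s - 1) * (real h)\<^sup>2"
    by (simp add: np_def norm_minus_commute)
  have "of_nat h * (\<Sum>j<Suc N. np (p + h * Suc j) s) - powint (real p) (real (p + h * Suc N)) s
    = (of_nat h * (\<Sum>j<N. np (p + h * Suc j) s) - powint (real p) (real (p + h * N)) s)
      + (of_nat h * np (p + h * Suc N) s - powint (real (p + h * N)) (real (p + h * Suc N)) s)"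
    using powint_add[of "real p" "real (p + h * N)" s "real (p + h * Suc N)"]
      by (simp add: algebra_simps)
  then have "norm (of_nat h * (\<Sum>j<Suc N. np (p + h * Suc j) s) - powint (real p) (real (p + h * Suc N)) s)
    \<le> norm (of_nat h * (\<Sum>j<N. np (p + h * Suc j) s) - powint (real p) (real (p + h * N)) s)
      + norm (of_nat h * np (p + h * Suc N) s - powint (real (p + h * N)) (real (p + h * Suc N)) s)"
    by (simp only: norm_triangle_ineq)
  then show ?case using Suc step
    by (simp add: distrib_right del: of_nat_Suc) (simp add: algebra_simps)
qed simp

text \<open>The N full steps of length h fit between p and 2 p, so h N <= p and their errors add up
  to h |s| p^(-Re s); the incomplete last step costs at most h p^(-Re s). The case s = 1 is reused
  for the harmonic sums.\<close>

lemma norm_side_error_le: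
  assumes "0 < p" "0 < h" "Re s \<ge> 0"
  shows "norm (side_error h p s) \<le> (norm s + 1) * real p powr - Re s"
proof (cases "p mod h = 1 mod h")
  case True
  obtain N where N: "{q. (p, q) \<in> side_pairs h} = (\<lambda>j. p + h * Suc j) ` {..<N}"
    "real (p + h * N) < sqrt 3 * real p" "sqrt 3 * real p \<le> real (p + h * Suc N)"
    using side_progression[OF assms(1) True assms(2)] .
  have inj: "inj_on (\<lambda>j. p + h * Suc j) {..<N}" using assms(2) by (auto simp: inj_on_def)
  have img: "(\<Sum>q\<in>(\<lambda>j. p + h * Suc j) ` {..<N}. np q s) = (\<Sum>j<N. np (p + h * Suc j) s)"
    by (simp only: sum.reindex[OF inj] o_def)
  have e: "of_nat h * side_error h p s = (of_nat h * (\<Sum>j<N. np (p + h * Suc j) s) - powint (real p) (real (p + h * N)) s)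
      - powint (real (p + h * N)) (sqrt 3 * real p) s"
    using True assms(2) powint_add[of "real p" "real (p + h * N)" s "sqrt 3 * real p"]
    unfolding side_error_def N(1) img by (simp add: field_simps)
  have "sqrt 3 \<le> 2" by (simp add: real_le_lsqrt)
  then have "sqrt 3 * real p \<le> 2 * real p" by (intro mult_right_mono) auto
  then have hN: "real h * real N \<le> real p" using N(2) by simp
  have p': "real p powr (- Re s - 1) * real p = real p powr - Re s"
    using assms(1) by (simp add: powr_diff)
  have "norm (powint (real (p + h * N)) (sqrt 3 * real p) s)
      \<le> (sqrt 3 * real p - real (p + h * N)) * real (p + h * N) powr (- Re s)"
    using assms N by (intro norm_powint_le) (auto intro: add_pos_nonneg)
  also have "\<dots> \<le> real h * real p powr (- Re s)"
    using assms N by (intro mult_mono powr_mono2') (auto simp: algebra_simps intro: add_pos_nonneg)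
  finally have 1: "norm (powint (real (p + h * N)) (sqrt 3 * real p) s) \<le> real h * real p powr (- Re s)" .
  have "norm (of_nat h * (\<Sum>j<N. np (p + h * Suc j) s) - powint (real p) (real (p + h * N)) s)
    \<le> real N * (norm s * real p powr (- Re s - 1) * (real h)\<^sup>2)"
    using assms by (intro norm_powint_progression) auto
  also have "\<dots> = real h * norm s * real p powr (- Re s - 1) * (real h * real N)"
    by (simp add: power2_eq_square)
  also have "\<dots> \<le> real h * norm s * real p powr (- Re s - 1) * real p"
    using hN by (intro mult_left_mono) auto
  also have "\<dots> = real h * (norm s * real p powr (- Re s))" by (simp add: mult.assoc p')
  finally have "norm (of_nat h * side_error h p s) \<le> real h * (norm s * real p powr (- Re s)) + real h * real p powr (- Re s)"
    unfolding e using 1 norm_triangle_ineq4 order_trans add_mono by meson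
  then have "real h * norm (side_error h p s) \<le> real h * ((norm s + 1) * real p powr - Re s)"
    by (simp add: norm_mult algebra_simps)
  then show ?thesis using assms(2) by simp
qed (simp add: side_error_def)

text \<open>Its terms are of order p^(-2 Re s), which explains the boundary 1/2.\<close>

definition side_rem :: "nat \<Rightarrow> complex \<Rightarrow> complex" where
  "side_rem h s = (\<Sum>n. np (Suc n) s * side_error h (Suc n) s)"

lemma side_rem_holomorphic: "0 < h \<Longrightarrow> side_rem h holomorphic_on {s. Re s > 1 / 2}"
  and side_rem_sums: "0 < h \<Longrightarrow> Re s > 1 / 2 \<Longrightarrow> (\<lambda>n. np (Suc n) s * side_error h (Suc n) s) sums side_rem h s"
proof -
  assume h: "0 < h"
  have hol: "(\<lambda>s. np (Suc n) s * side_error h (Suc n) s) holomorphic_on {s. Re s > 1 / 2}" for n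
    unfolding side_error_def using h
    by (cases "Suc n mod h = 1 mod h")
       (auto intro!: holomorphic_on_mult holomorphic_on_diff holomorphic_on_divide holomorphic_on_sum
         holomorphic_np holomorphic_powint)
  have bd: "norm (np (Suc n) s * side_error h (Suc n) s) \<le> 1 * (norm s + 1) * real (Suc n) powr - (2 * Re s + 0)"
    if "Re s > 1 / 2" for n s
  proof -
    have "norm (np (Suc n) s) * norm (side_error h (Suc n) s)
        \<le> real (Suc n) powr - Re s * ((norm s + 1) * real (Suc n) powr - Re s)"
      using h that by (intro mult_mono norm_side_error_le) (auto simp: norm_np)
    also have "\<dots> = (norm s + 1) * (real (Suc n) powr - Re s * real (Suc n) powr - Re s)"
      by simp
    also have "real (Suc n) powr - Re s * real (Suc n) powr - Re s = real (Suc n) powr - (2 * Re s + 0)"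
      by (simp flip: powr_add)
    finally show ?thesis by (simp add: norm_mult)
  qed
  note H = holomorphic_dirichlet_type_series[of "\<lambda>n s. np (Suc n) s * side_error h (Suc n) s" "1/2" 1 2 0, OF hol bd]
  show "side_rem h holomorphic_on {s. Re s > 1 / 2}" unfolding side_rem_def by (rule H(1)) auto
  show "(\<lambda>n. np (Suc n) s * side_error h (Suc n) s) sums side_rem h s" if "Re s > 1 / 2"
    unfolding side_rem_def by (rule H(2)) (use that in auto)
qed

definition zeta_class :: "nat \<Rightarrow> complex \<Rightarrow> complex" where
  "zeta_class h s = (\<Sum>\<^sub>\<infinity>p\<in>{p. 0 < p \<and> p mod h = 1 mod h}. np p s)"

lemma has_sum_zeta_class:
  assumes "Re s > 1"
  shows "((\<lambda>p. np p s) has_sum zeta_class h s) {p. 0 < p \<and> p mod h = 1 mod h}"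
proof -
  have "(\<lambda>p. np p s) summable_on {p. 0 < p \<and> p mod h = 1 mod h}"
    by (rule summable_on_subset[OF has_sum_imp_summable[OF has_sum_zeta[OF assms]]]) auto
  then show ?thesis by (simp add: zeta_class_def)
qed

lemma zeta_class_1: "zeta_class 1 s = zeta s" if "Re s > 1"
proof -
  have "{p::nat. 0 < p \<and> p mod 1 = 1 mod 1} = {1..}" by auto
  then show ?thesis unfolding zeta_class_def using has_sum_zeta[OF that] by (simp add: infsumI)
qed

text \<open>Restriction to odd p removes the Euler factor at 2.\<close>

lemma zeta_class_2: "zeta_class 2 s = (1 - 2 powr (- s)) * zeta s" if "Re s > 1"
proof -
  have "bij_betw (\<lambda>n::nat. 2 * n) {1..} {p. 0 < p \<and> even p}"
    by (rule bij_betwI[of _ _ _ "\<lambda>n. n div 2"]) (auto elim!: evenE)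
  moreover have "((\<lambda>n. np (2 * n) s) has_sum 2 powr (- s) * zeta s) {1..}"
    using has_sum_cmult_right[OF has_sum_zeta[OF that], of "2 powr (- s)"]
      by (simp add: np_mult) (simp add: np_def)
  ultimately have "((\<lambda>p. np p s) has_sum 2 powr (- s) * zeta s) {p. 0 < p \<and> even p}"
    using has_sum_reindex_bij_betw[of "\<lambda>n. 2 * n" "{1..}" _ "\<lambda>p. np p s"] by blast
  moreover have "{p::nat. 0 < p \<and> p mod 2 = 1 mod 2} \<inter> {p. 0 < p \<and> even p} = {}"
    by auto
  ultimately
  have "((\<lambda>p. np p s) has_sum zeta_class 2 s + 2 powr (- s) * zeta s)
      ({p. 0 < p \<and> p mod 2 = 1 mod 2} \<union> {p. 0 < p \<and> even p})"
    using has_sum_Un_disjoint[OF has_sum_zeta_class[OF that, of 2]] by blast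
  also have "{p::nat. 0 < p \<and> p mod 2 = 1 mod 2} \<union> {p. 0 < p \<and> even p} = {1..}"
    by (auto simp: odd_iff_mod_2_eq_one)
  finally have "zeta_class 2 s + 2 powr (- s) * zeta s = zeta s"
    using has_sum_zeta[OF that] has_sum_unique by blast
  then show ?thesis by (simp add: algebra_simps)
qed

lemma finite_side: "finite {q. (p, q) \<in> side_pairs h}"
  by (rule finite_subset[OF _ finite_less_sqrt3[of "\<lambda>_. True" "sqrt 3 * real p"]])
     (auto simp: side_pairs_def simp flip: less_sqrt3_iff)

lemma has_sum_diff_complex:
  fixes f g :: "'a \<Rightarrow> complex"
  assumes "(f has_sum a) A" "(g has_sum b) A"
  shows "((\<lambda>x. f x - g x) has_sum a - b) A"
  using has_sum_add[OF assms(1) has_sum_uminusI[OF assms(2)]] by simp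

lemma has_sum_side_iterated:
  assumes "Re s > 1"
  shows "((\<lambda>p. np p s * (\<Sum>q | (p, q) \<in> side_pairs h. np q s)) has_sum side_sum h s)
    {p. 0 < p \<and> p mod h = 1 mod h}"
proof -
  have "side_pairs h = Sigma {p. 0 < p \<and> p mod h = 1 mod h} (\<lambda>p. {q. (p, q) \<in> side_pairs h})"
    by (auto simp: side_pairs_def)
  then have "((\<lambda>x. np (fst x) s * np (snd x) s) has_sum side_sum h s)
      (Sigma {p. 0 < p \<and> p mod h = 1 mod h} (\<lambda>p. {q. (p, q) \<in> side_pairs h}))"
    using has_sum_side[OF assms, of h] by simp
  then show ?thesis
    by (rule has_sum_SigmaD) (auto intro!: has_sum_finiteI finite_side simp: sum_distrib_left)
qed

text \<open>The substitution t = p u turns the integral from p to sqrt 3 p into p^(1 - s) times a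
  fixed one; together with p^(-s) this sums to a zeta value at 2 s - 1.\<close>

lemma side_sum_eq:
  assumes "Re s > 1" "0 < h"
  shows "side_sum h s = powint 1 (sqrt 3) s / of_nat h * zeta_class h (2 * s - 1) + side_rem h s"
proof -
  let ?P = "{p::nat. 0 < p \<and> p mod h = 1 mod h}"
  have "((\<lambda>p. np p (2 * s - 1)) has_sum zeta_class h (2 * s - 1)) ?P"
    using assms by (intro has_sum_zeta_class) simp
  from has_sum_diff_complex[OF has_sum_side_iterated[OF assms(1), of h] has_sum_cmult_right[OF this, of "powint 1 (sqrt 3) s / of_nat h"]]
  have 1: "((\<lambda>p. np p s * (\<Sum>q | (p, q) \<in> side_pairs h. np q s) - powint 1 (sqrt 3) s / of_nat h * np p (2 * s - 1))
      has_sum side_sum h s - powint 1 (sqrt 3) s / of_nat h * zeta_class h (2 * s - 1)) ?P" .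
  have eq: "np p s * (\<Sum>q | (p, q) \<in> side_pairs h. np q s) - powint 1 (sqrt 3) s / of_nat h * np p (2 * s - 1)
      = np p s * side_error h p s" if "p \<in> ?P" for p
  proof -
    have "np p (2 * s - 1) = np p s * of_nat p powr (1 - s)"
      unfolding np_def powr_add[symmetric] by (simp add: algebra_simps)
    moreover have "powint (real p) (sqrt 3 * real p) s = of_nat p powr (1 - s) * powint 1 (sqrt 3) s"
      using powint_scale[of "real p" "sqrt 3" s] that by simp
    ultimately show ?thesis using that by (simp add: side_error_def algebra_simps)
  qed
  have "((\<lambda>p. np p s * side_error h p s) has_sum
      side_sum h s - powint 1 (sqrt 3) s / of_nat h * zeta_class h (2 * s - 1)) ?P"
    using has_sum_cong[THEN iffD1, OF eq 1] .
  then have "((\<lambda>p. np p s * side_error h p s) has_sum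
      side_sum h s - powint 1 (sqrt 3) s / of_nat h * zeta_class h (2 * s - 1)) {1..}"
    by (rule has_sum_cong_neutral[THEN iffD1, rotated -1]) (auto simp: side_error_def)
  then have "(\<lambda>n. np (Suc n) s * side_error h (Suc n) s) sums
      (side_sum h s - powint 1 (sqrt 3) s / of_nat h * zeta_class h (2 * s - 1))"
    unfolding has_sum_nat_atLeast_1_iff by (rule has_sum_imp_sums)
  moreover have "(\<lambda>n. np (Suc n) s * side_error h (Suc n) s) sums side_rem h s"
    using assms by (intro side_rem_sums) auto
  ultimately show ?thesis using sums_unique2 by (fastforce simp: algebra_simps)
qed

section \<open>Continuation and bounds on the real axis\<close>

text \<open>\<open>even_reg\<close>, \<open>odd_reg\<close> and \<open>wr_reg\<close> continue \<open>(s - 1) * side_sum 1 s\<close>, \<open>(s - 1) * side_sum 2 s\<close>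
  and \<open>(s - 1)\<^sup>2 * Phi_square_wr s\<close>.\<close>

definition even_reg :: "complex \<Rightarrow> complex" where
  "even_reg s = powint 1 (sqrt 3) s * (zeta_reg (2 * s - 1) / 2) + (s - 1) * side_rem 1 s"

definition odd_reg :: "complex \<Rightarrow> complex" where
  "odd_reg s = powint 1 (sqrt 3) s / 2 * ((1 - 2 powr (- (2 * s - 1))) * (zeta_reg (2 * s - 1) / 2))
     + (s - 1) * side_rem 2 s"

definition wr_reg :: "complex \<Rightarrow> complex" where
  "wr_reg s = zeta_reg s * L_ext s * ((s - 1) + (2 * s - 1) / zeta_reg (2 * s) *
     (2 / 2 powr s * even_reg s + 2 / (1 + 2 powr (- s)) * odd_reg s))"

lemma zeta_reg_nonzero: "Re s > 1 \<Longrightarrow> zeta_reg s \<noteq> 0"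
  using zeta_reg_eq[of s] zeta_nonzero[of s] by auto

lemma side_regs:
  assumes "Re s > 1"
  shows "(s - 1) * side_sum 1 s = even_reg s" "(s - 1) * side_sum 2 s = odd_reg s"
proof -
  have z: "Re (2 * s - 1) > 1" using assms by simp
  \<comment> \<open>The halves arise because zeta(2 s - 1) has the regularizing factor (2 s - 1) - 1
    = 2 (s - 1).\<close>
  have zr: "zeta_reg (2 * s - 1) / 2 = (s - 1) * zeta (2 * s - 1)"
  proof -
    have "2 * s - 1 - 1 = 2 * (s - 1)" by simp
    then show ?thesis unfolding zeta_reg_eq[OF z] by (simp only:) simp
  qed
  show "(s - 1) * side_sum 1 s = even_reg s"
    using side_sum_eq[OF assms, of 1] zeta_class_1[OF z]
    unfolding even_reg_def zr by (simp add: algebra_simps)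
  show "(s - 1) * side_sum 2 s = odd_reg s"
  proof -
    have "(s - 1) * (p / 2 * (k * y) + r) = p / 2 * (k * ((s - 1) * y)) + (s - 1) * r" for p k y r :: complex
      by (simp add: distrib_left)
    moreover have "side_sum 2 s = powint 1 (sqrt 3) s / 2 * ((1 - 2 powr (- (2 * s - 1))) * zeta (2 * s - 1)) + side_rem 2 s"
      using side_sum_eq[OF assms, of 2] zeta_class_2[OF z] by (simp only: of_nat_numeral)
    ultimately show ?thesis unfolding odd_reg_def zr by (simp only:)
  qed
qed

lemma wr_reg_eq:
  assumes "Re s > 1"
  shows "wr_reg s / (s - 1)\<^sup>2 = Phi_square_wr s"
proof -
  have s1: "s - 1 \<noteq> 0" using assms by auto
  have z2: "Re (2 * s) > 1" using assms by simp
  have s2: "2 * s - 1 \<noteq> 0"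
  proof
    assume "2 * s - 1 = 0"
    then have "Re (2 * s - 1) = 0" by simp
    then show False using assms by simp
  qed
  define A where "A = 2 / 2 powr s * side_sum 1 s + 2 / (1 + 2 powr (- s)) * side_sum 2 s"
  have "wr_reg s = (s - 1) * zeta s * L_chi4 s * ((s - 1) + (1 / zeta (2 * s)) * ((s - 1) * A))"
  proof -
    have "2 / 2 powr s * even_reg s + 2 / (1 + 2 powr (- s)) * odd_reg s = (s - 1) * A"
      unfolding side_regs[OF assms, symmetric] A_def by (simp add: distrib_left mult.left_commute)
    moreover have "(2 * s - 1) / zeta_reg (2 * s) = 1 / zeta (2 * s)"
      unfolding zeta_reg_eq[OF z2] using s2 by simp
    ultimately show ?thesis
      unfolding wr_reg_def zeta_reg_eq[OF assms] L_ext_eq[OF assms] by simp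
  qed
  then have "wr_reg s / (s - 1)\<^sup>2 = zeta s * L_chi4 s * (1 + A / zeta (2 * s))"
    using s1 by (simp add: power2_eq_square divide_simps) (simp add: algebra_simps)
  also have "\<dots> = Phi_square s + Phi_square_pr s * A"
    by (simp add: Phi_square_def Phi_square_pr_def algebra_simps)
  also have "\<dots> = Phi_square_wr s"
    unfolding Phi_square_wr_decomposition(1)[OF assms] Phi_wr_even_eq[OF assms] Phi_wr_odd_eq[OF assms] A_def
    by (simp add: distrib_left mult.commute mult.left_commute)
  finally show ?thesis .
qed

text \<open>For Re s > 1/2 the denominator takes zeta at 2 s, inside its zero-free region, and 2 s -
  1 stays in the domain of \<open>zeta_reg\<close>.\<close>

lemma holomorphic_wr_reg: "wr_reg holomorphic_on {s. Re s > 1 / 2}"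
proof -
  have zr: "zeta_reg holomorphic_on {s. Re s > 1 / 2}"
    by (rule holomorphic_on_subset[OF holomorphic_zeta_reg]) auto
  have L: "L_ext holomorphic_on {s. Re s > 1 / 2}"
    by (rule holomorphic_on_subset[OF L_ext_holomorphic]) auto
  have z1: "(\<lambda>s. zeta_reg (2 * s - 1)) holomorphic_on {s. Re s > 1 / 2}"
    by (rule holomorphic_on_compose_gen[OF _ holomorphic_zeta_reg, unfolded o_def])
      (auto intro!: holomorphic_intros)
  have z2: "(\<lambda>s. zeta_reg (2 * s)) holomorphic_on {s. Re s > 1 / 2}"
    by (rule holomorphic_on_compose_gen[OF _ holomorphic_zeta_reg, unfolded o_def])
      (auto intro!: holomorphic_intros)
  have p: "powint 1 (sqrt 3) holomorphic_on {s. Re s > 1 / 2}" by (rule holomorphic_powint) auto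
  have r: "side_rem 1 holomorphic_on {s. Re s > 1 / 2}" "side_rem 2 holomorphic_on {s. Re s > 1 / 2}"
    by (rule side_rem_holomorphic, simp)+
  have nz: "zeta_reg (2 * s) \<noteq> 0" "1 + 2 powr (- s) \<noteq> 0"
    if "s \<in> {s. Re s > 1 / 2}" for s
    using that zeta_reg_nonzero[of "2 * s"] one_plus_two_powr_nonzero[of s] by auto
  show ?thesis
    unfolding wr_reg_def even_reg_def odd_reg_def
    by (intro holomorphic_on_mult holomorphic_on_add holomorphic_on_diff holomorphic_on_divide
        holomorphic_on_const holomorphic_on_ident holomorphic_on_minus holomorphic_on_powr_right zr L z1 z2 p r nz) auto
qed

text \<open>The paired terms are positive. This gives L(1) > 0, on which the exact order of the pole
  depends, without evaluating L(1).\<close>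

lemma L_ext_real_pos:
  assumes "s > 0"
  obtains r where "L_ext (of_real s) = of_real r" "r > 0"
proof -
  define f where "f = (\<lambda>n. real (4 * n + 1) powr - s - real (4 * n + 3) powr - s)"
  have "np (4 * n + 1) (of_real s) - np (4 * n + 3) (of_real s) = of_real (f n)" for n
    unfolding np_def f_def by (simp add: powr_of_real[symmetric] del: powr_of_real)
  then have "(\<lambda>n. complex_of_real (f n)) sums L_ext (of_real s)"
    using L_ext_sums[of "of_real s"] assms by simp
  moreover from this have sm: "summable f" using summable_of_real_iff[of f] sums_summable by blast
  ultimately have "L_ext (of_real s) = of_real (suminf f)"
    using sums_of_real[OF summable_sums[OF sm]] sums_unique2 by blast
  moreover have "f n > 0" for n using assms by (auto simp: f_def intro!: powr_less_mono2_neg)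
  then have "suminf f > 0" using suminf_pos[OF sm] by blast
  ultimately show ?thesis using that by blast
qed

lemma wr_reg_1_nonzero: "wr_reg 1 \<noteq> 0"
proof -
  obtain r where r: "L_ext 1 = of_real r" "r > 0" using L_ext_real_pos[of 1] by auto
  have z2: "zeta_reg 2 \<noteq> 0" using zeta_reg_nonzero[of 2] by simp
  have pw: "powint 1 (sqrt 3) 1 = of_real (ln (sqrt 3))" by (simp add: powint_def)
  have p2: "(2::complex) powr (- 1) = 1 / 2" by (simp add: powr_minus)
  have z1: "zeta_reg 1 = 1" by (simp add: zeta_reg_def)
  have ev: "even_reg 1 = of_real (ln (sqrt 3)) / 2" by (simp add: even_reg_def pw z1)
  have od: "odd_reg 1 = of_real (ln (sqrt 3)) / 8" by (simp add: odd_reg_def pw z1 p2)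
  \<comment> \<open>The constant is 1 * 1/2 + 4/3 * 1/8 = 2/3, from the weights 2/2^s and 2/(1 +
    2^(-s)) at s = 1.\<close>
  have "wr_reg 1 = of_real (r * (ln (sqrt 3) * (2 / 3))) / zeta_reg 2"
    by (simp add: wr_reg_def z1 p2 r(1) ev od) (simp add: mult.commute)
  moreover have "r * (ln (sqrt 3) * (2 / 3)) \<noteq> 0" using r(2) by simp
  ultimately show ?thesis using z2 by (simp del: of_real_mult)
qed

theorem Phi_square_wr_continuation:
  defines "F \<equiv> \<lambda>s. wr_reg s / (s - 1)\<^sup>2"
  shows "F meromorphic_on {s. Re s > 1 / 2}" "\<And>s. Re s > 1 \<Longrightarrow> F s = Phi_square_wr s"
    and "is_pole F 1" "zorder F 1 = - 2" "\<And>s. Re s \<ge> 1 \<Longrightarrow> s \<noteq> 1 \<Longrightarrow> \<not> is_pole F s"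
proof -
  have op: "open {s. Re s > 1 / 2}" by (rule open_halfspace_Re_gt)
  have "wr_reg analytic_on {s. Re s > 1 / 2}" using holomorphic_wr_reg op analytic_on_open by blast
  then show "F meromorphic_on {s. Re s > 1 / 2}"
    unfolding F_def by (intro meromorphic_intros analytic_on_imp_meromorphic_on) auto
  show "F s = Phi_square_wr s" if "Re s > 1" for s unfolding F_def by (rule wr_reg_eq[OF that])
  have "isCont wr_reg 1"
    using holomorphic_on_imp_continuous_on[OF holomorphic_wr_reg] op
    by (subst (asm) continuous_on_eq_continuous_at) auto
  moreover have "filterlim (\<lambda>s. (s - 1)\<^sup>2) (at 0) (at (1::complex))"
    unfolding filterlim_at by (auto intro!: tendsto_eq_intros simp: eventually_at_filter)
  ultimately show "is_pole F 1" unfolding F_def using wr_reg_1_nonzero by (rule is_pole_divide)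
  show "zorder F 1 = - 2"
  proof (rule zorder_eqI[OF op _ holomorphic_wr_reg wr_reg_1_nonzero])
    fix w :: complex
    show "F w = wr_reg w * (w - 1) powi - 2"
      by (simp add: F_def power_int_minus divide_inverse)
  qed auto
  show "\<not> is_pole F s" if "Re s \<ge> 1" "s \<noteq> 1" for s
  proof (rule not_is_pole_holomorphic)
    show "open ({s. Re s > 1 / 2} - {1})" using op by (intro open_Diff) auto
    show "F holomorphic_on {s. Re s > 1 / 2} - {1}"
      unfolding F_def using holomorphic_on_subset[OF holomorphic_wr_reg]
      by (intro holomorphic_intros) auto
  qed (use that in auto)
qed

section \<open>Upper and lower Riemann sums for real s\<close>

definition rpowint :: "real \<Rightarrow> real \<Rightarrow> real \<Rightarrow> real" where
  "rpowint a b s = (a powr (1 - s) - b powr (1 - s)) / (s - 1)"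

lemma rpowint_add: "rpowint a b s + rpowint b c s = rpowint a c s"
  by (simp add: rpowint_def flip: add_divide_distrib)

lemma rpowint_scale:
  assumes "0 < p" "0 < b"
  shows "rpowint p (b * p) s = p powr (1 - s) * rpowint 1 b s"
  using assms by (simp add: rpowint_def powr_mult algebra_simps)

text \<open>The mean value theorem gives an interior point, hence the strict inequalities on which
  those of the final bounds rest.\<close>

lemma rpowint_bounds:
  assumes "0 < a" "a < b" "s > 1"
  shows "(b - a) * b powr - s < rpowint a b s" "rpowint a b s < (b - a) * a powr - s"
proof -
  define f where "f = (\<lambda>t. - (t powr (1 - s)) / (s - 1))"
  have "\<exists>z>a. z < b \<and> f b - f a = (b - a) * z powr - s"
  proof (rule MVT2[OF assms(2)])
    fix x assume "a \<le> x" "x \<le> b"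
    then have "(f has_real_derivative (- ((1 - s) * x powr (1 - s - 1))) / (s - 1)) (at x)"
      unfolding f_def using assms by (intro DERIV_cdivide DERIV_minus has_real_derivative_powr) auto
    moreover have "(- ((1 - s) * A)) / (s - 1) = A" for A using assms by (simp add: field_simps)
    ultimately show "(f has_real_derivative x powr - s) (at x)" by simp
  qed
  then obtain z where z: "a < z" "z < b" "rpowint a b s = (b - a) * z powr - s"
    by (auto simp: f_def rpowint_def diff_divide_distrib)
  then show "(b - a) * b powr - s < rpowint a b s" "rpowint a b s < (b - a) * a powr - s"
    using assms by (auto intro!: mult_strict_left_mono powr_less_mono2_neg)
qed

lemma rpowint_progression:
  assumes "0 < p" "0 < h" "s > 1"
  shows "real h * (\<Sum>j<N. real (p + h * Suc j) powr - s) \<le> rpowint (real p) (real (p + h * N)) s"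
    and "rpowint (real p) (real (p + h * N)) s \<le> real h * (\<Sum>j<N. real (p + h * j) powr - s)"
proof (induction N)
  case (Suc N)
  have lt: "0 < real (p + h * N)" "real (p + h * N) < real (p + h * Suc N)"
    using assms by (auto intro: add_pos_nonneg)
  have d: "real (p + h * Suc N) - real (p + h * N) = real h" by (simp add: algebra_simps)
  note b = rpowint_bounds[OF lt assms(3), unfolded d]
  note a = rpowint_add[of "real p" "real (p + h * N)" s "real (p + h * Suc N)", symmetric]
  { case 1
    show ?case unfolding a using Suc.IH(1) b(1) by (simp only: sum.lessThan_Suc distrib_left) }
  { case 2
    show ?case unfolding a using Suc.IH(2) b(2) by (simp only: sum.lessThan_Suc distrib_left) }
qed (simp_all add: rpowint_def)

text \<open>The admissible q are right endpoints, so the sum falls short of the integral; adding the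
  left endpoint q = p makes it too large, the interval cut off at sqrt 3 p being covered by a full
  step.\<close>

lemma side_inner_bounds:
  assumes "0 < p" "p mod h = 1 mod h" "0 < h" "s > 1"
  defines "S \<equiv> \<Sum>q | (p, q) \<in> side_pairs h. real q powr - s"
  shows "real h * S < rpowint (real p) (sqrt 3 * real p) s"
    and "rpowint (real p) (sqrt 3 * real p) s < real h * (real p powr - s + S)"
proof -
  obtain N where N: "{q. (p, q) \<in> side_pairs h} = (\<lambda>j. p + h * Suc j) ` {..<N}"
    "real (p + h * N) < sqrt 3 * real p" "sqrt 3 * real p \<le> real (p + h * Suc N)"
    using side_progression[OF assms(1-3)] .
  have inj: "inj_on (\<lambda>j. p + h * Suc j) {..<N}" using assms(3) by (auto simp: inj_on_def)
  have S: "S = (\<Sum>j<N. real (p + h * Suc j) powr - s)"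
    unfolding S_def N(1) by (simp only: sum.reindex[OF inj] o_def)
  have pN: "0 < real (p + h * N)" using assms(1) by (auto intro: add_pos_nonneg)
  have "0 < (sqrt 3 * real p - real (p + h * N)) * (sqrt 3 * real p) powr - s"
    using N(2) assms(1) by (intro mult_pos_pos) auto
  then have "rpowint (real (p + h * N)) (sqrt 3 * real p) s > 0"
    using rpowint_bounds(1)[OF pN N(2) assms(4)] by linarith
  then show "real h * S < rpowint (real p) (sqrt 3 * real p) s"
    using rpowint_progression(1)[OF assms(1,3,4), of N]
      rpowint_add[of "real p" "real (p + h * N)" s "sqrt 3 * real p"] by (simp add: S)
  have "rpowint (real (p + h * N)) (sqrt 3 * real p) s
      < (sqrt 3 * real p - real (p + h * N)) * real (p + h * N) powr - s"
    using rpowint_bounds(2)[OF pN N(2) assms(4)] .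
  also have "\<dots> \<le> real h * real (p + h * N) powr - s"
    using N(3) by (intro mult_right_mono) (auto simp: algebra_simps)
  finally have "rpowint (real p) (sqrt 3 * real p) s < real h * (\<Sum>j<Suc N. real (p + h * j) powr - s)"
    using rpowint_progression(2)[OF assms(1,3,4), of N]
      rpowint_add[of "real p" "real (p + h * N)" s "sqrt 3 * real p"]
    by (simp add: distrib_left)
  also have "(\<Sum>j<Suc N. real (p + h * j) powr - s) = real p powr - s + S"
    unfolding S by (subst sum.lessThan_Suc_shift) simp
  finally show "rpowint (real p) (sqrt 3 * real p) s < real h * (real p powr - s + S)" .
qed

lemma has_sum_of_real_complex:
  assumes "((\<lambda>x. complex_of_real (f x)) has_sum S) A"
  shows "(f has_sum Re S) A" "S = of_real (Re S)"
proof -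
  show r: "(f has_sum Re S) A" using has_sum_Re[OF assms] by simp
  then show "S = of_real (Re S)" using has_sum_of_real[OF r] assms has_sum_unique by blast
qed

lemma np_of_real: "np n (of_real s) = of_real (real n powr - s)"
  by (simp add: np_def powr_of_real[symmetric] del: powr_of_real)

lemma has_sum_zeta_class_real:
  assumes "s > 1"
  shows "((\<lambda>p. real p powr - s) has_sum Re (zeta_class h (of_real s))) {p. 0 < p \<and> p mod h = 1 mod h}"
    and "zeta_class h (of_real s) = of_real (Re (zeta_class h (of_real s)))"
proof -
  have H: "((\<lambda>p. complex_of_real (real p powr - s)) has_sum zeta_class h (of_real s)) {p. 0 < p \<and> p mod h = 1 mod h}"
    using has_sum_zeta_class[of "of_real s" h] assms by (simp add: np_of_real)
  show "((\<lambda>p. real p powr - s) has_sum Re (zeta_class h (of_real s))) {p. 0 < p \<and> p mod h = 1 mod h}"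
    "zeta_class h (of_real s) = of_real (Re (zeta_class h (of_real s)))"
    by (rule has_sum_of_real_complex[OF H])+
qed

text \<open>Multiplied by p^(-s), the added endpoint q = p becomes p^(-2 s); its sum is the zeta
  value at 2 s in the upper estimate.\<close>

lemma side_sum_real_bounds:
  assumes "s > 1" "0 < h"
  shows "side_sum h (of_real s) = of_real (Re (side_sum h (of_real s)))"
    and "Re (side_sum h (of_real s)) < rpowint 1 (sqrt 3) s / real h * Re (zeta_class h (of_real (2 * s - 1)))"
    and "rpowint 1 (sqrt 3) s / real h * Re (zeta_class h (of_real (2 * s - 1)))
      < Re (zeta_class h (of_real (2 * s))) + Re (side_sum h (of_real s))"
proof -
  let ?P = "{p::nat. 0 < p \<and> p mod h = 1 mod h}"
  define S where "S = (\<lambda>p. \<Sum>q | (p, q) \<in> side_pairs h. real q powr - s)"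
  have "((\<lambda>p. complex_of_real (real p powr - s * S p)) has_sum side_sum h (of_real s)) ?P"
    using has_sum_side_iterated[of "of_real s" h] assms(1) by (simp add: np_of_real S_def)
  note R = has_sum_of_real_complex[OF this]
  show "side_sum h (of_real s) = of_real (Re (side_sum h (of_real s)))" by (rule R(2))
  have J: "rpowint (real p) (sqrt 3 * real p) s * real p powr - s = rpowint 1 (sqrt 3) s * real p powr - (2 * s - 1)"
    if "p \<in> ?P" for p
  proof -
    have "real p powr (1 - s) * real p powr - s = real p powr - (2 * s - 1)"
      by (simp flip: powr_add)
    then show ?thesis using rpowint_scale[of "real p" "sqrt 3" s] that by (simp add: mult_ac)
  qed
  have Z1: "((\<lambda>p. rpowint 1 (sqrt 3) s / real h * real p powr - (2 * s - 1)) has_sum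
      rpowint 1 (sqrt 3) s / real h * Re (zeta_class h (of_real (2 * s - 1)))) ?P"
    using assms(1) by (intro has_sum_cmult_right has_sum_zeta_class_real) simp
  have Z2: "((\<lambda>p. real p powr - (2 * s) + real p powr - s * S p) has_sum
      Re (zeta_class h (of_real (2 * s))) + Re (side_sum h (of_real s))) ?P"
    using assms(1) by (intro has_sum_add R(1) has_sum_zeta_class_real) simp
  have lt: "real p powr - s * S p < rpowint 1 (sqrt 3) s / real h * real p powr - (2 * s - 1)"
    "rpowint 1 (sqrt 3) s / real h * real p powr - (2 * s - 1) < real p powr - (2 * s) + real p powr - s * S p"
    if p: "p \<in> ?P" for p
  proof -
    have p0: "real p powr - s > 0" using p by simp
    have pp: "p > 0" "p mod h = 1 mod h" using p by auto
    note b = side_inner_bounds[OF pp assms(2,1)]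
    have b': "S p < rpowint (real p) (sqrt 3 * real p) s / real h"
      "rpowint (real p) (sqrt 3 * real p) s / real h < real p powr - s + S p"
      using b assms(2) by (simp_all add: S_def field_simps)
    have e: "rpowint 1 (sqrt 3) s / real h * real p powr - (2 * s - 1)
        = real p powr - s * (rpowint (real p) (sqrt 3 * real p) s / real h)"
      using J[OF p] by (simp add: mult.commute)
    have sq: "real p powr - (2 * s) = real p powr - s * real p powr - s" by (simp flip: powr_add)
    show "real p powr - s * S p < rpowint 1 (sqrt 3) s / real h * real p powr - (2 * s - 1)"
      unfolding e using b'(1) p0 by (intro mult_strict_left_mono)
    show "rpowint 1 (sqrt 3) s / real h * real p powr - (2 * s - 1) < real p powr - (2 * s) + real p powr - s * S p"
      unfolding e sq distrib_left[symmetric] using b'(2) p0 by (intro mult_strict_left_mono)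
  qed
  \<comment> \<open>One strict term is enough for strictness of the sums, and p = 1 belongs to both
    residue classes.\<close>
  have one: "1 \<in> ?P" by simp
  show "Re (side_sum h (of_real s)) < rpowint 1 (sqrt 3) s / real h * Re (zeta_class h (of_real (2 * s - 1)))"
    by (rule has_sum_strict_mono[OF R(1) Z1 less_imp_le[OF lt(1)] one lt(1)[OF one]])
  show "rpowint 1 (sqrt 3) s / real h * Re (zeta_class h (of_real (2 * s - 1)))
      < Re (zeta_class h (of_real (2 * s))) + Re (side_sum h (of_real s))"
    by (rule has_sum_strict_mono[OF Z1 Z2 less_imp_le[OF lt(2)] one lt(2)[OF one]])
qed

lemma dirichlet_series_of_real:
  assumes "summable (\<lambda>n. norm (of_real (a (Suc n)) * of_nat (Suc n) powr - (of_real s :: complex)))"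
  shows "dirichlet_series (\<lambda>n. of_real (a n)) (of_real s :: complex) = of_real (dirichlet_series a s)"
    and "summable (\<lambda>n. a (Suc n) * real (Suc n) powr - s)"
proof -
  have e: "of_real (a (Suc n)) * of_nat (Suc n) powr - (of_real s :: complex)
      = of_real (a (Suc n) * real (Suc n) powr - s)" for n
    using np_of_real[of "Suc n" s] by (simp add: np_def)
  show sm: "summable (\<lambda>n. a (Suc n) * real (Suc n) powr - s)"
    using summable_norm_cancel[OF assms] unfolding e by (simp only: summable_of_real_iff)
  show "dirichlet_series (\<lambda>n. of_real (a n)) (of_real s :: complex) = of_real (dirichlet_series a s)"
    unfolding dirichlet_series_def e by (rule suminf_of_real[OF sm, symmetric])
qed

text \<open>The polymorphic definitions give separate real and complex series; these are matched so
  that the complex results can be used for real s.\<close>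

lemma real_dirichlet_values:
  assumes "s > 1"
  shows "zeta (of_real s :: complex) = of_real (zeta s)" "zeta s > 0"
    and "L_chi4 (of_real s :: complex) = of_real (L_chi4 s)" "L_chi4 s > 0"
    and "Phi_square_wr (of_real s :: complex) = of_real (Phi_square_wr s)"
proof -
  have s: "Re (of_real s) > 1" using assms by simp
  have chi: "chi4 n = complex_of_real (chi4 n)" for n by (simp add: chi4_def)
  note Z = dirichlet_series_of_real[of "\<lambda>_. 1" s]
    dirichlet_series_eqI(2)[of "\<lambda>_. 1" "of_real s" "zeta (of_real s)"] has_sum_zeta[OF s]
  show "zeta (of_real s :: complex) = of_real (zeta s)" using Z by (simp add: zeta_def)
  have "summable (\<lambda>n. 1 * real (Suc n) powr - s)" using Z by simp
  then show "zeta s > 0"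
    unfolding zeta_def dirichlet_series_def by (rule suminf_pos) simp
  have "summable (\<lambda>n. norm (chi4 (Suc n) * of_nat (Suc n) powr - (complex_of_real s)))"
    by (rule dirichlet_series_eqI(2)[OF has_sum_L_chi4[OF s]])
  then have "summable (\<lambda>n. norm (of_real (chi4 (Suc n)) * of_nat (Suc n) powr - (complex_of_real s)))"
    by (simp only: chi[symmetric])
  from dirichlet_series_of_real(1)[OF this]
  show L: "L_chi4 (of_real s :: complex) = of_real (L_chi4 s)" by (simp add: L_chi4_def flip: chi)
  obtain r where "L_ext (of_real s) = of_real r" "r > 0" using L_ext_real_pos[of s] assms by auto
  then show "L_chi4 s > 0" using L_ext_eq[OF s] L by simp
  show "Phi_square_wr (of_real s :: complex) = of_real (Phi_square_wr s)"
    using dirichlet_series_of_real(1)[of "\<lambda>n. real (a_square n)" s] Phi_square_wr_decomposition(2)[OF s]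
    by (simp add: Phi_square_wr_def)
qed

theorem Phi_square_wr_bounds:
  assumes "s > 1"
  shows "D_square s - Phi_square s < Phi_square_wr s" "Phi_square_wr s < D_square s + Phi_square s"
proof -
  have s: "Re (complex_of_real s) > 1" "Re (complex_of_real (2 * s)) > 1" "Re (complex_of_real (2 * s - 1)) > 1"
    using assms by auto
  define x where "x = 2 powr - s"
  define P where "P = zeta s * L_chi4 s / zeta (2 * s)"
  define J where "J = rpowint 1 (sqrt 3) s"
  define w where "w = zeta (2 * s - 1)"
  define z2 where "z2 = zeta (2 * s)"
  define \<sigma>1 where "\<sigma>1 = Re (side_sum 1 (of_real s))"
  define \<sigma>2 where "\<sigma>2 = Re (side_sum 2 (of_real s))"
  have x: "x > 0" by (simp add: x_def)
  have z2: "z2 > 0" using real_dirichlet_values(2)[of "2 * s"] assms by (simp add: z2_def)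
  have P: "P > 0" using real_dirichlet_values(2,4)[OF assms] z2 by (simp add: P_def z2_def)
  have tp: "(2::complex) powr (of_real t) = of_real (2 powr t)" for t
    using powr_of_real[of 2 t] by simp
  have zc: "Re (zeta_class 1 (of_real (2 * s - 1))) = w" "Re (zeta_class 1 (of_real (2 * s))) = z2"
    using zeta_class_1[OF s(2)] zeta_class_1[OF s(3)] real_dirichlet_values(1)[of "2 * s"]
      real_dirichlet_values(1)[of "2 * s - 1"] assms
    by (simp_all add: w_def z2_def)
  have zc2: "Re (zeta_class 2 (of_real t)) = (1 - 2 powr - t) * zeta t" if "t > 1" for t
  proof -
    have "(2::complex) powr (- of_real t) = of_real (2 powr - t)" using tp[of "- t"] by simp
    then have "zeta_class 2 (of_real t) = of_real ((1 - 2 powr - t) * zeta t)"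
      using zeta_class_2[of "of_real t"] that by (simp add: real_dirichlet_values(1)[OF that])
    then show ?thesis by (simp only: Re_complex_of_real)
  qed
  have x2: "2 powr - (2 * s) = x\<^sup>2" "2 powr - (2 * s - 1) = 2 * x\<^sup>2"
    by (simp_all add: x_def power2_eq_square powr_add[symmetric] powr_diff)
      (simp_all add: powr_minus field_simps powr_add[symmetric])
  have zc2': "Re (zeta_class 2 (of_real (2 * s - 1))) = (1 - 2 * x\<^sup>2) * w"
    "Re (zeta_class 2 (of_real (2 * s))) = (1 - x\<^sup>2) * z2"
    using zc2[of "2 * s - 1"] zc2[of "2 * s"] assms unfolding x2 by (simp_all add: w_def z2_def)
  note B1 = side_sum_real_bounds[OF assms, of 1, folded J_def \<sigma>1_def, unfolded zc]
  note B2 = side_sum_real_bounds[OF assms, of 2, folded J_def \<sigma>2_def, unfolded zc2']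
  have "complex_of_real (Phi_square_wr s)
      = of_real (zeta s * L_chi4 s + (2 * x * \<sigma>1 + 2 / (1 + x) * \<sigma>2) * P)"
  proof -
    have "Phi_square (of_real s :: complex) = of_real (zeta s * L_chi4 s)"
      using real_dirichlet_values[OF assms] by (simp add: Phi_square_def)
    moreover have "Phi_square_pr (of_real s) = of_real P"
      using real_dirichlet_values[OF assms] real_dirichlet_values(1)[of "2 * s"] assms
      by (simp add: Phi_square_pr_def P_def)
    moreover have "2 / 2 powr (of_real s) = complex_of_real (2 * x)"
      unfolding tp x_def by (simp add: powr_minus divide_inverse)
    moreover have "2 / (1 + 2 powr - of_real s) = complex_of_real (2 / (1 + x))"
      using tp[of "- s"] by (simp add: x_def)
    ultimately show ?thesis
      using Phi_square_wr_decomposition(1)[OF s(1)] Phi_wr_even_eq[OF s(1)] Phi_wr_odd_eq[OF s(1)]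
        B1(1) B2(1) real_dirichlet_values(5)[OF assms] by (simp add: algebra_simps)
  qed
  then have wr: "Phi_square_wr s = Phi_square s + (2 * x * \<sigma>1 + 2 / (1 + x) * \<sigma>2) * P"
    unfolding of_real_eq_iff Phi_square_def .
  \<comment> \<open>With x = 2^(-s) the weights combine as 2 x + (1 - 2 x^2)/(1 + x) = (1 + 2 x)/(1
    + x), which is the first factor of \<open>D_square\<close>.\<close>
  have D: "D_square s = (2 * x * (J * w) + 2 / (1 + x) * (J / 2 * ((1 - 2 * x\<^sup>2) * w))) * P"
  proof -
    have "(2 + 2 powr s) / (1 + 2 powr s) = (1 + 2 * x) / (1 + x)"
    proof -
      define t where "t = (2::real) powr s"
      have t: "t > 0" by (simp add: t_def)
      then have "1 + 2 * x = (2 + t) / t" "1 + x = (1 + t) / t"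
        by (simp_all add: x_def powr_minus t_def[symmetric] field_simps)
      then show ?thesis using t by (simp add: t_def[symmetric])
    qed
    moreover have "2 * x * (J * w) + 2 / (1 + x) * (J / 2 * ((1 - 2 * x\<^sup>2) * w)) = (1 + 2 * x) / (1 + x) * (J * w)"
      using x by (simp add: field_simps power2_eq_square)
    ultimately show ?thesis
      by (simp add: D_square_def P_def J_def rpowint_def w_def)
  qed
  have c: "2 * x > 0" "2 / (1 + x) > 0" using x by auto
  have "2 * x * \<sigma>1 < 2 * x * (J * w)" using B1(2) c(1) by (intro mult_strict_left_mono) auto
  moreover have "2 / (1 + x) * \<sigma>2 < 2 / (1 + x) * (J / 2 * ((1 - 2 * x\<^sup>2) * w))"
    using B2(2) c(2) by (intro mult_strict_left_mono) auto
  ultimately have "(2 * x * \<sigma>1 + 2 / (1 + x) * \<sigma>2) * P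
      < (2 * x * (J * w) + 2 / (1 + x) * (J / 2 * ((1 - 2 * x\<^sup>2) * w))) * P"
    using P by (intro mult_strict_right_mono) auto
  then show "Phi_square_wr s < D_square s + Phi_square s" unfolding wr D by simp
  have "2 * x * (J * w) < 2 * x * (z2 + \<sigma>1)" using B1(3) c(1)
    by (intro mult_strict_left_mono) auto
  moreover have "2 / (1 + x) * (J / 2 * ((1 - 2 * x\<^sup>2) * w)) < 2 / (1 + x) * ((1 - x\<^sup>2) * z2 + \<sigma>2)"
    using B2(3) c(2) by (intro mult_strict_left_mono) auto
  \<comment> \<open>The defects 2 x z2 and 2 (1 - x) z2 add up to 2 z2. Multiplied by P this is
    twice \<open>Phi_square\<close>, one half of which is absorbed by the summand
    \<open>Phi_square\<close> of the generating function.\<close>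
  moreover have "2 / (1 + x) * ((1 - x\<^sup>2) * z2 + \<sigma>2) = 2 * (1 - x) * z2 + 2 / (1 + x) * \<sigma>2"
    using x by (simp add: field_simps power2_eq_square)
  ultimately have "(2 * x * (J * w) + 2 / (1 + x) * (J / 2 * ((1 - 2 * x\<^sup>2) * w))) * P
      < (2 * z2 + (2 * x * \<sigma>1 + 2 / (1 + x) * \<sigma>2)) * P"
    using P by (intro mult_strict_right_mono) (auto simp: algebra_simps)
  moreover have "z2 * P = Phi_square s" using z2 by (simp add: P_def z2_def Phi_square_def)
  ultimately show "D_square s - Phi_square s < Phi_square_wr s"
    unfolding wr D by (simp add: distrib_right mult.assoc)
qed

section \<open>Asymptotics of the summatory function\<close>

definition cnt :: "'a set \<Rightarrow> ('a \<Rightarrow> nat) \<Rightarrow> real \<Rightarrow> real" where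
  "cnt X w x = real (card {a \<in> X. real (w a) \<le> x})"

section \<open>Density of the Gaussian integers\<close>

lemma card_multiples:
  assumes "0 < d"
  shows "card {n \<in> {1..N}. d dvd n} = N div d"
proof -
  have "{n \<in> {1..N}. d dvd n} = (*) d ` {1..N div d}"
  proof (intro subset_antisym subsetI)
    fix n assume "n \<in> {n \<in> {1..N}. d dvd n}"
    then obtain k where k: "n = d * k" "1 \<le> n" "n \<le> N" by auto
    have "k = n div d" using k assms by simp
    then have "k \<le> N div d" using k div_le_mono by blast
    moreover have "1 \<le> k" using k by (cases k) auto
    ultimately show "n \<in> (*) d ` {1..N div d}" using k by auto
  next
    fix n assume "n \<in> (*) d ` {1..N div d}"
    then obtain k where "k \<in> {1..N div d}" and k: "n = d * k" by blast
    then have k': "1 \<le> k" "k \<le> N div d" by auto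
    have "d * k \<le> d * (N div d)" using k' by (intro mult_le_mono2)
    also have "\<dots> \<le> N" by simp
    finally show "n \<in> {n \<in> {1..N}. d dvd n}" using k k' assms by auto
  qed
  then show ?thesis using assms by (simp add: card_image inj_on_def)
qed

lemma sum_chi_sum:
  "(\<Sum>n=1..N. chi_sum n) = (\<Sum>k<N. (- 1) ^ k * int (N div (2 * k + 1)))"
proof -
  have "(\<Sum>n=1..N. chi_sum n) = (\<Sum>n=1..N. \<Sum>d\<in>{d \<in> {1..N}. d dvd n}. chi4 d)"
    unfolding chi_sum_def
    by (intro sum.cong refl) (auto dest: dvd_imp_le intro!: Suc_leI Nat.gr0I)
  also have "\<dots> = (\<Sum>d=1..N. \<Sum>n\<in>{n \<in> {1..N}. d dvd n}. chi4 d)"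
    by (rule sum.swap_restrict) auto
  also have "\<dots> = (\<Sum>d=1..N. chi4 d * int (N div d))"
    using card_multiples by (intro sum.cong) (auto simp: mult.commute)
  \<comment> \<open>The quotient is 0 for d > N; an even upper limit lets the induction take one odd
    and one even d at a time.\<close>
  also have "\<dots> = (\<Sum>d=1..2 * N. chi4 d * int (N div d))"
    by (intro sum.mono_neutral_left) auto
  also have "\<dots> = (\<Sum>k<N. (- 1) ^ k * int (N div (2 * k + 1)))"
  proof -
    have "(\<Sum>d=1..2 * M. chi4 d * f d) = (\<Sum>k<M. (- 1) ^ k * f (2 * k + 1) :: int)" for M f
    proof (induction M)
      case (Suc M)
      have "chi4 (2 * M + 1) = ((- 1) ^ M :: int)"
      proof (cases "even M")
        case True
        then show ?thesis unfolding chi4_eq by (auto elim!: evenE)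
      next
        case False
        then obtain j where "M = 2 * j + 1" by (auto elim!: oddE)
        then have "(2 * M + 1) mod 4 = 3" by presburger
        then show ?thesis using False by (simp add: chi4_eq)
      qed
      moreover have "chi4 (Suc (2 * M + 1)) = (0::int)" by (simp add: chi4_def)
      ultimately show ?case using Suc by simp
    qed simp
    then show ?thesis .
  qed
  finally show ?thesis .
qed

text \<open>Leibniz: removing the first term leaves the negative of an alternating sum of the same
  kind.\<close>

lemma alternating_sum_bounds:
  fixes b :: "nat \<Rightarrow> real"
  assumes "\<And>k. b (Suc k) \<le> b k" "\<And>k. 0 \<le> b k"
  shows "0 \<le> (\<Sum>j<n. (- 1) ^ j * b (K + j)) \<and> (\<Sum>j<n. (- 1) ^ j * b (K + j)) \<le> b K"
proof (induction n arbitrary: K)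
  case (Suc n)
  have "(\<Sum>j<Suc n. (- 1) ^ j * b (K + j)) = b K - (\<Sum>j<n. (- 1) ^ j * b (Suc K + j))"
    by (subst sum.lessThan_Suc_shift) (simp add: sum_negf)
  then show ?case using Suc[of "Suc K"] assms(1)[of K] by simp
qed (use assms in simp)

text \<open>Replacing every floor by its argument would cost an error of order N. Only the first K
  floors are replaced, at cost 1 each; the rest is an alternating sum of decreasing terms, bounded
  by its first term N/(2 K + 1).\<close>

lemma sum_repr2_limit: "(\<lambda>N. real (\<Sum>n=1..N. repr2 n) / real N) \<longlonglongrightarrow> pi"
proof -
  have eq: "real (\<Sum>n=1..N. repr2 n) = 4 * (\<Sum>k<N. (- 1) ^ k * real (N div (2 * k + 1)))" for N
  proof -
    have "int (\<Sum>n=1..N. repr2 n) = 4 * (\<Sum>n=1..N. chi_sum n)"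
      by (simp add: sum_distrib_left repr2_eq_chi_sum)
    then have "real_of_int (int (\<Sum>n=1..N. repr2 n)) = 4 * of_int (\<Sum>n=1..N. chi_sum n)"
      by simp
    then show ?thesis unfolding sum_chi_sum by simp
  qed
  define e where "e = (\<lambda>K. (\<Sum>k<K. (- 1) ^ k / real (2 * k + 1)))"
  have "summable (\<lambda>k. (- 1) ^ k * 1 / real (k * 2 + 1))"
    using summable_arctan_series[of 1] by simp
  then have "(\<lambda>k. (- 1) ^ k * 1 / real (k * 2 + 1)) sums (pi / 4)"
    unfolding pi_series by (rule summable_sums)
  then have e: "e \<longlonglongrightarrow> pi / 4" by (simp add: sums_def e_def mult.commute)
  have bound: "\<bar>(\<Sum>k<N. (- 1) ^ k * real (N div (2 * k + 1))) - real N * e K\<bar> \<le> real K + real N / real (2 * K + 1)"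
    if "K \<le> N" for K N
  proof -
    define b where "b = (\<lambda>k. real (N div (2 * k + 1)))"
    have "N div (2 * Suc k + 1) \<le> N div (2 * k + 1)" for k by (intro div_le_mono2) auto
    then have ab: "0 \<le> (\<Sum>j<N - K. (- 1) ^ j * b (K + j)) \<and> (\<Sum>j<N - K. (- 1) ^ j * b (K + j)) \<le> b K"
      by (intro alternating_sum_bounds) (auto simp: b_def)
    have "(\<Sum>k<N. (- 1) ^ k * b k) = (\<Sum>k<K. (- 1) ^ k * b k) + (\<Sum>k=K..<N. (- 1) ^ k * b k)"
      using that by (simp add: sum.atLeastLessThan_concat flip: atLeast0LessThan)
    also have "(\<Sum>k=K..<N. (- 1) ^ k * b k) = (- 1) ^ K * (\<Sum>j<N - K. (- 1) ^ j * b (K + j))"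
      using that sum.shift_bounds_nat_ivl[of "\<lambda>k. (- 1) ^ k * b k" 0 K "N - K"]
      by (simp add: atLeast0LessThan power_add sum_distrib_left mult_ac add.commute)
    finally have "(\<Sum>k<N. (- 1) ^ k * b k) - real N * e K
        = (\<Sum>k<K. (- 1) ^ k * (b k - real N / real (2 * k + 1))) + (- 1) ^ K * (\<Sum>j<N - K. (- 1) ^ j * b (K + j))"
      by (simp add: e_def sum_distrib_left sum_subtractf right_diff_distrib mult_ac)
    moreover have "\<bar>\<Sum>k<K. (- 1) ^ k * (b k - real N / real (2 * k + 1))\<bar> \<le> real K"
    proof -
      have "\<bar>b k - real N / real (2 * k + 1)\<bar> \<le> 1" for k
      proof -
        have "b k = of_int \<lfloor>real N / real (2 * k + 1)\<rfloor>"
          unfolding b_def floor_divide_of_nat_eq by simp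
        then show ?thesis by linarith
      qed
      then have "(\<Sum>k<K. \<bar>(- 1) ^ k * (b k - real N / real (2 * k + 1))\<bar>) \<le> (\<Sum>k<K. 1)"
        by (intro sum_mono) (simp add: abs_mult)
      then show ?thesis by (intro order_trans[OF sum_abs]) simp
    qed
    moreover have "\<bar>(- 1) ^ K * (\<Sum>j<N - K. (- 1) ^ j * b (K + j))\<bar> \<le> real N / real (2 * K + 1)"
    proof -
      have "b K \<le> real N / real (2 * K + 1)" unfolding b_def by (rule of_nat_div_le_of_nat)
      then show ?thesis using ab by (simp add: abs_mult)
    qed
    ultimately show ?thesis unfolding b_def by linarith
  qed
  have "(\<lambda>N. (\<Sum>k<N. (- 1) ^ k * real (N div (2 * k + 1))) / real N) \<longlonglongrightarrow> pi / 4"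
  proof (rule LIMSEQ_I)
    fix r :: real assume r: "r > 0"
    have "(\<lambda>K. 1 / real (2 * K + 1) + \<bar>e K - pi / 4\<bar>) \<longlonglongrightarrow> 0 + \<bar>pi / 4 - pi / 4\<bar>"
      by (intro tendsto_intros e) real_asymp
    then have "\<forall>\<^sub>F K in sequentially. 1 / real (2 * K + 1) + \<bar>e K - pi / 4\<bar> < r / 2"
      using r by (intro order_tendstoD(2)[where y = 0]) auto
    \<comment> \<open>K is fixed before N grows, so the cost K of the floors vanishes after division
      by N.\<close>
    then obtain K where K: "1 / real (2 * K + 1) + \<bar>e K - pi / 4\<bar> < r / 2"
      by (auto simp: eventually_sequentially)
    have "(\<lambda>N. real K / real N) \<longlonglongrightarrow> 0" by real_asymp
    then have "\<forall>\<^sub>F N in sequentially. real K / real N < r / 2"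
      using r by (intro order_tendstoD(2)[where y = 0]) auto
    then obtain N0 where N0: "\<And>N. N \<ge> N0 \<Longrightarrow> real K / real N < r / 2"
      by (auto simp: eventually_sequentially)
    show "\<exists>no. \<forall>N\<ge>no. norm ((\<Sum>k<N. (- 1) ^ k * real (N div (2 * k + 1))) / real N - pi / 4) < r"
    proof (intro exI allI impI)
      fix N assume N: "N \<ge> max N0 (max K 1)"
      define s where "s = (\<Sum>k<N. (- 1) ^ k * real (N div (2 * k + 1)))"
      have N1: "real N > 0" using N by auto
      have "s / real N - e K = (s - real N * e K) / real N"
        using N1 by (simp add: diff_divide_distrib)
      then have "\<bar>s / real N - e K\<bar> = \<bar>s - real N * e K\<bar> / real N"
        by (simp only: abs_divide abs_of_nat)
      also have "\<dots> \<le> (real K + real N / real (2 * K + 1)) / real N"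
        using bound[of K N] N N1 unfolding s_def by (intro divide_right_mono) auto
      also have "\<dots> = real K / real N + 1 / real (2 * K + 1)" using N1
        by (simp add: field_simps)
      finally have "\<bar>s / real N - pi / 4\<bar> < r" using K N0[of N] N by linarith
      then show "norm ((\<Sum>k<N. (- 1) ^ k * real (N div (2 * k + 1))) / real N - pi / 4) < r"
        by (simp add: s_def)
    qed
  qed
  from tendsto_mult_left[OF this, of 4] show ?thesis unfolding eq by simp
qed

lemma of_nat_le_real_iff: "x \<ge> 0 \<Longrightarrow> real n \<le> x \<longleftrightarrow> n \<le> nat \<lfloor>x\<rfloor>"
  by (simp add: le_nat_iff le_floor_iff)

lemma cnt_eq_sum:
  assumes "\<And>n. 0 < n \<Longrightarrow> finite {a \<in> X. w a = n}" "\<And>a. a \<in> X \<Longrightarrow> 0 < w a" "x \<ge> 0"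
  shows "cnt X w x = real (\<Sum>n=1..nat \<lfloor>x\<rfloor>. card {a \<in> X. w a = n})"
    and "finite {a \<in> X. real (w a) \<le> x}"
proof -
  have e: "{a \<in> X. real (w a) \<le> x} = (\<Union>n\<in>{1..nat \<lfloor>x\<rfloor>}. {a \<in> X. w a = n})"
    unfolding of_nat_le_real_iff[OF assms(3)] using assms(2) by (auto simp: Suc_le_eq)
  show "finite {a \<in> X. real (w a) \<le> x}" unfolding e using assms(1) by auto
  have "card (\<Union>n\<in>{1..nat \<lfloor>x\<rfloor>}. {a \<in> X. w a = n}) = (\<Sum>n=1..nat \<lfloor>x\<rfloor>. card {a \<in> X. w a = n})"
    using assms(1) by (intro card_UN_disjoint) auto
  then show "cnt X w x = real (\<Sum>n=1..nat \<lfloor>x\<rfloor>. card {a \<in> X. w a = n})"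
    unfolding cnt_def e by simp
qed

lemma cnt_mono: "finite {a \<in> X. real (w a) \<le> y} \<Longrightarrow> x \<le> y \<Longrightarrow> cnt X w x \<le> cnt X w y"
  unfolding cnt_def of_nat_le_iff by (intro card_mono) auto

lemma cnt_nonneg: "0 \<le> cnt X w x"
  by (simp add: cnt_def)

lemma cnt_eq_0:
  assumes "\<And>a. a \<in> X \<Longrightarrow> 0 < w a" "x < 1"
  shows "cnt X w x = 0"
proof -
  have "\<not> real (w a) \<le> x" if "a \<in> X" for a
  proof -
    have "1 \<le> real (w a)" using assms(1)[OF that] by simp
    then show ?thesis using assms(2) by linarith
  qed
  then have "{a \<in> X. real (w a) \<le> x} = {}" by blast
  then show ?thesis unfolding cnt_def by (simp only: card.empty of_nat_0)
qed

lemma finite_gnorm_cnt: "finite {z \<in> X. real (gnorm z) \<le> x}"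
proof (cases "x \<ge> 0")
  case True
  then show ?thesis unfolding of_nat_le_real_iff[OF True]
    by (intro finite_subset[OF _ finite_gnorm_le]) auto
next
  case False
  then have "{z \<in> X. real (gnorm z) \<le> x} = {}" by (auto simp: not_le intro: less_le_trans)
  then show ?thesis by (simp only: finite.emptyI)
qed

lemma cnt_gauss_limit: "((\<lambda>x. cnt (- {0}) gnorm x / x) \<longlongrightarrow> pi) at_top"
proof -
  have "filterlim (\<lambda>x::real. nat \<lfloor>x\<rfloor>) sequentially at_top"
    by (rule filterlim_compose[OF filterlim_nat_sequentially filterlim_floor_sequentially])
  from filterlim_compose[OF sum_repr2_limit this]
  have "((\<lambda>x::real. real (\<Sum>n=1..nat \<lfloor>x\<rfloor>. repr2 n) / real (nat \<lfloor>x\<rfloor>)) \<longlongrightarrow> pi) at_top" .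
  moreover have "((\<lambda>x::real. real (nat \<lfloor>x\<rfloor>) / x) \<longlongrightarrow> 1) at_top"
    by real_asymp
  ultimately have "((\<lambda>x. real (\<Sum>n=1..nat \<lfloor>x\<rfloor>. repr2 n) / real (nat \<lfloor>x\<rfloor>) * (real (nat \<lfloor>x\<rfloor>) / x)) \<longlongrightarrow> pi * 1) at_top"
    by (rule tendsto_mult)
  then have T: "((\<lambda>x. real (\<Sum>n=1..nat \<lfloor>x\<rfloor>. repr2 n) / real (nat \<lfloor>x\<rfloor>) * (real (nat \<lfloor>x\<rfloor>) / x)) \<longlongrightarrow> pi) at_top"
    unfolding mult_1_right .
  have "\<forall>\<^sub>F x in at_top. real (\<Sum>n=1..nat \<lfloor>x\<rfloor>. repr2 n) / real (nat \<lfloor>x\<rfloor>) * (real (nat \<lfloor>x\<rfloor>) / x) = cnt (- {0}) gnorm x / x"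
    using eventually_ge_at_top[of 1]
  proof eventually_elim
    case (elim x)
    have "card {z \<in> - {0}. gnorm z = n} = repr2 n"
      if "n \<in> {1..nat \<lfloor>x\<rfloor>}" for n
      using that by (auto simp: repr2_def gnorm_def intro!: arg_cong[where f = card])
    then have "cnt (- {0}) gnorm x = real (\<Sum>n=1..nat \<lfloor>x\<rfloor>. repr2 n)"
      using elim by (subst cnt_eq_sum(1)) (auto intro: gnorm_pos finite_subset[OF _ finite_gnorm_eq])
    moreover have "real (nat \<lfloor>x\<rfloor>) \<noteq> 0" using elim of_nat_le_real_iff[of x 1]
      by simp
    ultimately show ?case by simp
  qed
  then show ?thesis by (rule Lim_transform_eventually[OF T])
qed

text \<open>Provides a bound uniform in x > 0, as domination in Tannery's theorem requires: the
  limit controls large x, monotonicity a bounded range, and the count is 0 below 1.\<close>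

lemma cnt_le_linear:
  assumes "((\<lambda>x. cnt X w x / x) \<longlongrightarrow> C) at_top" "\<And>a. a \<in> X \<Longrightarrow> 0 < w a"
    and "\<And>x. finite {a \<in> X. real (w a) \<le> x}"
  obtains K where "K \<ge> 0" "\<And>x. x > 0 \<Longrightarrow> cnt X w x \<le> K * x"
proof -
  have "\<forall>\<^sub>F x in at_top. cnt X w x / x < C + 1"
    using assms(1) by (rule order_tendstoD(2)) simp
  then obtain N where N: "\<And>x. x \<ge> N \<Longrightarrow> cnt X w x / x < C + 1"
    by (auto simp: eventually_at_top_linorder)
  define M where "M = max N 1"
  define K where "K = max (C + 1) (cnt X w M)"
  have "cnt X w x \<le> K * x" if "x > 0" for x
  proof (cases "x \<ge> M")
    case True
    then have "cnt X w x / x \<le> K" using N[of x] by (auto simp: M_def K_def)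
    then show ?thesis using that by (simp add: field_simps)
  next
    case False
    show ?thesis
    proof (cases "x < 1")
      case True
      then show ?thesis using cnt_eq_0[of X w x] assms(2) that cnt_nonneg[of X w M]
        by (simp add: K_def max_def)
    next
      case x1: False
      have "cnt X w x \<le> cnt X w M" using False assms(3) by (intro cnt_mono) auto
      also have "\<dots> \<le> K * 1" by (simp add: K_def)
      also have "\<dots> \<le> K * x" using x1 cnt_nonneg[of X w M]
        by (intro mult_left_mono) (auto simp: K_def)
      finally show ?thesis .
    qed
  qed
  moreover have "K \<ge> 0" using cnt_nonneg[of X w M] by (simp add: K_def max_def)
  ultimately show ?thesis using that by blast
qed

section \<open>Density of primitive Gaussian integers\<close>

lemma cnt_prim_moebius:
  assumes "x > 0"
  shows "(\<lambda>n. of_int (moebius_mu (Suc n)) * cnt (- {0}) gnorm (x / (real (Suc n))\<^sup>2)) sums cnt prim gnorm x"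
proof -
  define N where "N = nat \<lfloor>x\<rfloor>"
  define Z where "Z = {z \<in> - {0}. real (gnorm z) \<le> x}"
  define dv where "dv = (\<lambda>(d::nat) (z::int \<times> int). int d dvd fst z \<and> int d dvd snd z)"
  have finZ: "finite Z" unfolding Z_def by (rule finite_gnorm_cnt)
  have dle: "1 \<le> d \<and> d \<le> N" if zd: "z \<in> Z" "dv d z" for d z
  proof -
    obtain a b where ab: "fst z = int d * a" "snd z = int d * b" using zd(2)
      by (auto simp: dv_def dvd_def)
    then have z: "z = scale (d, (a, b))" by (simp add: scale_def prod_eq_iff)
    have g: "gnorm z = d\<^sup>2 * gnorm (a, b)" unfolding z by (simp add: gnorm_scale)
    have g0: "0 < gnorm z" using that(1) gnorm_pos by (auto simp: Z_def)
    then have "d \<noteq> 0" "gnorm (a, b) \<noteq> 0" unfolding g by auto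
    then have "d * 1 \<le> d * (d * gnorm (a, b))" by (intro mult_le_mono2) (auto simp: Suc_le_eq)
    then have "d \<le> gnorm z" by (simp add: g power2_eq_square mult.assoc)
    then have "real d \<le> x" using that(1)
      by (auto simp: Z_def intro: order_trans[OF of_nat_mono])
    then show ?thesis using \<open>d \<noteq> 0\<close> assms
      by (simp add: N_def of_nat_le_real_iff[symmetric] Suc_le_eq)
  qed
  have cntd: "cnt (- {0}) gnorm (x / (real d)\<^sup>2) = real (card {z \<in> Z. dv d z})"
    if "d \<ge> 1" for d
  proof -
    have "{z \<in> Z. dv d z} = (\<lambda>z. scale (d, z)) ` {z \<in> - {0}. real (gnorm z) \<le> x / (real d)\<^sup>2}"
    proof (intro subset_antisym subsetI)
      fix z assume z: "z \<in> {z \<in> Z. dv d z}"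
      then obtain a b where ab: "fst z = int d * a" "snd z = int d * b"
        by (auto simp: dv_def dvd_def)
      then have zs: "z = scale (d, (a, b))" by (simp add: scale_def prod_eq_iff)
      have g: "gnorm z = d\<^sup>2 * gnorm (a, b)" unfolding zs by (simp add: gnorm_scale)
      have "gnorm z > 0" using z gnorm_pos by (auto simp: Z_def)
      then have "(a, b) \<noteq> 0" unfolding g by (auto simp: gnorm_def zero_prod_def)
      moreover have "real (gnorm (a, b)) \<le> x / (real d)\<^sup>2"
        using z that by (simp add: Z_def g field_simps)
      ultimately show "z \<in> (\<lambda>z. scale (d, z)) ` {z \<in> - {0}. real (gnorm z) \<le> x / (real d)\<^sup>2}"
        using zs by blast
    next
      fix z assume "z \<in> (\<lambda>z. scale (d, z)) ` {z \<in> - {0}. real (gnorm z) \<le> x / (real d)\<^sup>2}"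
      then obtain y where y: "y \<noteq> 0" "real (gnorm y) \<le> x / (real d)\<^sup>2" "z = scale (d, y)"
        by auto
      have g: "gnorm z = d\<^sup>2 * gnorm y" unfolding y(3) by (simp add: gnorm_scale)
      have "z \<noteq> 0" using y(1) that by (auto simp: y(3) scale_def prod_eq_iff)
      moreover have "real (gnorm z) \<le> x" using y(2) that by (simp add: g field_simps)
      ultimately show "z \<in> {z \<in> Z. dv d z}" by (simp add: Z_def dv_def y(3) scale_def)
    qed
    moreover have "inj (\<lambda>z. scale (d, z))" using that by (auto simp: inj_def scale_def)
    ultimately show ?thesis by (simp add: cnt_def card_image inj_on_subset)
  qed
  \<comment> \<open>The integers d dividing both coordinates are the divisors of their gcd, so the
    Moebius sum detects primitivity.\<close>
  have ind: "(\<Sum>d\<in>{d \<in> {1..N}. dv d z}. moebius_mu d) = (if z \<in> prim then 1 else 0)"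
    if z: "z \<in> Z" for z
  proof -
    define g where "g = nat (gcd (fst z) (snd z))"
    have "z \<noteq> 0" using z by (auto simp: Z_def)
    then have g0: "g > 0" by (auto simp: g_def prod_eq_iff)
    have dvg: "dv d z \<longleftrightarrow> d dvd g" for d
    proof -
      have "int g = gcd (fst z) (snd z)" by (simp add: g_def)
      then have "d dvd g \<longleftrightarrow> int d dvd gcd (fst z) (snd z)"
        by (metis int_dvd_int_iff)
      then show ?thesis by (simp add: dv_def)
    qed
    have "{d \<in> {1..N}. dv d z} = {d. d dvd g}" using dle[OF z] dvg by auto
    moreover have "g = 1 \<longleftrightarrow> z \<in> prim" using g0
      by (auto simp: g_def prim_def coprime_iff_gcd_eq_1)
    ultimately show ?thesis using sum_moebius[OF g0] by simp
  qed
  have "(\<Sum>d=1..N. of_int (moebius_mu d) * real (card {z \<in> Z. dv d z})) = (\<Sum>d=1..N. \<Sum>z\<in>{z \<in> Z. dv d z}. of_int (moebius_mu d))"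
    by (simp add: mult.commute)
  also have "\<dots> = (\<Sum>z\<in>Z. \<Sum>d\<in>{d \<in> {1..N}. dv d z}. of_int (moebius_mu d))"
    by (rule sum.swap_restrict[OF _ finZ]) simp
  also have "\<dots> = (\<Sum>z\<in>Z. if z \<in> prim then 1 else 0)"
  proof (rule sum.cong[OF refl])
    fix z assume "z \<in> Z"
    from arg_cong[OF ind[OF this], of "of_int :: int \<Rightarrow> real"]
    show "(\<Sum>d\<in>{d \<in> {1..N}. dv d z}. of_int (moebius_mu d)) = (if z \<in> prim then 1 else (0::real))"
      by simp
  qed
  also have "\<dots> = real (card {z \<in> Z. z \<in> prim})" using finZ
    by (simp add: sum.If_cases Int_def)
  also have "{z \<in> Z. z \<in> prim} = {z \<in> prim. real (gnorm z) \<le> x}"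
    using zero_notin_prim by (auto simp: Z_def)
  finally have fin: "(\<Sum>d=1..N. of_int (moebius_mu d) * real (card {z \<in> Z. dv d z})) = cnt prim gnorm x"
    by (simp add: cnt_def)
  have "(\<lambda>n. of_int (moebius_mu (Suc n)) * cnt (- {0}) gnorm (x / (real (Suc n))\<^sup>2)) sums
      (\<Sum>n<N. of_int (moebius_mu (Suc n)) * cnt (- {0}) gnorm (x / (real (Suc n))\<^sup>2))"
  proof (rule sums_finite)
    fix n assume "n \<notin> {..<N}"
    then have e: "{z \<in> Z. dv (Suc n) z} = {}" using dle[of _ "Suc n"] by fastforce
    show "of_int (moebius_mu (Suc n)) * cnt (- {0}) gnorm (x / (real (Suc n))\<^sup>2) = 0"
      using cntd[of "Suc n", unfolded e card.empty of_nat_0] by simp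
  qed simp
  also have "(\<Sum>n<N. of_int (moebius_mu (Suc n)) * cnt (- {0}) gnorm (x / (real (Suc n))\<^sup>2))
      = (\<Sum>d=1..N. of_int (moebius_mu d) * real (card {z \<in> Z. dv d z}))"
  proof -
    have "cnt (- {0}) gnorm (x / (real (Suc n))\<^sup>2) = real (card {z \<in> Z. dv (Suc n) z})" for n
      by (rule cntd) simp
    then show ?thesis by (simp only: sum.atLeast1_atMost_eq One_nat_def)
  qed
  finally show ?thesis unfolding fin .
qed

lemma cnt_scaled_limit:
  assumes "((\<lambda>x. cnt X w x / x) \<longlongrightarrow> C) at_top" "c > 0"
  shows "((\<lambda>x. cnt X w (x / c) / x) \<longlongrightarrow> C / c) at_top"
proof -
  have "filterlim (\<lambda>x. x / c) at_top at_top" using assms(2) by real_asymp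
  from filterlim_compose[OF assms(1) this]
  have "((\<lambda>x. cnt X w (x / c) / (x / c) / c) \<longlongrightarrow> C / c) at_top"
    using assms(2) by (intro tendsto_intros) auto
  then show ?thesis using assms(2) by simp
qed

text \<open>Tannery's theorem, dominated by K / n^2, exchanges limit and Moebius sum; the limit is
  pi times 1/zeta(2).\<close>

lemma cnt_prim_limit: "((\<lambda>x. cnt prim gnorm x / x) \<longlongrightarrow> 6 / pi) at_top"
proof -
  obtain K where K: "K \<ge> 0" "\<And>x. x > 0 \<Longrightarrow> cnt (- {0}) gnorm x \<le> K * x"
    by (rule cnt_le_linear[OF cnt_gauss_limit gnorm_pos finite_gnorm_cnt]) auto
  define a where "a = (\<lambda>n x. of_int (moebius_mu (Suc n)) * (cnt (- {0}) gnorm (x / (real (Suc n))\<^sup>2) / x))"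
  define b where "b = (\<lambda>n. of_int (moebius_mu (Suc n)) * (pi / (real (Suc n))\<^sup>2))"
  have mu: "\<bar>real_of_int (moebius_mu n)\<bar> \<le> 1" for n using abs_moebius_le_1[of n]
    by linarith
  have lim: "((\<lambda>x. a n x) \<longlongrightarrow> b n) at_top" for n
    unfolding a_def b_def by (intro tendsto_mult_left cnt_scaled_limit cnt_gauss_limit) simp
  have bd: "norm (a n x) \<le> K * (1 / (real (Suc n))\<^sup>2)" if "x > 0" for n x
  proof -
    have "\<bar>real_of_int (moebius_mu (Suc n))\<bar> * (cnt (- {0}) gnorm (x / (real (Suc n))\<^sup>2) / x)
        \<le> 1 * (K * (x / (real (Suc n))\<^sup>2) / x)"
      using that mu K(2)[of "x / (real (Suc n))\<^sup>2"] cnt_nonneg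
      by (intro mult_mono divide_right_mono) (auto intro!: divide_nonneg_pos)
    then show ?thesis using that cnt_nonneg[of "- {0}" gnorm "x / (real (Suc n))\<^sup>2"]
      by (simp add: a_def abs_mult)
  qed
  have sq: "summable (\<lambda>n. 1 / (real (Suc n))\<^sup>2)" using inverse_squares_sums
    by (simp add: sums_iff add.commute)
  have "\<forall>\<^sub>F (n, x) in at_top \<times>\<^sub>F at_top. norm (a n x) \<le> K * (1 / (real (Suc n))\<^sup>2)"
  proof (rule eventually_mono)
    show "\<forall>\<^sub>F p in at_top \<times>\<^sub>F at_top. (\<lambda>_. True) (fst p :: nat) \<and> 0 < (snd p :: real)"
      by (rule eventually_prodI) (auto intro: eventually_gt_at_top)
    show "case p of (n, x) \<Rightarrow> norm (a n x) \<le> K * (1 / (real (Suc n))\<^sup>2)"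
      if "True \<and> 0 < snd p" for p
      using bd[of "snd p" "fst p"] that by (simp only: case_prod_beta)
  qed
  from tannerys_theorem[OF lim this summable_mult[OF sq]]
  have T: "((\<lambda>x. \<Sum>n. a n x) \<longlongrightarrow> suminf b) at_top" by auto
  have "((\<lambda>x. cnt prim gnorm x / x) \<longlongrightarrow> suminf b) at_top"
  proof (rule Lim_transform_eventually[OF T])
    show "\<forall>\<^sub>F x in at_top. (\<Sum>n. a n x) = cnt prim gnorm x / x"
      using eventually_gt_at_top[of 0]
    proof eventually_elim
      case (elim x)
      show ?case
        using sums_divide[OF cnt_prim_moebius[OF elim], of x] by (simp add: a_def sums_iff)
    qed
  qed
  moreover have "suminf b = 6 / pi"
  proof -
    have z2: "zeta (2::complex) = of_real (pi\<^sup>2 / 6)"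
    proof -
      have "(\<lambda>n. complex_of_real (1 / (real n + 1)\<^sup>2)) sums of_real (pi\<^sup>2 / 6)"
        using inverse_squares_sums
          by (intro sums_of_real) (simp only: of_nat_power of_nat_add of_nat_1)
      moreover have "complex_of_real (1 / (real n + 1)\<^sup>2) = np (Suc n) 2" for n
        by (simp add: np_def powr_minus divide_inverse add.commute)
      moreover have "(\<lambda>n. np (Suc n) 2) sums zeta 2"
        using has_sum_zeta[of 2] unfolding has_sum_nat_atLeast_1_iff
          by (auto intro: has_sum_imp_sums)
      ultimately show ?thesis by (simp only: sums_iff)
    qed
    have bsum: "summable b"
    proof (rule summable_comparison_test'[OF summable_mult[OF sq, of pi], of 0])
      show "norm (b n) \<le> pi * (1 / (real (Suc n))\<^sup>2)" for n
        using mult_right_mono[OF mu[of "Suc n"], of "pi / (real (Suc n))\<^sup>2"]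
          by (simp add: b_def abs_mult)
    qed
    have "(\<lambda>n. of_int (moebius_mu (Suc n)) * of_nat (Suc n) powr - 2) = (\<lambda>n. complex_of_real (b n / pi))"
      by (auto simp: b_def powr_minus divide_inverse fun_eq_iff)
    then have "dirichlet_series (\<lambda>n. of_int (moebius_mu n)) (2::complex) = of_real (suminf b / pi)"
      unfolding dirichlet_series_def using bsum by (simp add: suminf_of_real suminf_divide)
    with zeta_times_moebius[of 2] z2 have "complex_of_real (suminf b / pi * (pi\<^sup>2 / 6)) = of_real 1"
      by simp
    then have "suminf b / pi * (pi\<^sup>2 / 6) = 1" by (simp only: of_real_eq_iff)
    then show ?thesis by (simp add: field_simps power2_eq_square)
  qed
  ultimately show ?thesis by simp
qed


lemma cnt_prim_split:
  "cnt prim gnorm x = cnt prim_odd gnorm x + cnt prim_odd gnorm (x / 2)"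
proof -
  have un: "{z \<in> prim. real (gnorm z) \<le> x} = {z \<in> prim_odd. real (gnorm z) \<le> x}
      \<union> gmul (1, 1) ` {z \<in> prim_odd. real (gnorm z) \<le> x / 2}"
  proof -
    have g: "gnorm (gmul (1, 1) z) = 2 * gnorm z" for z
      using gnorm_gmul[of "(1,1)" z] by (simp add: gnorm_def)
    have "{z \<in> prim. real (gnorm z) \<le> x} = {z \<in> prim_odd. real (gnorm z) \<le> x}
      \<union> {z \<in> {z \<in> prim. even (gnorm z)}. real (gnorm z) \<le> x}" by (auto simp: prim_odd_def)
    also have "{z \<in> {z \<in> prim. even (gnorm z)}. real (gnorm z) \<le> x}
        = gmul (1, 1) ` {z \<in> prim_odd. real (gnorm z) \<le> x / 2}"
      unfolding prim_even using g by (auto simp: image_iff)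
    finally show ?thesis .
  qed
  have dis: "{z \<in> prim_odd. real (gnorm z) \<le> x} \<inter> gmul (1, 1) ` {z \<in> prim_odd. real (gnorm z) \<le> x / 2} = {}"
    using prim_even by (auto simp: prim_odd_def)
  have "card {z \<in> prim. real (gnorm z) \<le> x} = card {z \<in> prim_odd. real (gnorm z) \<le> x}
      + card (gmul (1, 1) ` {z \<in> prim_odd. real (gnorm z) \<le> x / 2})"
    unfolding un
      by (rule card_Un_disjoint[OF finite_gnorm_cnt finite_imageI[OF finite_gnorm_cnt] dis])
  then show ?thesis
    using card_image[OF inj_on_subset[OF inj_gmul[of "(1,1)"] subset_UNIV]] by (simp add: cnt_def)
qed

lemma prim_odd_pos: "z \<in> prim_odd \<Longrightarrow> 0 < gnorm z"
  and prim_pos: "z \<in> prim \<Longrightarrow> 0 < gnorm z"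
  by (auto simp: prim_odd_def dest!: zero_notin_prim intro!: gnorm_pos)

text \<open>Iterating \<open>cnt_prim_split\<close> expresses the odd count as an alternating sum of
  the counts at x / 2^k, so the density is 6/pi divided by 1 + 1/2.\<close>

lemma cnt_prim_odd_limit: "((\<lambda>x. cnt prim_odd gnorm x / x) \<longlongrightarrow> 4 / pi) at_top"
proof -
  obtain K where K: "K \<ge> 0" "\<And>x. x > 0 \<Longrightarrow> cnt prim gnorm x \<le> K * x"
    by (rule cnt_le_linear[OF cnt_prim_limit prim_pos finite_gnorm_cnt]) auto
  define a where "a = (\<lambda>k x. (- 1) ^ k * (cnt prim gnorm (x / 2 ^ k) / x))"
  define b where "b = (\<lambda>k. (- 1) ^ k * (6 / pi / 2 ^ k))"
  have lim: "((\<lambda>x. a n x) \<longlongrightarrow> b n) at_top" for n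
    unfolding a_def b_def by (intro tendsto_mult_left cnt_scaled_limit cnt_prim_limit) simp
  have bd: "norm (a n x) \<le> K * (1 / 2) ^ n" if "x > 0" for n x
  proof -
    have "cnt prim gnorm (x / 2 ^ n) / x \<le> K * (x / 2 ^ n) / x"
      using that K(2)[of "x / 2 ^ n"] by (intro divide_right_mono) auto
    then show ?thesis using that cnt_nonneg[of prim gnorm "x / 2 ^ n"]
      by (simp add: a_def abs_mult power_divide)
  qed
  have "\<forall>\<^sub>F (n, x) in at_top \<times>\<^sub>F at_top. norm (a n x) \<le> K * (1 / 2) ^ n"
  proof (rule eventually_mono)
    show "\<forall>\<^sub>F p in at_top \<times>\<^sub>F at_top. (\<lambda>_. True) (fst p :: nat) \<and> 0 < (snd p :: real)"
      by (rule eventually_prodI) (auto intro: eventually_gt_at_top)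
    show "case p of (n, x) \<Rightarrow> norm (a n x) \<le> K * (1 / 2) ^ n"
      if "True \<and> 0 < snd p" for p
      using bd[of "snd p" "fst p"] that by (simp only: case_prod_beta)
  qed
  from tannerys_theorem[OF lim this]
  have T: "((\<lambda>x. \<Sum>n. a n x) \<longlongrightarrow> suminf b) at_top"
    by (auto intro: summable_geometric)
  have "((\<lambda>x. cnt prim_odd gnorm x / x) \<longlongrightarrow> suminf b) at_top"
  proof (rule Lim_transform_eventually[OF T])
    show "\<forall>\<^sub>F x in at_top. (\<Sum>n. a n x) = cnt prim_odd gnorm x / x"
      using eventually_gt_at_top[of 0]
    proof eventually_elim
      case (elim x)
      have part: "(\<Sum>k<n. a k x) = (cnt prim_odd gnorm x - (- 1) ^ n * cnt prim_odd gnorm (x / 2 ^ n)) / x" for n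
        by (induction n) (use elim in \<open>simp_all add: a_def cnt_prim_split[of "x / 2 ^ _"] field_simps\<close>)
      \<comment> \<open>Once 2^n exceeds x no element is left to count and the remainder
        vanishes.\<close>
      have "filterlim (\<lambda>n. (2::real) ^ n) at_top sequentially" by real_asymp
      then have "\<forall>\<^sub>F n in sequentially. x < 2 ^ n"
        by (simp add: filterlim_at_top_dense)
      then have "\<forall>\<^sub>F n in sequentially. (\<Sum>k<n. a k x) = cnt prim_odd gnorm x / x"
      proof eventually_elim
        case (elim n)
        then have "cnt prim_odd gnorm (x / 2 ^ n) = 0"
          by (intro cnt_eq_0 prim_odd_pos) auto
        then show ?case by (simp add: part)
      qed
      then have "(\<lambda>n. \<Sum>k<n. a k x) \<longlonglongrightarrow> cnt prim_odd gnorm x / x"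
        by (rule tendsto_eventually)
      then show ?case unfolding sums_def[symmetric] by (rule sums_unique[symmetric])
    qed
  qed
  moreover have "b sums (6 / pi * (1 / (1 - (- 1 / 2))))"
  proof -
    have "(\<lambda>k. 6 / pi * (- 1 / 2) ^ k) sums (6 / pi * (1 / (1 - (- 1 / 2))))"
      by (intro sums_mult geometric_sums) simp
    also have "(\<lambda>k. 6 / pi * (- 1 / 2) ^ k) = b"
      by (simp only: b_def fun_eq_iff power_divide) simp
    finally show ?thesis .
  qed
  then have "suminf b = 4 / pi" by (simp add: sums_iff)
  ultimately show ?thesis by simp
qed

section \<open>Counting in products\<close>

lemma cnt_Times:
  assumes "\<And>b. b \<in> Y \<Longrightarrow> 0 < v b" "\<And>a. a \<in> X \<Longrightarrow> 0 < w a"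
    and "\<And>x. finite {a \<in> X. real (w a) \<le> x}" "\<And>x. finite {b \<in> Y. real (v b) \<le> x}" "x > 0"
  shows "cnt (X \<times> Y) (\<lambda>p. w (fst p) * v (snd p)) x = (\<Sum>a | a \<in> X \<and> real (w a) \<le> x. cnt Y v (x / real (w a)))"
proof -
  have "{p \<in> X \<times> Y. real (w (fst p) * v (snd p)) \<le> x}
      = Sigma {a \<in> X. real (w a) \<le> x} (\<lambda>a. {b \<in> Y. real (v b) \<le> x / real (w a)})"
  proof (intro subset_antisym subsetI)
    fix p assume "p \<in> {p \<in> X \<times> Y. real (w (fst p) * v (snd p)) \<le> x}"
    then obtain a b where p: "p = (a, b)" "a \<in> X" "b \<in> Y" "real (w a) * real (v b) \<le> x"
      by auto
    have "real (w a) * 1 \<le> real (w a) * real (v b)"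
      using assms(1)[OF p(3)] by (intro mult_left_mono) (auto simp: Suc_le_eq)
    then have "real (w a) \<le> x" using p(4) by linarith
    then show "p \<in> Sigma {a \<in> X. real (w a) \<le> x} (\<lambda>a. {b \<in> Y. real (v b) \<le> x / real (w a)})"
      using p assms(2)[OF p(2)] by (simp add: field_simps)
  next
    fix p assume "p \<in> Sigma {a \<in> X. real (w a) \<le> x} (\<lambda>a. {b \<in> Y. real (v b) \<le> x / real (w a)})"
    then show "p \<in> {p \<in> X \<times> Y. real (w (fst p) * v (snd p)) \<le> x}"
      using assms(2) by (auto simp: field_simps)
  qed
  then show ?thesis using assms(3,4) by (simp add: cnt_def)
qed

text \<open>Since \<open>Y\<close> has a density, only the harmonic sums of \<open>X\<close> matter; no asymptotics of its
  counting function is needed.\<close>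

lemma cnt_Times_limit:
  assumes pos: "\<And>b. b \<in> Y \<Longrightarrow> 0 < v b" "\<And>a. a \<in> X \<Longrightarrow> 0 < w a"
    and fin: "\<And>x. finite {a \<in> X. real (w a) \<le> x}" "\<And>x. finite {b \<in> Y. real (v b) \<le> x}"
    and Y: "((\<lambda>y. cnt Y v y / y) \<longlongrightarrow> C) at_top"
    and X: "\<And>x. x > 0 \<Longrightarrow> cnt X w x \<le> K * x"
    and S: "((\<lambda>x. (\<Sum>a | a \<in> X \<and> real (w a) \<le> x. 1 / real (w a)) / ln x) \<longlongrightarrow> k) at_top"
  shows "((\<lambda>x. cnt (X \<times> Y) (\<lambda>p. w (fst p) * v (snd p)) x / (x * ln x)) \<longlongrightarrow> C * k) at_top"
proof -
  define S where "S = (\<lambda>x. \<Sum>a | a \<in> X \<and> real (w a) \<le> x. 1 / real (w a))"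
  define T where "T = cnt (X \<times> Y) (\<lambda>p. w (fst p) * v (snd p))"
  have Sl: "((\<lambda>x. S x / ln x) \<longlongrightarrow> k) at_top" using S by (simp add: S_def)
  have "((\<lambda>x. T x / (x * ln x) - C * (S x / ln x)) \<longlongrightarrow> 0) at_top"
  proof (rule tendstoI)
    fix e :: real assume e: "e > 0"
    define d where "d = e / (2 * (\<bar>k\<bar> + 1))"
    have d: "d > 0" using e by (auto simp: d_def intro!: divide_pos_pos)
    have "\<forall>\<^sub>F y in at_top. \<bar>cnt Y v y / y - C\<bar> < d"
      using tendstoD[OF Y d] by (simp add: dist_real_def)
    then obtain Y0 where Y0: "\<And>y. y \<ge> Y0 \<Longrightarrow> \<bar>cnt Y v y / y - C\<bar> < d"
      by (auto simp: eventually_at_top_linorder)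
    define M where "M = max Y0 1"
    define B where "B = cnt Y v M + \<bar>C\<bar> * M"
    have B0: "B \<ge> 0" using cnt_nonneg[of Y v M] by (simp add: B_def M_def)
    \<comment> \<open>One estimate for all y > 0: the constant B absorbs small y. Summed over X it
      costs at most B K x, which is negligible against x log x.\<close>
    have dev: "\<bar>cnt Y v y - C * y\<bar> \<le> d * y + B" if y: "y > 0" for y
    proof (cases "y \<ge> M")
      case True
      have "cnt Y v y - C * y = (cnt Y v y / y - C) * y"
        using y by (simp add: left_diff_distrib)
      then have "\<bar>cnt Y v y - C * y\<bar> = \<bar>cnt Y v y / y - C\<bar> * y"
        using y by (simp only: abs_mult abs_of_pos)
      also have "\<dots> \<le> d * y" using Y0[of y] True y
        by (intro mult_right_mono) (auto simp: M_def)
      finally show ?thesis using B0 by simp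
    next
      case False
      have "cnt Y v y \<le> cnt Y v M" using False fin(2) by (intro cnt_mono) auto
      moreover have "\<bar>C * y\<bar> \<le> \<bar>C\<bar> * M" using False y
        by (auto simp: abs_mult intro: mult_left_mono)
      moreover have "d * y \<ge> 0" using d y by simp
      ultimately show ?thesis using cnt_nonneg[of Y v y] unfolding B_def by linarith
    qed
    have main: "\<bar>T x - C * x * S x\<bar> \<le> d * x * S x + B * (K * x)" if x: "x > 0" for x
    proof -
      have "T x - C * x * S x = (\<Sum>a | a \<in> X \<and> real (w a) \<le> x. cnt Y v (x / real (w a)) - C * (x / real (w a)))"
        using cnt_Times[OF pos fin x] unfolding T_def S_def
          by (simp add: sum_subtractf sum_distrib_left)
      also have "\<bar>\<dots>\<bar> \<le> (\<Sum>a | a \<in> X \<and> real (w a) \<le> x. d * (x / real (w a)) + B)"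
        using x pos(2) by (intro order_trans[OF sum_abs] sum_mono dev) auto
      also have "\<dots> = d * x * S x + B * cnt X w x"
        unfolding S_def cnt_def by (simp add: sum.distrib sum_distrib_left)
      also have "\<dots> \<le> d * x * S x + B * (K * x)"
        using X[OF x] B0 by (intro add_left_mono mult_left_mono) auto
      finally show ?thesis .
    qed
    have "((\<lambda>x. d * (S x / ln x) + B * K / ln x) \<longlongrightarrow> d * k + 0) at_top"
      by (intro tendsto_add tendsto_mult tendsto_const Sl) real_asymp
    moreover have "d * k + 0 < e"
    proof -
      have "d * k \<le> d * \<bar>k\<bar>" using d by (intro mult_left_mono) auto
      also have "\<dots> < d * (2 * (\<bar>k\<bar> + 1))" using d
        by (intro mult_strict_left_mono) auto
      also have "\<dots> = e" by (simp add: d_def)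
      finally show ?thesis by simp
    qed
    ultimately have "\<forall>\<^sub>F x in at_top. d * (S x / ln x) + B * K / ln x < e"
      by (rule order_tendstoD(2))
    then show "\<forall>\<^sub>F x in at_top. dist (T x / (x * ln x) - C * (S x / ln x)) 0 < e"
      using eventually_gt_at_top[of 1]
    proof eventually_elim
      case (elim x)
      have x: "x > 0" "x * ln x > 0" using elim(2) by auto
      have lx: "ln x \<noteq> 0" "x \<noteq> 0" using elim(2) by auto
      have "C * (S x / ln x) = C * x * S x / (x * ln x)" using lx by simp
      then have "T x / (x * ln x) - C * (S x / ln x) = (T x - C * x * S x) / (x * ln x)"
        by (simp only: diff_divide_distrib)
      also have "\<bar>\<dots>\<bar> \<le> (d * x * S x + B * (K * x)) / (x * ln x)"
        using main[OF x(1)] x(2) by (simp add: abs_divide divide_right_mono)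
      also have "\<dots> = d * (S x / ln x) + B * K / ln x" using lx by (simp add: field_simps)
      finally show ?case using elim(1) by (simp add: dist_real_def)
    qed
  qed
  from tendsto_add[OF this tendsto_mult_left[OF Sl, of C]] show ?thesis by (simp add: T_def)
qed

section \<open>Harmonic sums over the admissible pairs\<close>

definition class_harm :: "nat \<Rightarrow> real \<Rightarrow> real" where
  "class_harm h y = (\<Sum>p | 0 < p \<and> p mod h = 1 mod h \<and> real p \<le> y. 1 / real p)"

lemma finite_nat_le_real: "finite {p::nat. P p \<and> real p \<le> y}"
  by (rule finite_subset[of _ "{..nat \<lceil>y\<rceil>}"]) (auto, linarith)

text \<open>Each h/(1 + h j) is compared with the increment of the logarithm over one step, and the
  increments telescope.\<close>

lemma class_harm_bounds:
  assumes "0 < h" "h \<le> 2" "y \<ge> 1"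
  shows "(ln y) / real h \<le> class_harm h y" "class_harm h y \<le> 1 + (ln y) / real h"
proof -
  define M where "M = nat \<lfloor>(y - 1) / real h\<rfloor>"
  have M: "real M \<le> (y - 1) / real h" "(y - 1) / real h < real M + 1"
    using assms by (simp_all add: M_def)
  then have M': "1 + real h * real M \<le> y" "y < 1 + real h * (real M + 1)"
    using assms(1) by (simp_all add: field_simps)
  have set: "{p. 0 < p \<and> p mod h = 1 mod h \<and> real p \<le> y} = (\<lambda>j. 1 + h * j) ` {..M}"
  proof (intro subset_antisym subsetI)
    fix p assume p: "p \<in> {p. 0 < p \<and> p mod h = 1 mod h \<and> real p \<le> y}"
    then have "h dvd p - 1" using mod_eq_dvd_iff_nat[of 1 p h] by auto
    then obtain j where "p - 1 = h * j" by (auto simp: dvd_def)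
    then have j: "p = 1 + h * j" using p by auto
    have "real h * real j < real h * (real M + 1)" using p M'(2) by (simp add: j)
    then have "j \<le> M" using assms(1) by (simp add: mult_less_cancel_left)
    then show "p \<in> (\<lambda>j. 1 + h * j) ` {..M}" using j by auto
  next
    fix p assume "p \<in> (\<lambda>j. 1 + h * j) ` {..M}"
    then obtain j where j: "j \<le> M" "p = 1 + h * j" by auto
    have "real h * real j \<le> real h * real M" using j(1) by (intro mult_left_mono) auto
    then have "real p \<le> y" using M'(1) by (simp add: j(2))
    moreover have "p mod h = 1 mod h" unfolding j(2) by (rule mod_mult_self2)
    ultimately show "p \<in> {p. 0 < p \<and> p mod h = 1 mod h \<and> real p \<le> y}"
      using j(2) by (simp only: mem_Collect_eq) simp
  qed
  have eq: "class_harm h y = (\<Sum>j<Suc M. 1 / (1 + real h * real j))"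
    unfolding class_harm_def set lessThan_Suc_atMost using assms(1)
    by (subst sum.reindex) (auto simp: inj_on_def)
  have step: "ln (1 + real h * real (Suc j)) - ln (1 + real h * real j) \<le> real h / (1 + real h * real j)"
    "real h / (1 + real h * real (Suc j)) \<le> ln (1 + real h * real (Suc j)) - ln (1 + real h * real j)" for j
  proof -
    have pos: "0 < 1 + real h * real j" "0 < 1 + real h * real (Suc j)"
      by (auto intro: add_pos_nonneg)
    have d: "1 + real h * real (Suc j) - (1 + real h * real j) = real h"
      by (simp add: algebra_simps)
    show "ln (1 + real h * real (Suc j)) - ln (1 + real h * real j) \<le> real h / (1 + real h * real j)"
      using ln_diff_le[OF pos(2,1)] unfolding d .
    have "1 + real h * real j - (1 + real h * real (Suc j)) = - real h" by (simp add: algebra_simps)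
    then show "real h / (1 + real h * real (Suc j)) \<le> ln (1 + real h * real (Suc j)) - ln (1 + real h * real j)"
      using ln_diff_le[OF pos] by simp
  qed
  have "(\<Sum>j<Suc M. ln (1 + real h * real (Suc j)) - ln (1 + real h * real j))
      \<le> (\<Sum>j<Suc M. real h / (1 + real h * real j))"
    by (intro sum_mono step)
  then have "ln (1 + real h * real (Suc M)) \<le> real h * (\<Sum>j<Suc M. 1 / (1 + real h * real j))"
    using sum_lessThan_telescope[of "\<lambda>j. ln (1 + real h * real j)" "Suc M"]
    by (simp add: sum_distrib_left del: sum.lessThan_Suc of_nat_Suc)
  moreover have "ln y \<le> ln (1 + real h * real (Suc M))" using M'(2) assms(3)
    by (simp add: add.commute)
  ultimately show "ln y / real h \<le> class_harm h y" using assms(1) unfolding eq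
    by (simp add: field_simps)
  have "(\<Sum>j<M. real h / (1 + real h * real (Suc j)))
      \<le> (\<Sum>j<M. ln (1 + real h * real (Suc j)) - ln (1 + real h * real j))"
    by (intro sum_mono step)
  then have "real h * (\<Sum>j<M. 1 / (1 + real h * real (Suc j))) \<le> ln (1 + real h * real M)"
    using sum_lessThan_telescope[of "\<lambda>j. ln (1 + real h * real j)" M]
    by (simp add: sum_distrib_left del: of_nat_Suc)
  also have "\<dots> \<le> ln y" using M'(1) by (intro ln_mono) (auto intro: add_pos_nonneg)
  finally have "(\<Sum>j<M. 1 / (1 + real h * real (Suc j))) \<le> ln y / real h"
    using assms(1) by (simp add: field_simps)
  then show "class_harm h y \<le> 1 + ln y / real h"
    unfolding eq by (subst sum.lessThan_Suc_shift) simp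
qed

text \<open>The Riemann sum error at s = 1, where (|s| + 1) p^(-Re s) is 2/p.\<close>

lemma side_inner_harm:
  assumes "0 < p" "p mod h = 1 mod h" "0 < h"
  shows "\<bar>(\<Sum>q | (p, q) \<in> side_pairs h. 1 / real q) - ln (sqrt 3) / real h\<bar> \<le> 2 / real p"
proof -
  have "np q 1 = complex_of_real (1 / real q)" for q by (simp add: np_def powr_minus divide_inverse)
  moreover have "powint (real p) (sqrt 3 * real p) 1 = of_real (ln (sqrt 3))"
    using assms(1) by (simp add: powint_def ln_mult)
  ultimately have "side_error h p 1 = of_real ((\<Sum>q | (p, q) \<in> side_pairs h. 1 / real q) - ln (sqrt 3) / real h)"
    using assms(2) by (simp add: side_error_def)
  moreover have "norm (side_error h p 1) \<le> (norm (1::complex) + 1) * real p powr - Re 1"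
    using assms by (intro norm_side_error_le) auto
  ultimately show ?thesis
    using assms(1) by (simp only: norm_of_real) (simp add: powr_minus divide_inverse)
qed

definition side_harm :: "nat \<Rightarrow> real \<Rightarrow> real" where
  "side_harm h y = (\<Sum>p | 0 < p \<and> p mod h = 1 mod h \<and> real p \<le> y.
     1 / real p * (\<Sum>q | (p, q) \<in> side_pairs h. 1 / real q))"

text \<open>Weighted by 1/p, the inner errors are at most 2/p^2 and have a bounded sum.\<close>

lemma side_harm_approx:
  assumes "0 < h"
  obtains B where "\<And>y. \<bar>side_harm h y - ln (sqrt 3) / real h * class_harm h y\<bar> \<le> B"
proof -
  have sq: "summable (\<lambda>n. 1 / (real n)\<^sup>2)"
    using inverse_power_summable[of 2, where 'a = real]
    by (simp add: divide_inverse)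
  have "\<bar>side_harm h y - ln (sqrt 3) / real h * class_harm h y\<bar> \<le> 2 * (\<Sum>n. 1 / (real n)\<^sup>2)" for y
  proof -
    let ?P = "{p. 0 < p \<and> p mod h = 1 mod h \<and> real p \<le> y}"
    have fin: "finite ?P"
      using finite_nat_le_real[of "\<lambda>p. 0 < p \<and> p mod h = 1 mod h" y]
        by (simp add: conj_assoc)
    have eq: "side_harm h y - ln (sqrt 3) / real h * class_harm h y
        = (\<Sum>p\<in>?P. 1 / real p * ((\<Sum>q | (p, q) \<in> side_pairs h. 1 / real q) - ln (sqrt 3) / real h))"
      by (simp add: side_harm_def class_harm_def sum_distrib_left sum_subtractf right_diff_distrib mult.commute)
    have "\<bar>side_harm h y - ln (sqrt 3) / real h * class_harm h y\<bar> \<le> (\<Sum>p\<in>?P. 2 * (1 / (real p)\<^sup>2))"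
      unfolding eq
    proof (intro order_trans[OF sum_abs] sum_mono)
      fix p assume p: "p \<in> ?P"
      have "\<bar>1 / real p * ((\<Sum>q | (p, q) \<in> side_pairs h. 1 / real q) - ln (sqrt 3) / real h)\<bar>
          = 1 / real p * \<bar>(\<Sum>q | (p, q) \<in> side_pairs h. 1 / real q) - ln (sqrt 3) / real h\<bar>"
        by (simp add: abs_mult)
      also have "\<dots> \<le> 1 / real p * (2 / real p)"
        using p assms by (intro mult_left_mono side_inner_harm) auto
      finally show "\<bar>1 / real p * ((\<Sum>q | (p, q) \<in> side_pairs h. 1 / real q) - ln (sqrt 3) / real h)\<bar>
          \<le> 2 * (1 / (real p)\<^sup>2)" by (simp add: power2_eq_square)
    qed
    also have "\<dots> = 2 * (\<Sum>p\<in>?P. 1 / (real p)\<^sup>2)"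
      by (rule sum_distrib_left[symmetric])
    also have "\<dots> \<le> 2 * (\<Sum>n. 1 / (real n)\<^sup>2)"
      using fin sq by (intro mult_left_mono sum_le_suminf) auto
    finally show ?thesis .
  qed
  then show ?thesis using that by blast
qed

lemma side_harm_limit:
  assumes "0 < h" "h \<le> 2"
  shows "((\<lambda>y. side_harm h y / ln y) \<longlongrightarrow> ln (sqrt 3) / (real h)\<^sup>2) at_top"
proof -
  obtain B where B: "\<And>y. \<bar>side_harm h y - ln (sqrt 3) / real h * class_harm h y\<bar> \<le> B"
    using side_harm_approx[OF assms(1)] by blast
  define c where "c = ln (sqrt 3) / real h"
  have c: "c > 0" using assms by (simp add: c_def)
  have "((\<lambda>y. (c * (ln y / real h) - B) / ln y) \<longlongrightarrow> c * inverse (real h)) at_top"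
    using assms by real_asymp
  then have lo: "((\<lambda>y. (c * (ln y / real h) - B) / ln y) \<longlongrightarrow> c / real h) at_top"
    by (simp only: divide_inverse)
  have "((\<lambda>y. (c * (1 + ln y / real h) + B) / ln y) \<longlongrightarrow> c * inverse (real h)) at_top"
    using assms by real_asymp
  then have up: "((\<lambda>y. (c * (1 + ln y / real h) + B) / ln y) \<longlongrightarrow> c / real h) at_top"
    by (simp only: divide_inverse)
  have "((\<lambda>y. side_harm h y / ln y) \<longlongrightarrow> c / real h) at_top"
  proof (rule tendsto_sandwich[OF _ _ lo up])
    show "\<forall>\<^sub>F y in at_top. (c * (ln y / real h) - B) / ln y \<le> side_harm h y / ln y"
      using eventually_gt_at_top[of 1]
    proof eventually_elim
      case (elim y)
      have "c * (ln y / real h) \<le> c * class_harm h y"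
        using class_harm_bounds(1)[OF assms, of y] elim c by (intro mult_left_mono) auto
      then show ?case using B[of y] elim by (intro divide_right_mono) (auto simp: c_def)
    qed
    show "\<forall>\<^sub>F y in at_top. side_harm h y / ln y \<le> (c * (1 + ln y / real h) + B) / ln y"
      using eventually_gt_at_top[of 1]
    proof eventually_elim
      case (elim y)
      have "c * class_harm h y \<le> c * (1 + ln y / real h)"
        using class_harm_bounds(2)[OF assms, of y] elim c by (intro mult_left_mono) auto
      then show ?case using B[of y] elim by (intro divide_right_mono) (auto simp: c_def)
    qed
  qed
  then show ?thesis by (simp add: c_def power2_eq_square)
qed

lemma side_pairs_less: "(p, q) \<in> side_pairs h \<Longrightarrow> 0 < p \<and> p < q \<and> q < 2 * p"
proof -
  assume a: "(p, q) \<in> side_pairs h"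
  then have "q\<^sup>2 < (2 * p)\<^sup>2" by (auto simp: side_pairs_def power_mult_distrib)
  then have "q < 2 * p" by (rule power2_less_imp_less) simp
  then show ?thesis using a by (auto simp: side_pairs_def)
qed

lemma side_pairs_finite: "finite {x \<in> side_pairs h. real (fst x * snd x) \<le> y}"
  and cnt_side_pairs_le: "y > 0 \<Longrightarrow> cnt (side_pairs h) (\<lambda>x. fst x * snd x) y \<le> 2 * y"
proof -
  let ?S = "{x \<in> side_pairs h. real (fst x * snd x) \<le> y}"
  let ?M = "nat \<lfloor>sqrt y\<rfloor>"
  \<comment> \<open>From p < q < 2 p and p q <= y follow p <= sqrt y and q < 2 p.\<close>
  have sub: "?S \<subseteq> {1..?M} \<times> {1..2 * ?M}" 
  proof
    fix x assume x: "x \<in> ?S"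
    obtain p q where pq: "x = (p, q)" by (cases x)
    have l: "0 < p" "p < q" "q < 2 * p" "real p * real q \<le> y" using x side_pairs_less[of p q h]
      by (auto simp: pq)
    have "real p * real p \<le> real p * real q" using l by (intro mult_left_mono) auto
    then have "(real p)\<^sup>2 \<le> y" unfolding power2_eq_square using l(4) by (rule order_trans)
    then have "real p \<le> sqrt y" by (rule real_le_rsqrt)
    then have "p \<le> ?M"
      using of_nat_le_real_iff[of "sqrt y" p] order_trans[of 0 "real p" "sqrt y"] by simp
    then show "x \<in> {1..?M} \<times> {1..2 * ?M}" using l by (auto simp: pq)
  qed
  then show "finite ?S" by (rule finite_subset) simp
  assume y: "y > 0"
  have "card ?S \<le> card ({1..?M} \<times> {1..2 * ?M})" using sub by (intro card_mono) auto
  then have "cnt (side_pairs h) (\<lambda>x. fst x * snd x) y \<le> real (?M * (2 * ?M))"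
    unfolding cnt_def of_nat_le_iff by (simp add: card_cartesian_product)
  also have "\<dots> = 2 * (real ?M * real ?M)" by simp
  also have "\<dots> \<le> 2 * (sqrt y * sqrt y)"
    using y by (intro mult_left_mono mult_mono) (auto simp: of_nat_floor)
  finally show "cnt (side_pairs h) (\<lambda>x. fst x * snd x) y \<le> 2 * y" using y by simp
qed

text \<open>Sandwich: \<open>p \<le> sqrt (x / 2)\<close> implies \<open>p q \<le> x\<close>, which in turn implies \<open>p \<le> sqrt x\<close>.\<close>

lemma side_pairs_harm_limit:
  assumes "0 < h" "h \<le> 2"
  shows "((\<lambda>x. (\<Sum>a | a \<in> side_pairs h \<and> real (fst a * snd a) \<le> x. 1 / real (fst a * snd a)) / ln x)
    \<longlongrightarrow> ln 3 / (4 * (real h)\<^sup>2)) at_top"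
proof -
  define S where "S = (\<lambda>x. \<Sum>a | a \<in> side_pairs h \<and> real (fst a * snd a) \<le> x. 1 / real (fst a * snd a))"
  let ?P = "\<lambda>y. {p. 0 < p \<and> p mod h = 1 mod h \<and> real p \<le> y}"
  let ?A = "\<lambda>y. Sigma (?P y) (\<lambda>p. {q. (p, q) \<in> side_pairs h})"
  have finP: "finite (?P y)" for y
    using finite_nat_le_real[of "\<lambda>p. 0 < p \<and> p mod h = 1 mod h" y]
      by (simp add: conj_assoc)
  have finA: "finite (?A y)" for y using finP finite_side by (intro finite_SigmaI)
  have harm: "side_harm h y = (\<Sum>a\<in>?A y. 1 / real (fst a * snd a))" for y
  proof -
    have "side_harm h y = (\<Sum>p\<in>?P y. \<Sum>q\<in>{q. (p, q) \<in> side_pairs h}. 1 / real (p * q))"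
      by (simp add: side_harm_def sum_distrib_left)
    also have "\<dots> = (\<Sum>(p, q)\<in>?A y. 1 / real (p * q))"
      by (rule sum.Sigma) (use finP finite_side in auto)
    finally show ?thesis by (simp add: case_prod_unfold)
  qed
  have lo: "side_harm h (sqrt (x / 2)) \<le> S x" if "x > 0" for x
    unfolding harm S_def
  proof (rule sum_mono2)
    show "finite {a. a \<in> side_pairs h \<and> real (fst a * snd a) \<le> x}"
      using side_pairs_finite by simp
    show "?A (sqrt (x / 2)) \<subseteq> {a. a \<in> side_pairs h \<and> real (fst a * snd a) \<le> x}"
    proof
      fix a assume a: "a \<in> ?A (sqrt (x / 2))"
      obtain p q where pq: "a = (p, q)" by (cases a)
      have l: "(p, q) \<in> side_pairs h" "real p \<le> sqrt (x / 2)" using a by (auto simp: pq)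
      have "q \<le> 2 * p" using side_pairs_less[OF l(1)] by simp
      then have "real q \<le> 2 * real p" by (metis of_nat_le_iff of_nat_mult of_nat_numeral)
      then have "real p * real q \<le> real p * (2 * real p)" by (intro mult_left_mono) auto
      also have "\<dots> = 2 * (real p)\<^sup>2" by (simp add: power2_eq_square)
      also have "\<dots> \<le> 2 * (sqrt (x / 2))\<^sup>2" using l(2)
        by (intro mult_left_mono power_mono) auto
      also have "\<dots> = x" using that by simp
      finally show "a \<in> {a. a \<in> side_pairs h \<and> real (fst a * snd a) \<le> x}" using l
        by (simp add: pq)
    qed
  qed auto
  have up: "S x \<le> side_harm h (sqrt x)" for x
    unfolding harm S_def
  proof (rule sum_mono2[OF finA])
    show "{a. a \<in> side_pairs h \<and> real (fst a * snd a) \<le> x} \<subseteq> ?A (sqrt x)"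
    proof
      fix a assume a: "a \<in> {a. a \<in> side_pairs h \<and> real (fst a * snd a) \<le> x}"
      obtain p q where pq: "a = (p, q)" by (cases a)
      have l: "(p, q) \<in> side_pairs h" "real p * real q \<le> x" using a by (auto simp: pq)
      have "real p * real p \<le> real p * real q" using side_pairs_less[OF l(1)]
        by (intro mult_left_mono) auto
      then have "(real p)\<^sup>2 \<le> x" unfolding power2_eq_square using l(2)
        by (rule order_trans)
      then have "real p \<le> sqrt x" by (rule real_le_rsqrt)
      then show "a \<in> ?A (sqrt x)" using l(1) by (auto simp: pq side_pairs_def)
    qed
  qed auto
  have l2: "ln (sqrt 3) = ln 3 / 2" by (simp add: ln_sqrt)
  \<comment> \<open>Cutting p off at sqrt (x/c) halves the logarithm; with log (sqrt 3) = (log 3)/2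
    this accounts for the 4 in the denominator.\<close>
  have lim: "((\<lambda>x. side_harm h (sqrt (x / c)) / ln (sqrt (x / c)) * (ln (sqrt (x / c)) / ln x))
      \<longlongrightarrow> ln (sqrt 3) / (real h)\<^sup>2 * (1 / 2)) at_top" if "c > 0" for c
  proof (rule tendsto_mult)
    have "filterlim (\<lambda>x. sqrt (x / c)) at_top at_top" using that by real_asymp
    from filterlim_compose[OF side_harm_limit[OF assms] this]
    show "((\<lambda>x. side_harm h (sqrt (x / c)) / ln (sqrt (x / c))) \<longlongrightarrow> ln (sqrt 3) / (real h)\<^sup>2) at_top" .
    show "((\<lambda>x. ln (sqrt (x / c)) / ln x) \<longlongrightarrow> 1 / 2) at_top" using that
      by real_asymp
  qed
  have lim': "((\<lambda>x. side_harm h (sqrt (x / c)) / ln x) \<longlongrightarrow> ln 3 / (4 * (real h)\<^sup>2)) at_top"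
    if c: "c > 0" for c
  proof -
    have "\<forall>\<^sub>F x in at_top. side_harm h (sqrt (x / c)) / ln (sqrt (x / c)) * (ln (sqrt (x / c)) / ln x)
        = side_harm h (sqrt (x / c)) / ln x"
    proof -
      have "\<forall>\<^sub>F x in at_top. ln (sqrt (x / c)) > 0" using c by real_asymp
      then show ?thesis by eventually_elim simp
    qed
    from Lim_transform_eventually[OF lim[OF c] this] show ?thesis by (simp add: l2)
  qed
  have "((\<lambda>x. S x / ln x) \<longlongrightarrow> ln 3 / (4 * (real h)\<^sup>2)) at_top"
  proof (rule tendsto_sandwich[OF _ _ lim'[of 2] lim'[of 1]])
    show "\<forall>\<^sub>F x in at_top. side_harm h (sqrt (x / 2)) / ln x \<le> S x / ln x"
      using eventually_gt_at_top[of 1] by eventually_elim (auto intro!: divide_right_mono lo)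
    show "\<forall>\<^sub>F x in at_top. S x / ln x \<le> side_harm h (sqrt (x / 1)) / ln x"
      using eventually_gt_at_top[of 1] by eventually_elim (auto intro!: divide_right_mono up)
  qed auto
  then show ?thesis by (simp add: S_def)
qed

theorem A_square_asymptotics:
  "(\<lambda>x. real (A_square x) - ln 3 / (2 * pi) * (x * ln x)) \<in> o[at_top](\<lambda>x. x * ln x)"
proof -
  define w where "w = (\<lambda>x::nat \<times> nat. fst x * snd x)"
  define E where "E = cnt (side_pairs 1 \<times> prim) (\<lambda>p. w (fst p) * gnorm (snd p))"
  define U where "U = cnt (side_pairs 2 \<times> prim_odd) (\<lambda>p. w (fst p) * gnorm (snd p))"
  have wpos: "0 < w a" if "a \<in> side_pairs h" for a h using that
    by (auto simp: w_def side_pairs_def)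
  have wfin: "finite {a \<in> side_pairs h. real (w a) \<le> x}" for h x unfolding w_def
    by (rule side_pairs_finite)
  have wle: "cnt (side_pairs h) w x \<le> 2 * x" if "x > 0" for h x unfolding w_def
    by (rule cnt_side_pairs_le[OF that])
  have wh: "((\<lambda>x. (\<Sum>a | a \<in> side_pairs h \<and> real (w a) \<le> x. 1 / real (w a)) / ln x)
    \<longlongrightarrow> ln 3 / (4 * (real h)\<^sup>2)) at_top" if "0 < h" "h \<le> 2" for h
    unfolding w_def by (rule side_pairs_harm_limit[OF that])
  have "((\<lambda>x. E x / (x * ln x)) \<longlongrightarrow> 6 / pi * (ln 3 / (4 * (real 1)\<^sup>2))) at_top"
    unfolding E_def
    by (rule cnt_Times_limit[OF prim_pos wpos wfin finite_gnorm_cnt cnt_prim_limit wle wh]) auto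
  then have El: "((\<lambda>x. E x / (x * ln x)) \<longlongrightarrow> 3 * ln 3 / (2 * pi)) at_top"
    by simp
  have "((\<lambda>x. U x / (x * ln x)) \<longlongrightarrow> 4 / pi * (ln 3 / (4 * (real 2)\<^sup>2))) at_top"
    unfolding U_def
    by (rule cnt_Times_limit[OF prim_odd_pos wpos wfin finite_gnorm_cnt cnt_prim_odd_limit wle wh]) auto
  then have Ul: "((\<lambda>x. U x / (x * ln x)) \<longlongrightarrow> ln 3 / (4 * pi)) at_top"
    by simp
  \<comment> \<open>\<open>E\<close> weighs by p q |z|^2, while the index in the even case is twice
    that; hence the argument x/2.\<close>
  have E2: "((\<lambda>x. E (x / 2) / (x / 2 * ln (x / 2)) * (x / 2 * ln (x / 2) / (x * ln x))) \<longlongrightarrow> 3 * ln 3 / (2 * pi) * (1 / 2)) at_top"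
  proof (rule tendsto_mult)
    have "filterlim (\<lambda>x::real. x / 2) at_top at_top" by real_asymp
    from filterlim_compose[OF El this]
    show "((\<lambda>x. E (x / 2) / (x / 2 * ln (x / 2))) \<longlongrightarrow> 3 * ln 3 / (2 * pi)) at_top" .
    show "((\<lambda>x::real. x / 2 * ln (x / 2) / (x * ln x)) \<longlongrightarrow> 1 / 2) at_top"
      by real_asymp
  qed
  \<comment> \<open>The square sublattices number only O(x) and do not contribute to the main
    term.\<close>
  have G: "((\<lambda>x. cnt (- {0}) gnorm x / x * (1 / ln x)) \<longlongrightarrow> pi * 0) at_top"
    by (intro tendsto_mult cnt_gauss_limit) real_asymp
  have "((\<lambda>x. 1 / 4 * (cnt (- {0}) gnorm x / x * (1 / ln x)
      + 2 * (E (x / 2) / (x / 2 * ln (x / 2)) * (x / 2 * ln (x / 2) / (x * ln x))) + 2 * (U x / (x * ln x))))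
      \<longlongrightarrow> 1 / 4 * (pi * 0 + 2 * (3 * ln 3 / (2 * pi) * (1 / 2)) + 2 * (ln 3 / (4 * pi)))) at_top"
    by (intro tendsto_intros G E2 Ul)
  moreover have "1 / 4 * (pi * 0 + 2 * (3 * ln 3 / (2 * pi) * (1 / 2)) + 2 * (ln 3 / (4 * pi))) = ln 3 / (2 * pi)"
    by (simp add: field_simps)
  moreover have "\<forall>\<^sub>F x in at_top. 1 / 4 * (cnt (- {0}) gnorm x / x * (1 / ln x)
      + 2 * (E (x / 2) / (x / 2 * ln (x / 2)) * (x / 2 * ln (x / 2) / (x * ln x))) + 2 * (U x / (x * ln x)))
      = real (A_square x) / (x * ln x)"
    using eventually_gt_at_top[of 2]
  proof eventually_elim
    case (elim x)
    then have x0: "x \<ge> 0" "x / 2 \<ge> 0" by auto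
    have e1: "E (x / 2) = real (\<Sum>n=1..nat \<lfloor>x\<rfloor>. card (rect_even n))"
    proof -
      have "E (x / 2) = cnt (side_pairs 1 \<times> prim) (\<lambda>x. 2 * (fst (fst x) * snd (fst x) * gnorm (snd x))) x"
        unfolding E_def cnt_def w_def
          by (rule arg_cong[where f = "\<lambda>A. real (card A)"]) (auto simp: field_simps)
      also have "\<dots> = real (\<Sum>n=1..nat \<lfloor>x\<rfloor>. card (rect_even n))"
        unfolding rect_even_def
        by (rule cnt_eq_sum(1)[OF _ _ x0(1)])
          (use a_square_eq(2) wpos prim_pos in \<open>auto simp: rect_even_def w_def\<close>)
      finally show ?thesis .
    qed
    have e2: "U x = real (\<Sum>n=1..nat \<lfloor>x\<rfloor>. card (rect_odd n))"
      unfolding U_def rect_odd_def w_def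
      by (rule cnt_eq_sum(1)[OF _ _ x0(1)])
        (use a_square_eq(3) wpos prim_odd_pos in \<open>auto simp: rect_odd_def w_def\<close>)
    have e3: "cnt (- {0}) gnorm x = real (\<Sum>n=1..nat \<lfloor>x\<rfloor>. repr2 n)"
    proof -
      have "card {z \<in> - {0}. gnorm z = n} = repr2 n"
        if "n \<in> {1..nat \<lfloor>x\<rfloor>}" for n
        using that by (auto simp: repr2_def gnorm_def intro!: arg_cong[where f = card])
      then show ?thesis
        using x0 by (subst cnt_eq_sum(1)) (auto intro: gnorm_pos finite_subset[OF _ finite_gnorm_eq])
    qed
    have "{n. 1 \<le> n \<and> real n \<le> x} = {1..nat \<lfloor>x\<rfloor>}"
      unfolding of_nat_le_real_iff[OF x0(1)]
        by (simp only: atLeastAtMost_def atLeast_def atMost_def Int_def mem_Collect_eq)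
    then have "4 * A_square x = (\<Sum>n=1..nat \<lfloor>x\<rfloor>. 4 * a_square n)"
      by (simp add: A_square_def sum_distrib_left)
    also have "\<dots> = (\<Sum>n=1..nat \<lfloor>x\<rfloor>. repr2 n + 2 * card (rect_even n) + 2 * card (rect_odd n))"
      by (intro sum.cong refl a_square_eq(1)) auto
    also have "\<dots> = (\<Sum>n=1..nat \<lfloor>x\<rfloor>. repr2 n) + 2 * (\<Sum>n=1..nat \<lfloor>x\<rfloor>. card (rect_even n))
        + 2 * (\<Sum>n=1..nat \<lfloor>x\<rfloor>. card (rect_odd n))"
      by (simp add: sum.distrib sum_distrib_left)
    finally have "real (4 * A_square x) = cnt (- {0}) gnorm x + 2 * E (x / 2) + 2 * U x"
      unfolding e1 e2 e3 by (simp only: of_nat_add of_nat_mult of_nat_numeral)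
    then have A: "real (A_square x) = 1 / 4 * (cnt (- {0}) gnorm x + 2 * E (x / 2) + 2 * U x)"
      by simp
    have "ln (x / 2) \<noteq> 0" "x \<noteq> 0" using elim by auto
    then have "E (x / 2) / (x / 2 * ln (x / 2)) * (x / 2 * ln (x / 2) / (x * ln x)) = E (x / 2) / (x * ln x)"
      by simp
    then show ?case unfolding A
      by (simp only: add_divide_distrib times_divide_eq_right[symmetric]) simp
  qed
  ultimately have L: "((\<lambda>x. real (A_square x) / (x * ln x)) \<longlongrightarrow> ln 3 / (2 * pi)) at_top"
    using Lim_transform_eventually by fastforce
  have ne: "\<forall>\<^sub>F x in at_top. x * ln x \<noteq> (0::real)"
    using eventually_gt_at_top[of 1] by eventually_elim auto
  show ?thesis
  proof (rule smalloI_tendsto)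
    have "((\<lambda>x. real (A_square x) / (x * ln x) - ln 3 / (2 * pi)) \<longlongrightarrow> ln 3 / (2 * pi) - ln 3 / (2 * pi)) at_top"
      by (intro tendsto_diff L tendsto_const)
    then have T: "((\<lambda>x. real (A_square x) / (x * ln x) - ln 3 / (2 * pi)) \<longlongrightarrow> 0) at_top"
      by simp
    show "((\<lambda>x. (real (A_square x) - ln 3 / (2 * pi) * (x * ln x)) / (x * ln x)) \<longlongrightarrow> 0) at_top"
    proof (rule Lim_transform_eventually[OF T])
      show "\<forall>\<^sub>F x in at_top. real (A_square x) / (x * ln x) - ln 3 / (2 * pi)
          = (real (A_square x) - ln 3 / (2 * pi) * (x * ln x)) / (x * ln x)"
        using ne by eventually_elim (simp only: diff_divide_distrib nonzero_mult_div_cancel_right simp_thms)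
    qed
  qed (rule ne)
qed

theorem theorem3p1:
  shows "(\<forall>s::complex. Re s > 1 \<longrightarrow>
            summable (\<lambda>n. norm (of_nat (a_square (Suc n)) * of_nat (Suc n) powr (- s))) \<and>
            Phi_square_wr s = Phi_square s + Phi_wr_even s + Phi_wr_odd s) \<and>
         (\<exists>F. F meromorphic_on {s. Re s > 1 / 2} \<and>
              (\<forall>s. Re s > 1 \<longrightarrow> F s = Phi_square_wr s) \<and>
              is_pole F 1 \<and> zorder F 1 = - 2 \<and>
              (\<forall>s. Re s \<ge> 1 \<and> s \<noteq> 1 \<longrightarrow> \<not> is_pole F s)) \<and>
         (\<forall>s::real. s > 1 \<longrightarrow>
            D_square s - Phi_square s < Phi_square_wr s \<and>
            Phi_square_wr s < D_square s + Phi_square s) \<and>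
         (\<lambda>x. real (A_square x) - ln 3 / (2 * pi) * (x * ln x)) \<in> o[at_top](\<lambda>x. x * ln x)"
proof (intro conjI allI impI exI[of _ "\<lambda>s. wr_reg s / (s - 1)\<^sup>2"])
  fix s :: complex assume s: "Re s > 1"
  show "summable (\<lambda>n. norm (of_nat (a_square (Suc n)) * of_nat (Suc n) powr (- s)))"
    "Phi_square_wr s = Phi_square s + Phi_wr_even s + Phi_wr_odd s"
    by (rule Phi_square_wr_decomposition[OF s])+
qed (use Phi_square_wr_continuation Phi_square_wr_bounds A_square_asymptotics in auto)

end
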